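(* Let $\{B(t)\}_{t\ge 0}$ be a standard Brownian motion, let $S(t):=\max_{0\le u\le t}B(u)$, and let $\mathcal A:=\int_0^1 S(t)\,\mathrm dt$. Then $\mathcal A$ has a density function $f_{\mathcal A}(x)$ given by, for $x>0$, \begin{align*} f_{\mathcal A}(x) &=\frac{2^{2/3}\Gamma(1/3)}{3^{1/2}\pi}\sum_{n=0}^\infty(-1)^n\frac{\Gamma(n+5/6)}{n!\,\Gamma(n+2/3)}\Bigl(\frac32\Bigr)^{n+1/2}x^{2n}\\ &\qquad+\frac{2^{2/3}\Gamma(1/3)}{3^{1/2}\pi}\sum_{n=0}^\infty(-1)^n\frac{\Gamma(n+7/6)}{n!\,\Gamma(n+4/3)}\Bigl(\frac32\Bigr)^{n+5/6}x^{2n+2/3}\\ &=\frac{2^{1/2}}{\pi^{1/2}}\;{}_1F_1\Bigl(\tfrac56;\tfrac23;-\tfrac32x^2\Bigr)+\frac{2^{-1/6}3^{1/3}}{\Gamma(5/6)}\,x^{2/3}\;{}_1F_1\Bigl(\tfrac76;\tfrac43;-\tfrac32x^2\Bigr)\\ &=e^{-\frac32x^2}\left(\frac{2^{1/2}}{\pi^{1/2}}\;{}_1F_1\Bigl(-\tfrac16;\tfrac23;\tfrac32x^2\Bigr)+\frac{2^{-1/6}3^{1/3}}{\Gamma(5/6)}\,x^{2/3}\;{}_1F_1\Bigl(\tfrac16;\tfrac43;\tfrac32x^2\Bigr)\right)\\ &=\frac{2^{7/6}}{\Gamma(2/3)}\,e^{-\frac32x^2}\,U\Bigl(-\tfrac16;\tfrac23;\tfrac32x^2\Bigr)\\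 &=\frac{2^{5/6}3^{1/3}}{\Gamma(2/3)}\,x^{2/3}e^{-\frac32x^2}\,U\Bigl(\tfrac16;\tfrac43;\tfrac32x^2\Bigr). \end{align*}
   Context: ${}_1F_1(a;b;z)=\sum_{n\ge0}\frac{(a)_n}{(b)_n}\frac{z^n}{n!}$ is the confluent hypergeometric function, where $(a)_n=a(a+1)\cdots(a+n-1)$. $U(a;b;z)$ is the confluent hypergeometric function of the second kind (Tricomi's function): for non-integer $b$ and $z>0$, $U(a;b;z)=\frac{\Gamma(1-b)}{\Gamma(a-b+1)}\,{}_1F_1(a;b;z)+\frac{\Gamma(b-1)}{\Gamma(a)}\,z^{1-b}\,{}_1F_1(a-b+1;2-b;z)$. *)

theory Defs
  imports "HOL-Probability.Probability"
begin

text \<open>Paths are required to be continuous at every point of the sample space, so that the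
  running maximum is attained everywhere. The values of \<^term>\<open>B t\<close> for \<^term>\<open>t < (0::real)\<close>
  are irrelevant.\<close>

locale standard_brownian_motion = prob_space M
  for M :: "'a measure" +
  fixes B :: "real \<Rightarrow> 'a \<Rightarrow> real"
  assumes measurable_at: "\<And>t. 0 \<le> t \<Longrightarrow> B t \<in> borel_measurable M"
    and starts_at_zero: "AE \<omega> in M. B 0 \<omega> = 0"
    and continuous_paths: "\<And>\<omega>. \<omega> \<in> space M \<Longrightarrow> continuous_on {0..} (\<lambda>t. B t \<omega>)"
    and normal_increments: "\<And>s t. 0 \<le> s \<Longrightarrow> s < t \<Longrightarrow>
      distributed M lborel (\<lambda>\<omega>. B t \<omega> - B s \<omega>) (normal_density 0 (sqrt (t - s)))"
    and independent_increments: "\<And>(n::nat) \<tau>. 0 \<le> \<tau> 0 \<Longrightarrow> (\<And>i. i < n \<Longrightarrow> \<tau> i < \<tau> (Suc i)) \<Longrightarrow>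
      indep_vars (\<lambda>_. borel) (\<lambda>i \<omega>. B (\<tau> (Suc i)) \<omega> - B (\<tau> i) \<omega>) {..<n}"

text \<open>The supremum below is a maximum when the path is continuous on \<^term>\<open>{0..t::real}\<close>.\<close>

definition running_max :: "(real \<Rightarrow> 'a \<Rightarrow> real) \<Rightarrow> real \<Rightarrow> 'a \<Rightarrow> real" where
  "running_max B t \<omega> = (SUP u\<in>{0..t}. B u \<omega>)"

definition running_max_area :: "(real \<Rightarrow> 'a \<Rightarrow> real) \<Rightarrow> 'a \<Rightarrow> real" where
  "running_max_area B \<omega> = (LBINT t:{0..1}. running_max B t \<omega>)"

definition hyp1F1 :: "real \<Rightarrow> real \<Rightarrow> real \<Rightarrow> real" where
  "hyp1F1 a b z = (\<Sum>n. pochhammer a n / pochhammer b n * (z ^ n / fact n))"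

text \<open>Tricomi's function, meaningful only for non-integer \<open>b\<close> and \<open>z > 0\<close>. At a pole of a Gamma
  function in a denominator, the library value \<open>Gamma = 0\<close> and division by zero give the
  usual convention that the reciprocal of Gamma vanishes there.\<close>

definition tricomi_U :: "real \<Rightarrow> real \<Rightarrow> real \<Rightarrow> real" where
  "tricomi_U a b z =
     Gamma (1 - b) / Gamma (a - b + 1) * hyp1F1 a b z
     + Gamma (b - 1) / Gamma a * z powr (1 - b) * hyp1F1 (a - b + 1) (2 - b) z"

end

theory Submission
  imports Defs "HOL-Real_Asymp.Real_Asymp"
begin

text \<open>
  Run the process up to an independent exponential time. For \<open>q(s) = 1 + \<theta> s\<close>, the resolvent
  \<open>F(s, y) = E \<integral> exp (- \<integral>\<^sub>0\<^sup>t q(S\<^sub>u) du) dt\<close>, started from maximum \<open>s\<close> and gap \<open>y = S - B\<close>, solves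
  \<open>F\<^sub>y\<^sub>y / 2 = q F - 1\<close> with \<open>F\<^sub>s + F\<^sub>y = 0\<close> at \<open>y = 0\<close>, and so is
  \<open>1 / q(s) + c(s) exp (- y sqrt (2 q(s)))\<close>, where \<open>c\<close> is a Laplace integral. The boundary condition makes
  \<open>F(s', y') - F(s, y)\<close>, over one step of a Gaussian random walk, a polynomial in the step up to
  an error controlled by the cubed step and the squared increment of the maximum. Summing the
  steps, with no stochastic calculus, and refining the walk gives the Laplace
  transform of \<open>T powr (3/2) * A\<close> for a standard exponential time \<open>T\<close> independent of the area \<open>A\<close>:
  it is that of \<open>3 / (2 sqrt 2) W G\<close> with independent \<open>W\<close> exponential and \<open>G\<close> of
  Gamma(2/3) law. Hence all moments of \<open>A\<close> are known, and they grow slowly enough to determine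
  the law.

  The candidate density is \<open>x powr (2/3) exp (- 3/2 x\<^sup>2) U (1/6) (4/3) (3/2 x\<^sup>2)\<close> up to a constant. The
  integral representation of \<open>U\<close> turns its moments into Beta integrals; that representation
  follows by comparing solutions of Kummer's equation through their behaviour at 0.
\<close>

section \<open>Gamma integrals and Laplace integrals\<close>

text \<open>The exponential time makes the problem homogeneous in time, and Brownian scaling turns
  the area up to time t into t^(3/2) times the area up to time 1. The boundary condition acquires
  constant coefficients in the variable p = q^(3/2): if g(p) = F(s, 0), then F_y = - sqrt(2 q) c and
  c = g - 1/q at y = 0 give g - \<beta> g' = p^(-2/3) with \<beta> = 3 \<theta> / (2 sqrt 2). The
  Laplace integral solving it equals E exp(- \<beta> W G) at p = 1; this is the origin of the factor
  3 / (2 sqrt 2), while the shape 2/3 comes from 1/q = p^(-2/3). On the way back only a mixture over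
  T is known. Moments separate T from A, since the n-th moment of T^(3/2) is Gamma(3n/2 + 1).
  Dividing by it also makes determinacy easy: the moments of W G grow like (n!)^2, too fast for the
  Taylor series of its characteristic function to converge, whereas the moment of A of order 2n,
  divided by (2n)!, is at most c^n / n!.\<close>

lemma has_bochner_integral_Gamma:
  fixes s p :: real
  assumes s: "0 < s" and p: "0 < p"
  shows "has_bochner_integral lborel (\<lambda>r. indicator {0<..} r * (r powr (s - 1) * exp (- p * r))) (Gamma s * p powr (- s))"
proof (rule has_bochner_integral_nn_integral)
  let ?G = "(\<integral>\<^sup>+r. ennreal (indicator {0<..} r * (r powr (s - 1) * exp (- p * r))) \<partial>lborel)"
  have "(\<integral>\<^sup>+t. ennreal (indicator {0..} t * t powr (s - 1) / exp t) \<partial>lborel)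
      = \<bar>p\<bar> * (\<integral>\<^sup>+r. ennreal (indicator {0..} (0 + p * r) * (0 + p * r) powr (s - 1) / exp (0 + p * r)) \<partial>lborel)"
    by (rule nn_integral_real_affine) (use p in auto)
  also have "\<dots> = p * (\<integral>\<^sup>+r. ennreal (p powr (s - 1)) * ennreal (indicator {0<..} r * (r powr (s - 1) * exp (- p * r))) \<partial>lborel)"
  proof -
    have *: "indicator {0..} (0 + p * r) * (0 + p * r) powr (s - 1) / exp (0 + p * r)
       = p powr (s - 1) * (indicator {0<..} r * (r powr (s - 1) * exp (- p * r)))" for r
      using p by (cases "r = 0") (auto simp: indicator_def exp_minus field_simps powr_mult zero_le_mult_iff)
    show ?thesis using p unfolding * by (simp add: ennreal_mult')
  qed
  also have "\<dots> = ennreal (p powr s) * ?G"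
    using p by (subst nn_integral_cmult) (auto simp: mult.assoc[symmetric] ennreal_mult'[symmetric] powr_mult_base)
  finally have "ennreal (Gamma s) = ennreal (p powr s) * ?G"
    using Gamma_conv_nn_integral_real[OF s] by simp
  hence "ennreal (p powr - s) * ennreal (Gamma s) = (ennreal (p powr - s) * ennreal (p powr s)) * ?G"
    by (simp add: mult.assoc)
  also have "ennreal (p powr - s) * ennreal (p powr s) = 1"
    using p by (subst ennreal_mult[symmetric]) (auto simp: powr_add[symmetric])
  finally show "?G = ennreal (Gamma s * p powr - s)"
    using s by (simp add: ennreal_mult[symmetric] mult.commute)
qed (use s p in \<open>auto intro!: less_imp_le[OF Gamma_real_pos]\<close>)

lemma nn_integral_Gamma:
  fixes s p :: real
  assumes s: "0 < s" and p: "0 < p"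
  shows "(\<integral>\<^sup>+r. ennreal (indicator {0<..} r * (r powr (s - 1) * exp (- p * r))) \<partial>lborel) = ennreal (Gamma s * p powr (- s))"
proof -
  note B = has_bochner_integral_Gamma[OF assms]
  show ?thesis
    by (subst nn_integral_eq_integral[OF has_bochner_integral_iff[THEN iffD1, OF B, THEN conjunct1]])
       (simp_all only: has_bochner_integral_integral_eq[OF B], simp)
qed

text \<open>The factor \<open>(1 + u) powr (- s)\<close> is itself a Gamma integral in
  \<open>r\<close>. After exchanging the integrals, the one in \<open>u\<close> is a Gamma integral
  for each \<open>r\<close>, and so is the one that remains.\<close>

lemma nn_integral_Beta:
  fixes a s :: real
  assumes a: "0 < a" "a < s"
  shows "(\<integral>\<^sup>+u. ennreal (indicator {0<..} u * (u powr (a - 1) * (1 + u) powr (- s))) \<partial>lborel)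
     = ennreal (Gamma a * Gamma (s - a) / Gamma s)"
proof -
  let ?I = "indicator {0<..} :: real \<Rightarrow> real"
  let ?E = "\<lambda>u r. (?I u * u powr (a - 1) * (?I r * (r powr (s - 1) * exp (- (1 + u) * r))))"
  have s: "0 < s" using a by simp
  have G: "0 < Gamma s" "0 < Gamma a" "0 < Gamma (s - a)" using a by auto
  have "(\<integral>\<^sup>+u. ennreal (?I u * (u powr (a - 1) * (1 + u) powr (- s))) \<partial>lborel)
     = (\<integral>\<^sup>+u. ennreal (1 / Gamma s) * (\<integral>\<^sup>+r. ennreal (?E u r) \<partial>lborel) \<partial>lborel)"
  proof (rule nn_integral_cong)
    fix u :: real
    show "ennreal (?I u * (u powr (a - 1) * (1 + u) powr (- s))) = ennreal (1 / Gamma s) * (\<integral>\<^sup>+r. ennreal (?E u r) \<partial>lborel)"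
    proof (cases "u > 0")
      case True
      have "(\<integral>\<^sup>+r. ennreal (?E u r) \<partial>lborel)
        = ennreal (?I u * u powr (a - 1)) * ennreal (Gamma s * (1 + u) powr (- s))"
        using True by (subst ennreal_mult, simp, simp) (subst nn_integral_cmult, simp, subst nn_integral_Gamma[OF s], auto)
      thus ?thesis using True G by (simp add: ennreal_mult[symmetric])
    qed simp
  qed
  also have "\<dots> = ennreal (1 / Gamma s) * (\<integral>\<^sup>+u. (\<integral>\<^sup>+r. ennreal (?E u r) \<partial>lborel) \<partial>lborel)"
    by (rule nn_integral_cmult) measurable
  also have "(\<integral>\<^sup>+u. (\<integral>\<^sup>+r. ennreal (?E u r) \<partial>lborel) \<partial>lborel)
     = (\<integral>\<^sup>+r. (\<integral>\<^sup>+u. ennreal (?E u r) \<partial>lborel) \<partial>lborel)"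
    by (rule lborel_pair.Fubini') measurable
  also have "\<dots> = (\<integral>\<^sup>+r. ennreal (Gamma a) * ennreal (?I r * (r powr (s - a - 1) * exp (- 1 * r))) \<partial>lborel)"
  proof (rule nn_integral_cong)
    fix r :: real
    show "(\<integral>\<^sup>+u. ennreal (?E u r) \<partial>lborel) = ennreal (Gamma a) * ennreal (?I r * (r powr (s - a - 1) * exp (- 1 * r)))"
    proof (cases "r > 0")
      case True
      have "(\<integral>\<^sup>+u. ennreal (?E u r) \<partial>lborel)
        = (\<integral>\<^sup>+u. ennreal (r powr (s - 1) * exp (- r)) * ennreal (?I u * (u powr (a - 1) * exp (- r * u))) \<partial>lborel)"
        using True by (intro nn_integral_cong) (auto simp: ennreal_mult[symmetric] indicator_def exp_add[symmetric] field_simps)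
      also have "\<dots> = ennreal (r powr (s - 1) * exp (- r)) * ennreal (Gamma a * r powr (- a))"
        by (subst nn_integral_cmult, simp, subst nn_integral_Gamma[OF a(1) True], auto)
      also have "\<dots> = ennreal (Gamma a) * ennreal (?I r * (r powr (s - a - 1) * exp (- 1 * r)))"
      proof -
        have "r powr (s - 1) * r powr (- a) = r powr (s - a - 1)"
          by (simp add: powr_add[symmetric] algebra_simps)
        thus ?thesis using True G by (simp add: ennreal_mult[symmetric] mult_ac)
      qed
      finally show ?thesis .
    qed simp
  qed
  also have "\<dots> = ennreal (Gamma a) * ennreal (Gamma (s - a))"
    using a by (subst nn_integral_cmult, simp, subst nn_integral_Gamma) auto
  also have "ennreal (1 / Gamma s) * (ennreal (Gamma a) * ennreal (Gamma (s - a))) = ennreal (Gamma a * Gamma (s - a) / Gamma s)"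
    using G by (simp add: ennreal_mult[symmetric])
  finally show ?thesis .
qed

section \<open>Differentiation of Laplace integrals\<close>

lemma exp_remainder_le:
  fixes v :: real
  shows "\<bar>exp (- v) - 1 + v\<bar> \<le> v\<^sup>2 * exp \<bar>v\<bar>"
proof -
  obtain t where t: "\<bar>t\<bar> \<le> \<bar>- v\<bar>" "exp (- v) = (\<Sum>m<2. (- v) ^ m / fact m) + exp t / fact 2 * (- v) ^ 2"
    using Maclaurin_exp_le[of "- v" 2] by blast
  have "exp (- v) - 1 + v = exp t / 2 * v\<^sup>2"
    using t(2) by (simp add: numeral_2_eq_2)
  moreover have "exp t \<le> exp \<bar>v\<bar>" using t(1) by simp
  hence "exp t / 2 * v\<^sup>2 \<le> exp \<bar>v\<bar> * v\<^sup>2"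
    using exp_gt_zero[of "\<bar>v\<bar>"] by (intro mult_right_mono) (linarith, simp)
  moreover have "0 \<le> exp t / 2 * v\<^sup>2" by simp
  ultimately show ?thesis unfolding mult.commute[of "v\<^sup>2"] by linarith
qed

lemma exp_ge_power_term:
  fixes v :: real
  assumes "0 \<le> v"
  shows "v ^ n / fact n \<le> exp v"
proof -
  have "(\<Sum>k\<in>{n}. v ^ k /\<^sub>R fact k) \<le> (\<Sum>k. v ^ k /\<^sub>R fact k)"
    using assms by (intro sum_le_suminf summable_exp_generic) auto
  thus ?thesis unfolding exp_def by (simp add: divide_inverse mult.commute)
qed

text \<open>Half of the exponential decay pays for the power: u^n is at most n! (2/x)^n exp(x u /
  2), and integrability is assumed at every positive rate, in particular at x/2.\<close>

lemma laplace_times_power: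
  fixes g :: "real \<Rightarrow> real"
  assumes [measurable]: "g \<in> borel_measurable borel" and g0: "\<And>u. u \<le> 0 \<Longrightarrow> g u = 0"
    and int: "\<And>x. 0 < x \<Longrightarrow> integrable lborel (\<lambda>u. exp (- x * u) * g u)" and x: "0 < x"
  shows "integrable lborel (\<lambda>u. exp (- x * u) * (u ^ n * g u))"
proof (rule Bochner_Integration.integrable_bound[OF integrable_mult_right[OF int]])
  show "0 < x / 2" using x by simp
  show "AE u in lborel. norm (exp (- x * u) * (u ^ n * g u)) \<le> norm (fact n * (2 / x) ^ n * (exp (- (x / 2) * u) * g u))"
  proof (rule AE_I2)
    fix u :: real
    show "norm (exp (- x * u) * (u ^ n * g u)) \<le> norm (fact n * (2 / x) ^ n * (exp (- (x / 2) * u) * g u))"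
    proof (cases "u \<le> 0")
      case False
      hence "(x * u / 2) ^ n / fact n \<le> exp (x * u / 2)"
        using x exp_ge_power_term[of "x * u / 2" n] by simp
      hence *: "(u * (x / 2)) ^ n \<le> fact n * exp (x * u / 2)"
        by (simp add: divide_le_eq mult_ac)
      have "u ^ n = (2 / x) ^ n * (u * (x / 2)) ^ n"
        unfolding power_mult_distrib[symmetric] using x by simp
      also have "\<dots> \<le> (2 / x) ^ n * (fact n * exp (x * u / 2))"
        using x by (intro mult_left_mono *) auto
      finally have "exp (- x * u) * u ^ n \<le> exp (- x * u) * ((2 / x) ^ n * (fact n * exp (x * u / 2)))"
        by (intro mult_left_mono) auto
      also have "\<dots> = fact n * (2 / x) ^ n * (exp (- x * u) * exp (x * u / 2))"
        by (simp only: mult_ac)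
      also have "exp (- x * u) * exp (x * u / 2) = exp (- (x / 2) * u)"
        unfolding exp_add[symmetric] by (simp add: field_simps)
      finally have "exp (- x * u) * u ^ n * \<bar>g u\<bar> \<le> fact n * (2 / x) ^ n * exp (- (x / 2) * u) * \<bar>g u\<bar>"
        by (intro mult_right_mono) auto
      thus ?thesis using False x by (simp add: abs_mult mult_ac)
    qed (simp add: g0)
  qed
qed simp

lemma laplace_has_real_derivative:
  fixes g :: "real \<Rightarrow> real"
  assumes [measurable]: "g \<in> borel_measurable borel" and g0: "\<And>u. u \<le> 0 \<Longrightarrow> g u = 0"
    and int: "\<And>x. 0 < x \<Longrightarrow> integrable lborel (\<lambda>u. exp (- x * u) * g u)" and x: "0 < x"
  shows "((\<lambda>x. \<integral>u. exp (- x * u) * g u \<partial>lborel) has_real_derivative - (\<integral>u. exp (- x * u) * (u * g u) \<partial>lborel)) (at x)"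
proof -
  define I where "I y = (\<integral>u. exp (- y * u) * g u \<partial>lborel)" for y
  define J where "J = (\<integral>u. exp (- x * u) * (u * g u) \<partial>lborel)"
  define K where "K = (\<integral>u. \<bar>exp (- (x/2) * u) * (u\<^sup>2 * g u)\<bar> \<partial>lborel)"
  have int1: "integrable lborel (\<lambda>u. exp (- x * u) * (u * g u))"
    using laplace_times_power[OF assms(1) g0 int x, of 1] by simp
  have int2: "integrable lborel (\<lambda>u. exp (- (x/2) * u) * (u\<^sup>2 * g u))"
    using laplace_times_power[OF assms(1) g0 int, of "x/2" 2] x by simp
  \<comment> \<open>The quadratic remainder of the exponential serves both signs of
    \<open>h\<close>. Its factor exp |h u| costs at most half of the decay because |h| < x/2, so
    \<open>K\<close> does not depend on \<open>h\<close>.\<close>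
  have bound: "\<bar>(I (x + h) - I x) / h + J\<bar> \<le> K * \<bar>h\<bar>" if h: "h \<noteq> 0" "\<bar>h\<bar> < x / 2" for h
  proof -
    have xh: "0 < x + h" using h x by linarith
    have I_eq: "I (x + h) - I x + h * J = (\<integral>u. exp (- (x + h) * u) * g u - exp (- x * u) * g u + h * (exp (- x * u) * (u * g u)) \<partial>lborel)"
      unfolding I_def J_def using int[OF xh] int[OF x] int1 by simp
    have "\<bar>I (x + h) - I x + h * J\<bar> \<le> (\<integral>u. h\<^sup>2 * \<bar>exp (- (x/2) * u) * (u\<^sup>2 * g u)\<bar> \<partial>lborel)"
      unfolding I_eq
    proof (rule order_trans[OF integral_abs_bound], rule integral_mono)
      fix u :: real
      show "\<bar>exp (- (x + h) * u) * g u - exp (- x * u) * g u + h * (exp (- x * u) * (u * g u))\<bar> \<le> h\<^sup>2 * \<bar>exp (- (x/2) * u) * (u\<^sup>2 * g u)\<bar>"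
      proof (cases "u \<le> 0")
        case False
        have *: "exp (- (x + h) * u) * g u - exp (- x * u) * g u + h * (exp (- x * u) * (u * g u)) = exp (- x * u) * (exp (- (h * u)) - 1 + h * u) * g u"
          by (simp add: algebra_simps exp_add[symmetric])
        have "\<bar>exp (- (x + h) * u) * g u - exp (- x * u) * g u + h * (exp (- x * u) * (u * g u))\<bar> \<le> exp (- x * u) * ((h * u)\<^sup>2 * exp \<bar>h * u\<bar>) * \<bar>g u\<bar>"
          unfolding * using exp_remainder_le[of "h * u"] by (simp add: abs_mult mult_right_mono)
        also have "\<dots> = exp (- x * u + \<bar>h * u\<bar>) * ((h * u)\<^sup>2 * \<bar>g u\<bar>)"
          by (simp only: exp_add mult_ac)
        also have "\<dots> \<le> exp (- (x/2) * u) * ((h * u)\<^sup>2 * \<bar>g u\<bar>)"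
        proof (intro mult_right_mono, subst exp_le_cancel_iff)
          have "\<bar>h\<bar> * u \<le> x / 2 * u" using h False by (intro mult_right_mono) auto
          moreover have "x * u = x / 2 * u + x / 2 * u" by simp
          moreover have "- x * u = - (x * u)" "- (x / 2) * u = - (x / 2 * u)" by simp_all
          moreover have "\<bar>h * u\<bar> = \<bar>h\<bar> * u" using False by (simp add: abs_mult)
          ultimately show "- x * u + \<bar>h * u\<bar> \<le> - (x / 2) * u" by linarith
        qed auto
        finally show ?thesis by (simp add: abs_mult power_mult_distrib mult_ac)
      qed (simp add: g0)
    next
      show "integrable lborel (\<lambda>u. \<bar>exp (- (x + h) * u) * g u - exp (- x * u) * g u + h * (exp (- x * u) * (u * g u))\<bar>)"
        by (intro integrable_abs Bochner_Integration.integrable_add Bochner_Integration.integrable_diff int xh x integrable_mult_right int1)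
    next
      show "integrable lborel (\<lambda>u. h\<^sup>2 * \<bar>exp (- (x/2) * u) * (u\<^sup>2 * g u)\<bar>)"
        by (intro integrable_mult_right integrable_abs int2)
    qed
    also have "\<dots> = h\<^sup>2 * K" unfolding K_def by simp
    finally have "\<bar>(I (x + h) - I x + h * J) / h\<bar> \<le> h\<^sup>2 * K / \<bar>h\<bar>"
      by (simp add: abs_divide divide_right_mono)
    also have "h\<^sup>2 * K / \<bar>h\<bar> = K * \<bar>h\<bar>"
      using h by (cases "0 < h") (auto simp: power2_eq_square)
    also have "(I (x + h) - I x + h * J) / h = (I (x + h) - I x) / h + J" using h by (simp add: field_simps)
    finally show ?thesis .
  qed
  have "(\<lambda>h. (I (x + h) - I x) / h + J) \<midarrow>0\<rightarrow> 0"
  proof (rule Lim_null_comparison)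
    show "\<forall>\<^sub>F h in at 0. norm ((I (x + h) - I x) / h + J) \<le> K * \<bar>h\<bar>"
      using bound x by (auto simp: eventually_at dist_real_def intro!: exI[of _ "x/2"])
    show "((\<lambda>h. K * \<bar>h\<bar>) \<longlongrightarrow> 0) (at 0)" by (auto intro!: tendsto_eq_intros)
  qed
  from tendsto_diff[OF this tendsto_const[of J]]
  have "(I has_real_derivative - J) (at x)" by (simp add: DERIV_def)
  thus ?thesis by (simp add: I_def[abs_def] J_def)
qed

section \<open>The confluent hypergeometric function\<close>

lemma summable_hyp1F1:
  fixes a b z :: real
  assumes b: "0 < b"
  shows "summable (\<lambda>n. pochhammer a n / pochhammer b n * (z ^ n / fact n))"
proof (rule summable_ratio_test)
  \<comment> \<open>\<open>K\<close> bounds |a + n| / (b + n) for every n, so past the index below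
    consecutive terms have ratio at most 1/2.\<close>
  define K where "K = max 1 (\<bar>a\<bar> / b)"
  have K: "1 \<le> K" "\<bar>a\<bar> \<le> K * b" using b by (auto simp: K_def field_simps max_def)
  fix n :: nat
  assume n: "nat \<lceil>2 * (K * \<bar>z\<bar>)\<rceil> \<le> n"
  have "\<bar>a + real n\<bar> \<le> \<bar>a\<bar> + real n" by simp
  also have "\<dots> \<le> K * b + K * real n" using K(2) mult_right_mono[OF K(1), of "real n"] by simp
  finally have r: "\<bar>a + real n\<bar> / (b + real n) \<le> K" using b by (simp add: field_simps)
  have q: "\<bar>z\<bar> * K / real (Suc n) \<le> 1 / 2" using n by (simp add: field_simps)
  have "pochhammer a (Suc n) / pochhammer b (Suc n) * (z ^ Suc n / fact (Suc n))
      = (a + real n) / (b + real n) * (z / real (Suc n)) * (pochhammer a n / pochhammer b n * (z ^ n / fact n))"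
    by (simp add: pochhammer_Suc mult_ac del: of_nat_Suc)
  hence "norm (pochhammer a (Suc n) / pochhammer b (Suc n) * (z ^ Suc n / fact (Suc n)))
      = (\<bar>a + real n\<bar> / (b + real n)) * (\<bar>z\<bar> / real (Suc n)) * norm (pochhammer a n / pochhammer b n * (z ^ n / fact n))"
    using b by (simp only: real_norm_def abs_mult abs_divide abs_of_nat) simp
  also have "\<dots> \<le> K * (\<bar>z\<bar> / real (Suc n)) * norm (pochhammer a n / pochhammer b n * (z ^ n / fact n))"
    by (intro mult_right_mono r) auto
  also have "\<dots> \<le> 1 / 2 * norm (pochhammer a n / pochhammer b n * (z ^ n / fact n))"
    using q by (intro mult_right_mono) (auto simp: mult.commute)
  finally show "norm (pochhammer a (Suc n) / pochhammer b (Suc n) * (z ^ Suc n / fact (Suc n)))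
    \<le> 1 / 2 * norm (pochhammer a n / pochhammer b n * (z ^ n / fact n))" .
qed simp

lemma hyp1F1_powser: "hyp1F1 a b z = (\<Sum>n. (pochhammer a n / pochhammer b n / fact n) * z ^ n)"
  by (simp add: hyp1F1_def)

lemma summable_hyp1F1_powser:
  fixes a b z :: real
  assumes "0 < b"
  shows "summable (\<lambda>n. (pochhammer a n / pochhammer b n / fact n) * z ^ n)"
  using summable_hyp1F1[OF assms, of a z] by simp

lemma diffs_hyp1F1:
  fixes a b :: real
  assumes b: "0 < b"
  shows "diffs (\<lambda>n. pochhammer a n / pochhammer b n / fact n) = (\<lambda>n. a / b * (pochhammer (a + 1) n / pochhammer (b + 1) n / fact n))"
proof
  fix n
  have "0 < pochhammer (b + 1) n" using b by (intro pochhammer_pos) auto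
  thus "diffs (\<lambda>n. pochhammer a n / pochhammer b n / fact n) n = a / b * (pochhammer (a + 1) n / pochhammer (b + 1) n / fact n)"
    using b by (simp add: diffs_def pochhammer_rec field_simps del: of_nat_Suc)
qed

lemma hyp1F1_has_real_derivative:
  assumes b: "0 < b"
  shows "(hyp1F1 a b has_real_derivative a / b * hyp1F1 (a + 1) (b + 1) z) (at z)"
proof -
  have "((\<lambda>z. \<Sum>n. (pochhammer a n / pochhammer b n / fact n) * z ^ n) has_real_derivative
      (\<Sum>n. diffs (\<lambda>n. pochhammer a n / pochhammer b n / fact n) n * z ^ n)) (at z)"
    by (rule termdiffs_strong_converges_everywhere) (rule summable_hyp1F1_powser[OF b])
  moreover have "(\<Sum>n. diffs (\<lambda>n. pochhammer a n / pochhammer b n / fact n) n * z ^ n) = a / b * hyp1F1 (a + 1) (b + 1) z"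
    unfolding diffs_hyp1F1[OF b] hyp1F1_powser
    unfolding mult.assoc by (rule suminf_mult) (use b in \<open>intro summable_hyp1F1_powser, simp\<close>)
  ultimately show ?thesis by (simp add: hyp1F1_powser[abs_def])
qed

lemma hyp1F1_0 [simp]: "hyp1F1 a b 0 = 1"
  unfolding hyp1F1_powser powser_zero by simp

lemma hyp1F1_pos:
  assumes "0 < a" "0 < b" "0 \<le> z"
  shows "0 < hyp1F1 a b z"
proof -
  have "0 < (\<Sum>n. pochhammer a n / pochhammer b n * (z ^ n / fact n))"
  proof (rule suminf_pos2[of _ 0])
    show "summable (\<lambda>n. pochhammer a n / pochhammer b n * (z ^ n / fact n))"
      by (rule summable_hyp1F1[OF assms(2)])
    show "0 \<le> pochhammer a n / pochhammer b n * (z ^ n / fact n)" for n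
      using assms by (intro divide_nonneg_nonneg mult_nonneg_nonneg) (auto simp: less_imp_le[OF pochhammer_pos])
  qed simp
  thus ?thesis by (simp add: hyp1F1_def)
qed

text \<open>Comparison of coefficients: if c_n are those of the function and d_n those of its
  derivative, then (n + b) d_n = (n + a) c_n. This is Kummer's equation z w'' + (b - z) w' = a w
  with both derivatives written as shifted functions.\<close>

lemma hyp1F1_ode:
  fixes a b z :: real
  assumes b: "0 < b"
  shows "z * (a / b * ((a + 1) / (b + 1) * hyp1F1 (a + 2) (b + 2) z)) + (b - z) * (a / b * hyp1F1 (a + 1) (b + 1) z)
    = a * hyp1F1 a b z"
proof -
  define c where "c n = pochhammer a n / pochhammer b n / fact n" for n
  define d where "d n = a / b * (pochhammer (a + 1) n / pochhammer (b + 1) n / fact n)" for n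
  have dc: "diffs c = d" unfolding c_def d_def by (rule diffs_hyp1F1[OF b])
  have dd: "diffs d = (\<lambda>n. a / b * ((a + 1) / (b + 1) * (pochhammer (a + 2) n / pochhammer (b + 2) n / fact n)))"
  proof
    fix n
    have "diffs d n = a / b * diffs (\<lambda>n. pochhammer (a + 1) n / pochhammer (b + 1) n / fact n) n"
      by (simp add: d_def diffs_def)
    also have "diffs (\<lambda>n. pochhammer (a + 1) n / pochhammer (b + 1) n / fact n) n
      = (a + 1) / (b + 1) * (pochhammer (a + 2) n / pochhammer (b + 2) n / fact n)"
      using diffs_hyp1F1[of "b + 1" "a + 1"] b by (simp add: add.assoc)
    finally show "diffs d n = a / b * ((a + 1) / (b + 1) * (pochhammer (a + 2) n / pochhammer (b + 2) n / fact n))" .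
  qed
  have s1: "(\<lambda>n. c n * z ^ n) sums hyp1F1 a b z"
    unfolding c_def hyp1F1_powser by (rule summable_sums[OF summable_hyp1F1_powser[OF b]])
  have s2: "(\<lambda>n. d n * z ^ n) sums (a / b * hyp1F1 (a + 1) (b + 1) z)"
    unfolding d_def hyp1F1_powser mult.assoc
    by (intro sums_mult summable_sums) (use b summable_hyp1F1_powser[of "b + 1" "a + 1" z] in simp)
  have s3: "(\<lambda>n. diffs d n * z ^ n) sums (a / b * ((a + 1) / (b + 1) * hyp1F1 (a + 2) (b + 2) z))"
    unfolding dd hyp1F1_powser mult.assoc
    by (intro sums_mult summable_sums) (use b summable_hyp1F1_powser[of "b + 2" "a + 2" z] in simp)
  have z: "z * (real n * x * z ^ (n - Suc 0)) = real n * x * z ^ n" for n x by (cases n) auto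
  have t1: "(\<lambda>n. real n * c n * z ^ n) sums (z * (a / b * hyp1F1 (a + 1) (b + 1) z))"
    using sums_mult[OF diffs_equiv[of c z], of z] s2 unfolding dc z by (auto simp: sums_iff)
  have t2: "(\<lambda>n. real n * d n * z ^ n) sums (z * (a / b * ((a + 1) / (b + 1) * hyp1F1 (a + 2) (b + 2) z)))"
    using sums_mult[OF diffs_equiv[of d z], of z] s3 unfolding z by (auto simp: sums_iff)
  have "real n * d n * z ^ n + b * (d n * z ^ n) - real n * c n * z ^ n - a * (c n * z ^ n) = 0" for n
  proof -
    have "d n = (a + real n) / (b + real n) * c n"
    proof -
      have "d n = diffs c n" by (simp add: dc)
      also have "\<dots> = (a + real n) / (b + real n) * c n"
        by (simp add: diffs_def c_def pochhammer_Suc mult.commute del: of_nat_Suc)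
      finally show ?thesis .
    qed
    hence "(real n + b) * d n = (real n + a) * c n" using b by (simp add: add.commute)
    hence "((real n + b) * d n - (real n + a) * c n) * z ^ n = 0" by simp
    thus ?thesis by (simp add: algebra_simps)
  qed
  moreover have "(\<lambda>n. real n * d n * z ^ n + b * (d n * z ^ n) - real n * c n * z ^ n - a * (c n * z ^ n)) sums
      (z * (a / b * ((a + 1) / (b + 1) * hyp1F1 (a + 2) (b + 2) z)) + b * (a / b * hyp1F1 (a + 1) (b + 1) z)
        - z * (a / b * hyp1F1 (a + 1) (b + 1) z) - a * hyp1F1 a b z)"
    by (intro sums_diff sums_add sums_mult s1 s2 t1 t2)
  ultimately have "(\<lambda>n. 0) sums (z * (a / b * ((a + 1) / (b + 1) * hyp1F1 (a + 2) (b + 2) z)) + b * (a / b * hyp1F1 (a + 1) (b + 1) z)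
        - z * (a / b * hyp1F1 (a + 1) (b + 1) z) - a * hyp1F1 a b z)" by simp
  from sums_unique2[OF sums_zero this] show ?thesis using b by (simp add: left_diff_distrib diff_divide_distrib)
qed

text \<open>The Cauchy product of the series on the right with that of exp(- z) has the required
  coefficients by the Chu-Vandermonde identity.\<close>

lemma hyp1F1_kummer_transformation:
  fixes a b z :: real
  assumes b: "0 < b"
  shows "hyp1F1 a b (- z) = exp (- z) * hyp1F1 (b - a) b z"
proof -
  define c where "c n = pochhammer (b - a) n / pochhammer b n / fact n" for n
  have 1: "summable (\<lambda>n. norm (c n * z ^ n))"
    by (rule powser_insidea[where x = "norm z + 1"]) (use summable_hyp1F1_powser[OF b] in \<open>simp_all add: c_def\<close>)
  have 2: "summable (\<lambda>n. norm ((- z) ^ n /\<^sub>R fact n))" by (rule summable_norm_exp)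
  have coeff: "(\<Sum>i\<le>n. (c i * z ^ i) * ((- z) ^ (n - i) /\<^sub>R fact (n - i))) = pochhammer a n / pochhammer b n / fact n * (- z) ^ n" for n
  proof -
    have V: "(\<Sum>k\<le>n. (pochhammer (b - a) k * pochhammer (- real n) k) / (fact k * pochhammer b k)) = pochhammer a n / pochhammer b n"
      using Vandermonde_pochhammer[of n b "b - a"] b by (simp add: atMost_atLeast0 add_pos_nonneg add_eq_0_iff2)
    have "(c i * z ^ i) * ((- z) ^ (n - i) /\<^sub>R fact (n - i)) = (- z) ^ n / fact n * ((pochhammer (b - a) i * pochhammer (- real n) i) / (fact i * pochhammer b i))" if "i \<le> n" for i
    proof -
      \<comment> \<open>Up to sign this is a falling factorial of n, which turns the terms of the
        Vandermonde sum into those of the Cauchy product.\<close>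
      have A: "pochhammer (- real n) i = (- 1) ^ i * (fact n / fact (n - i))"
        using that
      proof (induction i)
        case (Suc i)
        have "fact (n - i) = (real n - real i) * fact (n - Suc i)"
          using Suc.prems by (subst fact_reduce) (auto simp: of_nat_diff)
        hence *: "fact n / fact (n - Suc i) = (real n - real i) * (fact n / fact (n - i) :: real)"
          using Suc.prems by simp
        have "pochhammer (- real n) (Suc i) = (- 1) ^ i * (fact n / fact (n - i)) * (- real n + real i)"
          using Suc by (simp add: pochhammer_Suc)
        also have "\<dots> = (- 1) ^ Suc i * (fact n / fact (n - Suc i))"
          unfolding * by (simp add: algebra_simps)
        finally show ?case .
      qed simp
      have B: "(- z) ^ n = (- 1) ^ i * z ^ i * (- z) ^ (n - i)"
        using that by (simp add: power_mult_distrib[symmetric] power_add[symmetric])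
      have C: "(- 1) ^ i * (- 1 :: real) ^ i = 1" by (simp add: power_add[symmetric])
      have "(- z) ^ n / fact n * ((pochhammer (b - a) i * pochhammer (- real n) i) / (fact i * pochhammer b i))
        = ((- 1) ^ i * (- 1) ^ i) * ((c i * z ^ i) * ((- z) ^ (n - i) /\<^sub>R fact (n - i)))"
        unfolding A B by (simp add: c_def divide_inverse) (use C in \<open>simp add: field_simps\<close>)
      thus ?thesis unfolding C by simp
    qed
    hence "(\<Sum>i\<le>n. (c i * z ^ i) * ((- z) ^ (n - i) /\<^sub>R fact (n - i))) = (- z) ^ n / fact n * (\<Sum>i\<le>n. (pochhammer (b - a) i * pochhammer (- real n) i) / (fact i * pochhammer b i))"
      unfolding sum_distrib_left by (intro sum.cong) auto
    thus ?thesis by (simp add: V mult.commute)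
  qed
  have "hyp1F1 (b - a) b z * exp (- z) = (\<Sum>n. c n * z ^ n) * (\<Sum>n. (- z) ^ n /\<^sub>R fact n)"
    by (simp add: hyp1F1_powser c_def exp_def)
  also have "\<dots> = (\<Sum>n. pochhammer a n / pochhammer b n / fact n * (- z) ^ n)"
    unfolding Cauchy_product[OF 1 2] coeff ..
  also have "\<dots> = hyp1F1 a b (- z)" by (simp add: hyp1F1_powser)
  finally show ?thesis by (simp add: mult.commute)
qed

section \<open>An integral representation of Tricomi's function\<close>

text \<open>By the mean value theorem, removing the leading power from (1 + u)^c leaves a function
  that decays like u^(c - 1), hence one whose integral against u^(a - 1) converges at infinity when
  a + c < 1.\<close>

lemma powr_increment_bounds:
  fixes c u :: real
  assumes c: "0 < c" "c \<le> 1" and u: "0 < u"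
  shows "0 \<le> (1 + u) powr c - u powr c" "(1 + u) powr c - u powr c \<le> c * u powr (c - 1)"
proof -
  show "0 \<le> (1 + u) powr c - u powr c" using c u by (simp add: powr_mono2)
  have "\<exists>z. z > u \<and> z < 1 + u \<and> (1 + u) powr c - u powr c = ((1 + u) - u) * (c * z powr (c - 1))"
    using u by (intro MVT2) (auto intro!: derivative_eq_intros)
  then obtain z where z: "u < z" "(1 + u) powr c - u powr c = c * z powr (c - 1)" by auto
  have "z powr (c - 1) \<le> u powr (c - 1)" using z(1) u c by (intro powr_mono2') auto
  thus "(1 + u) powr c - u powr c \<le> c * u powr (c - 1)" using z(2) c by simp
qed

text \<open>The increment is the integral of c (t + u)^(c - 1) over t in [0, 1]. After an exchange
  of integrals, the substitution u = t v makes the inner one t^(a + c - 1) times a Beta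
  integral.\<close>

lemma nn_integral_powr_increment:
  fixes a c :: real
  assumes a: "0 < a" and c: "0 < c" and ac: "a + c < 1"
  shows "(\<integral>\<^sup>+u. ennreal (indicator {0<..} u * (u powr (a - 1) * ((1 + u) powr c - u powr c))) \<partial>lborel)
    = ennreal (c * (Gamma a * Gamma (1 - a - c) / Gamma (1 - c)) / (a + c))"
proof -
  let ?I = "indicator {0<..} :: real \<Rightarrow> real"
  let ?E = "\<lambda>u t. (?I u * (u powr (a - 1)) * (c * (t + u) powr (c - 1)) * indicator {0..1} t)"
  let ?C = "\<lambda>u. (\<integral>\<^sup>+t. ennreal (c * (t + u) powr (c - 1)) * indicator {0..1} t \<partial>lborel)"
  let ?B = "\<lambda>v. (?I v * (v powr (a - 1) * (1 + v) powr (- (1 - c))))"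
  define B where "B = Gamma a * Gamma (1 - a - c) / Gamma (1 - c)"
  have B: "0 < B" unfolding B_def using a c ac by auto
  have "(\<integral>\<^sup>+u. ennreal (?I u * (u powr (a - 1) * ((1 + u) powr c - u powr c))) \<partial>lborel)
     = (\<integral>\<^sup>+u. (\<integral>\<^sup>+t. ennreal (?E u t) \<partial>lborel) \<partial>lborel)"
  proof (rule nn_integral_cong)
    fix u :: real
    show "ennreal (?I u * (u powr (a - 1) * ((1 + u) powr c - u powr c)))
       = (\<integral>\<^sup>+t. ennreal (?E u t) \<partial>lborel)"
    proof (cases "0 < u")
      case True
      have "(?C u) = ennreal ((1 + u) powr c - (0 + u) powr c)"
        using True c by (intro nn_integral_FTC_Icc) (auto intro!: derivative_eq_intros)
      hence "ennreal (u powr (a - 1)) * (?C u)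
         = ennreal (u powr (a - 1) * ((1 + u) powr c - u powr c))"
        using True c powr_mono2[of c u "1 + u"] by (simp add: ennreal_mult)
      moreover have "ennreal (u powr (a - 1)) * (?C u)
        = (\<integral>\<^sup>+t. ennreal (u powr (a - 1)) * (ennreal (c * (t + u) powr (c - 1)) * indicator {0..1} t) \<partial>lborel)"
        by (rule nn_integral_cmult[symmetric]) measurable
      moreover have "\<dots> = (\<integral>\<^sup>+t. ennreal (?E u t) \<partial>lborel)"
        using True c by (intro nn_integral_cong) (auto simp: indicator_def ennreal_mult)
      ultimately show ?thesis using True by simp
    qed simp
  qed
  also have "\<dots> = (\<integral>\<^sup>+t. (\<integral>\<^sup>+u. ennreal (?E u t) \<partial>lborel) \<partial>lborel)"
    by (rule lborel_pair.Fubini') measurable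
  also have "\<dots> = (\<integral>\<^sup>+t. ennreal (c * B) * ennreal (indicator {0..1} t * t powr (a + c - 1)) \<partial>lborel)"
  \<comment> \<open>The point t = 0 is set aside because the substitution u = t v degenerates
    there.\<close>
  proof (rule nn_integral_cong_AE, rule AE_mp[OF AE_lborel_singleton[of "0::real"]], rule AE_I2, rule impI)
    fix t :: real
    assume t0: "t \<noteq> 0"
    show "(\<integral>\<^sup>+u. ennreal (?E u t) \<partial>lborel)
       = ennreal (c * B) * ennreal (indicator {0..1} t * t powr (a + c - 1))"
    proof (cases "t \<in> {0..1}")
      case True
      hence t: "0 < t" using t0 by auto
      have "(\<integral>\<^sup>+u. ennreal (?E u t) \<partial>lborel)
        = \<bar>t\<bar> * (\<integral>\<^sup>+v. ennreal (?I (0 + t * v) * ((0 + t * v) powr (a - 1)) * (c * (t + (0 + t * v)) powr (c - 1)) * indicator {0..1} t) \<partial>lborel)"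
        using t by (intro nn_integral_real_affine) auto
      also have "\<dots> = t * (\<integral>\<^sup>+v. ennreal (c * t powr (a + c - 2)) * ennreal (?B v) \<partial>lborel)"
      proof -
        have "?I (0 + t * v) * ((0 + t * v) powr (a - 1)) * (c * (t + (0 + t * v)) powr (c - 1)) * indicator {0..1} t
          = c * t powr (a + c - 2) * (?B v)" for v
        proof (cases "0 < v")
          case True
          have "t + t * v = t * (1 + v)" by (simp add: algebra_simps)
          moreover have "t powr (a + c - 2) = t powr (a - 1) * t powr (c - 1)" by (simp add: powr_add[symmetric])
          ultimately show ?thesis using True t \<open>t \<in> {0..1}\<close> by (simp add: powr_mult)
        next
          case False
          thus ?thesis using t by (simp add: zero_less_mult_iff)
        qed
        thus ?thesis using t c by (simp only: abs_of_pos ennreal_mult' powr_ge_zero mult_nonneg_nonneg less_imp_le)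
      qed
      also have "(\<integral>\<^sup>+v. ennreal (c * t powr (a + c - 2)) * ennreal (?B v) \<partial>lborel) = ennreal (c * t powr (a + c - 2)) * ennreal B"
        using a ac c nn_integral_Beta[of a "1 - c"]
        by (subst nn_integral_cmult) (auto simp: B_def algebra_simps)
      also have "ennreal t * (ennreal (c * t powr (a + c - 2)) * ennreal B) = ennreal (c * B) * ennreal (indicator {0..1} t * t powr (a + c - 1))"
      proof -
        have "t * t powr (a + c - 2) = t powr (a + c - 1)" using t by (simp add: powr_mult_base)
        thus ?thesis using t c B True by (simp add: ennreal_mult[symmetric] mult_ac)
      qed
      finally show ?thesis .
    qed simp
  qed
  also have "\<dots> = ennreal (c * B) * (\<integral>\<^sup>+t. ennreal (indicator {0..1} t * t powr (a + c - 1)) \<partial>lborel)"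
    by (rule nn_integral_cmult) measurable
  also have "(\<integral>\<^sup>+t. ennreal (indicator {0..1} t * t powr (a + c - 1)) \<partial>lborel) = ennreal (1 / (a + c))"
    using has_integral_powr_from_0[of "a + c - 1" 1] a c by (subst nn_integral_has_integral_lebesgue) auto
  finally show ?thesis unfolding B_def[symmetric] using a c B by (simp add: ennreal_mult[symmetric])
qed

text \<open>Its Laplace transform at x is to be Gamma(a) U(a; b; x), with c standing for b - a -
  1.\<close>

definition tricomi_kernel :: "real \<Rightarrow> real \<Rightarrow> real \<Rightarrow> real" where
  "tricomi_kernel a c u = indicator {0<..} u * (u powr (a - 1) * (1 + u) powr c)"

lemma tricomi_kernel_measurable [measurable]: "tricomi_kernel a c \<in> borel_measurable borel"
  unfolding tricomi_kernel_def[abs_def] by measurable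

lemma tricomi_kernel_eq_0: "u \<le> 0 \<Longrightarrow> tricomi_kernel a c u = 0"
  by (simp add: tricomi_kernel_def)

lemma integrable_tricomi_kernel:
  assumes a: "0 < a" and c: "0 < c" "c \<le> 1" and x: "0 < x"
  shows "integrable lborel (\<lambda>u. exp (- x * u) * tricomi_kernel a c u)"
proof (rule Bochner_Integration.integrable_bound)
  let ?g = "\<lambda>s u. indicator {0<..} u * (u powr (s - 1) * exp (- x * u))"
  show "integrable lborel (\<lambda>u. ?g a u + ?g (a + 1) u)"
    using has_bochner_integral_Gamma[of a x] has_bochner_integral_Gamma[of "a + 1" x] a x
    by (intro Bochner_Integration.integrable_add) (auto simp: has_bochner_integral_iff)
  show "AE u in lborel. norm (exp (- x * u) * tricomi_kernel a c u) \<le> norm (?g a u + ?g (a + 1) u)"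
  proof (rule AE_I2)
    fix u :: real
    show "norm (exp (- x * u) * tricomi_kernel a c u) \<le> norm (?g a u + ?g (a + 1) u)"
    proof (cases "0 < u")
      case True
      have "(1 + u) powr c \<le> 1 + u" using powr_mono[of c 1 "1 + u"] c True by simp
      hence "exp (- x * u) * (u powr (a - 1) * (1 + u) powr c) \<le> exp (- x * u) * (u powr (a - 1) * (1 + u))"
        by (intro mult_left_mono) auto
      also have "\<dots> = ?g a u + ?g (a + 1) u"
        using True powr_mult_base[of u "a - 1"] by (simp add: algebra_simps)
      finally show ?thesis using True by (simp add: tricomi_kernel_def)
    qed (simp add: tricomi_kernel_def)
  qed
qed measurable

text \<open>The combined integrand is the derivative of \<open>F u\<close>, which vanishes at both
  ends of the half-line. With derivatives in x taken under the integral, the identity is Kummer's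
  equation for b = a + c + 1.\<close>

lemma tricomi_kernel_ode:
  assumes a: "0 < a" and c: "0 < c" "c \<le> 1" and x: "0 < x"
  shows "x * (\<integral>u. exp (- x * u) * (u * (u * tricomi_kernel a c u)) \<partial>lborel)
     - (a + c + 1 - x) * (\<integral>u. exp (- x * u) * (u * tricomi_kernel a c u) \<partial>lborel)
     = a * (\<integral>u. exp (- x * u) * tricomi_kernel a c u \<partial>lborel)"
proof -
  note int = integrable_tricomi_kernel[OF a c]
  note i0 = int[OF x]
  have i1: "integrable lborel (\<lambda>u. exp (- x * u) * (u * tricomi_kernel a c u))"
    using laplace_times_power[OF _ tricomi_kernel_eq_0 int x, of 1] by simp
  have i2: "integrable lborel (\<lambda>u. exp (- x * u) * (u * (u * tricomi_kernel a c u)))"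
    using laplace_times_power[OF _ tricomi_kernel_eq_0 int x, of 2] by (simp add: power2_eq_square mult.assoc)
  define F where "F u = exp (- x * u) * u powr a * (1 + u) powr (c + 1)" for u
  define f where "f u = exp (- x * u) * (u powr (a - 1) * (1 + u) powr c) * (a + (a + c + 1 - x) * u - x * u * u)" for u
  have eq: "indicator {0<..} u *\<^sub>R f u = a * (exp (- x * u) * tricomi_kernel a c u)
      + (a + c + 1 - x) * (exp (- x * u) * (u * tricomi_kernel a c u)) - x * (exp (- x * u) * (u * (u * tricomi_kernel a c u)))" for u
    by (simp add: f_def tricomi_kernel_def algebra_simps)
  have "(LBINT u=0..\<infinity>. f u) = 0 - 0"
  proof (rule interval_integral_FTC_integrable)
    fix u :: real assume "0 < ereal u"
    hence u: "0 < u" by simp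
    have "(F has_real_derivative f u) (at u)"
    proof -
      have 1: "u powr a = u * u powr (a - 1)" "(1 + u) powr (c + 1) = (1 + u) * (1 + u) powr c"
        using u by (simp_all add: powr_mult_base add.commute)
      have "(F has_real_derivative (- x * exp (- x * u)) * u powr a * (1 + u) powr (c + 1)
         + exp (- x * u) * (a * u powr (a - 1)) * (1 + u) powr (c + 1)
         + exp (- x * u) * u powr a * ((c + 1) * (1 + u) powr c)) (at u)"
        unfolding F_def[abs_def] using u by (auto intro!: derivative_eq_intros simp: algebra_simps)
      moreover have "(- x * exp (- x * u)) * u powr a * (1 + u) powr (c + 1)
         + exp (- x * u) * (a * u powr (a - 1)) * (1 + u) powr (c + 1)
         + exp (- x * u) * u powr a * ((c + 1) * (1 + u) powr c) = f u"
        unfolding 1 f_def by (simp add: algebra_simps)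
      ultimately show ?thesis by simp
    qed
    thus "(F has_vector_derivative f u) (at u)" by (simp add: has_real_derivative_iff_has_vector_derivative)
    show "isCont f u" unfolding f_def[abs_def] using u by (intro continuous_intros) auto
  next
    have "integrable lborel (\<lambda>u. indicator {0<..} u *\<^sub>R f u)"
      unfolding eq using i0 i1 i2 by (intro Bochner_Integration.integrable_add Bochner_Integration.integrable_diff integrable_mult_right)
    thus "set_integrable lborel (einterval 0 \<infinity>) f"
      by (simp add: set_integrable_def zero_ereal_def einterval_eq)
  next
    have "(F \<longlongrightarrow> 0) (at_right 0)" unfolding F_def using a by real_asymp
    thus "((F \<circ> real_of_ereal) \<longlongrightarrow> 0) (at_right 0)" by (simp add: zero_ereal_def ereal_tendsto_simps)
    have "(F \<longlongrightarrow> 0) at_top" unfolding F_def using x by real_asymp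
    thus "((F \<circ> real_of_ereal) \<longlongrightarrow> 0) (at_left \<infinity>)" by (simp add: ereal_tendsto_simps)
  qed simp
  moreover have "(LBINT u=0..\<infinity>. f u) = (\<integral>u. indicator {0<..} u *\<^sub>R f u \<partial>lborel)"
    by (simp add: interval_lebesgue_integral_def zero_ereal_def einterval_eq set_lebesgue_integral_def)
  ultimately have "(\<integral>u. indicator {0<..} u *\<^sub>R f u \<partial>lborel) = 0" by simp
  thus ?thesis unfolding eq using i0 i1 i2 by simp
qed

section \<open>Behaviour of the Laplace transform at the origin\<close>

lemma eventually_at_right_0I: "(\<And>x. 0 < x \<Longrightarrow> P x) \<Longrightarrow> \<forall>\<^sub>F x in at_right (0::real). P x"
  using eventually_at_right_less by (rule eventually_mono)

lemma constant_on_pos_tendsto: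
  fixes f :: "real \<Rightarrow> real"
  assumes "\<And>x. 0 < x \<Longrightarrow> (f has_real_derivative 0) (at x)" "(f \<longlongrightarrow> l) (at_right 0)" "0 < x"
  shows "f x = l"
proof -
  have "\<exists>k. \<forall>x\<in>{0<..}. f x = k"
    by (rule has_field_derivative_zero_constant) (auto intro: has_field_derivative_at_within assms(1))
  then obtain k where k: "\<And>x. 0 < x \<Longrightarrow> f x = k" by auto
  have "(f \<longlongrightarrow> k) (at_right 0)"
    by (rule tendsto_eventually[OF eventually_at_right_0I]) (rule k)
  from tendsto_unique[OF _ this assms(2)] k[OF assms(3)] show ?thesis by simp
qed

text \<open>The kernel splits into u^(a + c - 1), whose Laplace transform is the explicit singular
  power of x, and the remainder \<open>k\<close>, which is integrable with integral \<alpha>. The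
  first limit is therefore dominated convergence for \<open>k\<close>.\<close>

lemma tricomi_kernel_asymp_0:
  assumes a: "0 < a" and c: "0 < c" and ac: "a + c < 1"
  defines "\<alpha> \<equiv> c * (Gamma a * Gamma (1 - a - c) / Gamma (1 - c)) / (a + c)"
  shows "((\<lambda>x. (\<integral>u. exp (- x * u) * tricomi_kernel a c u \<partial>lborel) - Gamma (a + c) * x powr (- (a + c))) \<longlongrightarrow> \<alpha>) (at_right 0)"
    and "((\<lambda>x. x powr (a + c + 1) * (\<integral>u. exp (- x * u) * (u * tricomi_kernel a c u) \<partial>lborel)) \<longlongrightarrow> Gamma (a + c + 1)) (at_right 0)"
proof -
  let ?I = "\<lambda>x. (\<integral>u. exp (- x * u) * tricomi_kernel a c u \<partial>lborel)"
  let ?J = "\<lambda>x. (\<integral>u. exp (- x * u) * (u * tricomi_kernel a c u) \<partial>lborel)"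
  define k where "k u = indicator {0<..} u * (u powr (a - 1) * ((1 + u) powr c - u powr c))" for u :: real
  have [measurable]: "k \<in> borel_measurable borel" unfolding k_def[abs_def] by measurable
  have c1: "c \<le> 1" using a ac by simp
  have k0: "0 \<le> k u" for u using powr_increment_bounds(1)[OF c c1] by (auto simp: k_def indicator_def)
  have G: "0 < Gamma a" "0 < Gamma (1 - a - c)" "0 < Gamma (1 - c)" using a c ac by auto
  have "has_bochner_integral lborel k \<alpha>"
    by (rule has_bochner_integral_nn_integral)
       (use k0 a c G nn_integral_powr_increment[OF a c ac] in \<open>auto simp: k_def[symmetric] \<alpha>_def\<close>)
  hence ki: "integrable lborel k" "(\<integral>u. k u \<partial>lborel) = \<alpha>" by (auto simp: has_bochner_integral_iff)
  have powr_ac: "u powr (a - 1) * u powr c = u powr (a + c - 1)" for u :: real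
    by (simp add: powr_add[symmetric] algebra_simps)
  have T: "tricomi_kernel a c u = k u + indicator {0<..} u * u powr (a + c - 1)" for u
    by (auto simp: tricomi_kernel_def k_def powr_ac[symmetric] indicator_def algebra_simps)
  have eq1: "(?I x) - Gamma (a + c) * x powr (- (a + c)) = (\<integral>u. exp (- x * u) * k u \<partial>lborel)" if x: "0 < x" for x
  proof -
    have B: "has_bochner_integral lborel (\<lambda>u. indicator {0<..} u * (u powr (a + c - 1) * exp (- x * u))) (Gamma (a + c) * x powr (- (a + c)))"
      using has_bochner_integral_Gamma[of "a + c" x] a c x by simp
    have "(\<integral>u. exp (- x * u) * k u \<partial>lborel) = (\<integral>u. exp (- x * u) * tricomi_kernel a c u - indicator {0<..} u * (u powr (a + c - 1) * exp (- x * u)) \<partial>lborel)"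
      by (intro Bochner_Integration.integral_cong) (auto simp: T algebra_simps)
    also have "\<dots> = (?I x) - Gamma (a + c) * x powr (- (a + c))"
      using B integrable_tricomi_kernel[OF a c c1 x] by (subst Bochner_Integration.integral_diff) (auto simp: has_bochner_integral_iff)
    finally show ?thesis by simp
  qed
  \<comment> \<open>The limit at 0 from the right is taken as y = 1/x tends to infinity, the form in
    which dominated convergence is available.\<close>
  have "((\<lambda>y. \<integral>u. exp (- inverse y * u) * k u \<partial>lborel) \<longlongrightarrow> (\<integral>u. k u \<partial>lborel)) at_top"
  proof (rule integral_dominated_convergence_at_top[where w = k])
    show "AE u in lborel. ((\<lambda>y. exp (- inverse y * u) * k u) \<longlongrightarrow> k u) at_top"
    proof (rule AE_I2)
      fix u :: real
      have "((\<lambda>y. exp (- inverse y * u) * k u) \<longlongrightarrow> exp (- 0 * u) * k u) at_top"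
        by (intro tendsto_intros tendsto_inverse_0_at_top filterlim_ident)
      thus "((\<lambda>y. exp (- inverse y * u) * k u) \<longlongrightarrow> k u) at_top" by simp
    qed
    show "\<forall>\<^sub>F y in at_top. AE u in lborel. norm (exp (- inverse y * u) * k u) \<le> k u"
      using eventually_gt_at_top[of 0]
    proof eventually_elim
      case (elim y)
      have "exp (- inverse y * u) * k u \<le> k u" for u
        using k0[of u] elim c by (cases "0 < u") (auto simp: k_def powr_mono2 intro!: mult_left_le_one_le)
      thus ?case using k0 by (auto simp: abs_mult)
    qed
  qed (use ki in auto)
  hence "((\<lambda>x. \<integral>u. exp (- x * u) * k u \<partial>lborel) \<longlongrightarrow> \<alpha>) (at_right 0)"
    unfolding filterlim_at_right_to_top ki .
  thus "((\<lambda>x. (?I x) - Gamma (a + c) * x powr (- (a + c))) \<longlongrightarrow> \<alpha>) (at_right 0)"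
    by (rule Lim_transform_eventually[OF _ eventually_at_right_0I]) (rule eq1[symmetric])
  \<comment> \<open>Since u k(u) is at most c u^(a + c - 1), the remainder contributes O(x^(- a -
    c)), one power of x less singular than the main term.\<close>
  have bnd: "\<bar>x powr (a + c + 1) * (?J x) - Gamma (a + c + 1)\<bar> \<le> c * Gamma (a + c) * x" if x: "0 < x" for x
  proof -
    have B: "has_bochner_integral lborel (\<lambda>u. indicator {0<..} u * (u powr (a + c + 1 - 1) * exp (- x * u))) (Gamma (a + c + 1) * x powr (- (a + c + 1)))"
      using has_bochner_integral_Gamma[of "a + c + 1" x] a c x by simp
    have B2: "has_bochner_integral lborel (\<lambda>u. indicator {0<..} u * (u powr (a + c - 1) * exp (- x * u))) (Gamma (a + c) * x powr (- (a + c)))"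
      using has_bochner_integral_Gamma[of "a + c" x] a c x by simp
    have i1: "integrable lborel (\<lambda>u. exp (- x * u) * (u * tricomi_kernel a c u))"
      using laplace_times_power[OF _ tricomi_kernel_eq_0 integrable_tricomi_kernel[OF a c c1] x, of 1] by simp
    have eq: "exp (- x * u) * (u * k u) = exp (- x * u) * (u * tricomi_kernel a c u) - indicator {0<..} u * (u powr (a + c + 1 - 1) * exp (- x * u))" for u
      using powr_mult_base[of u "a + c - 1"] by (auto simp: T indicator_def algebra_simps)
    have ik: "integrable lborel (\<lambda>u. exp (- x * u) * (u * k u))"
      unfolding eq using B i1 by (intro Bochner_Integration.integrable_diff) (auto simp: has_bochner_integral_iff)
    have J: "(\<integral>u. exp (- x * u) * (u * k u) \<partial>lborel) = (?J x) - Gamma (a + c + 1) * x powr (- (a + c + 1))"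
      unfolding eq using B i1 by (subst Bochner_Integration.integral_diff) (auto simp: has_bochner_integral_iff)
    have nn: "0 \<le> (\<integral>u. exp (- x * u) * (u * k u) \<partial>lborel)"
      using k0 by (intro integral_nonneg_AE AE_I2) (auto simp: k_def indicator_def zero_le_mult_iff)
    have "(\<integral>u. exp (- x * u) * (u * k u) \<partial>lborel) \<le> (\<integral>u. c * (indicator {0<..} u * (u powr (a + c - 1) * exp (- x * u))) \<partial>lborel)"
    proof (rule integral_mono[OF ik])
      show "integrable lborel (\<lambda>u. c * (indicator {0<..} u * (u powr (a + c - 1) * exp (- x * u))))"
        using B2 by (auto simp: has_bochner_integral_iff)
      fix u :: real
      show "exp (- x * u) * (u * k u) \<le> c * (indicator {0<..} u * (u powr (a + c - 1) * exp (- x * u)))"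
      proof (cases "0 < u")
        case True
        have "u * k u \<le> u * (u powr (a - 1) * (c * u powr (c - 1)))"
          using True powr_increment_bounds(2)[OF c c1 True] by (simp add: k_def mult_left_mono)
        also have "\<dots> = c * u powr (a + c - 1)"
          using True by (simp add: powr_mult_base powr_add[symmetric] mult_ac)
        finally have "exp (- x * u) * (u * k u) \<le> exp (- x * u) * (c * u powr (a + c - 1))"
          by (intro mult_left_mono) auto
        thus ?thesis using True by (simp add: mult_ac)
      qed (simp add: k_def)
    qed
    also have "\<dots> = c * (Gamma (a + c) * x powr (- (a + c)))" using B2 by (simp add: has_bochner_integral_iff)
    finally have le: "x powr (a + c + 1) * (\<integral>u. exp (- x * u) * (u * k u) \<partial>lborel) \<le> x powr (a + c + 1) * (c * (Gamma (a + c) * x powr (- (a + c))))"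
      by (intro mult_left_mono) auto
    have p1: "x powr (a + c + 1) * x powr (- (a + c)) = x" "x powr (a + c + 1) * x powr (- (a + c + 1)) = 1"
      using x by (simp_all add: powr_add[symmetric])
    have "x powr (a + c + 1) * (c * (Gamma (a + c) * x powr (- (a + c)))) = c * Gamma (a + c) * x"
      using p1(1) by (simp add: mult_ac) 
    moreover have "x powr (a + c + 1) * (?J x) - Gamma (a + c + 1) = x powr (a + c + 1) * (\<integral>u. exp (- x * u) * (u * k u) \<partial>lborel)"
      unfolding J using p1(2) by (simp add: right_diff_distrib mult_ac)
    moreover have "0 \<le> x powr (a + c + 1) * (\<integral>u. exp (- x * u) * (u * k u) \<partial>lborel)" using nn by simp
    ultimately show ?thesis using le by linarith
  qed
  have "((\<lambda>x. x powr (a + c + 1) * (?J x) - Gamma (a + c + 1)) \<longlongrightarrow> 0) (at_right 0)"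
  proof (rule Lim_null_comparison)
    show "\<forall>\<^sub>F x in at_right 0. norm (x powr (a + c + 1) * (?J x) - Gamma (a + c + 1)) \<le> c * Gamma (a + c) * x"
      using bnd by (intro eventually_at_right_0I) simp
    show "((\<lambda>x. c * Gamma (a + c) * x) \<longlongrightarrow> 0) (at_right 0)" by (auto intro!: tendsto_eq_intros)
  qed
  thus "((\<lambda>x. x powr (a + c + 1) * (?J x)) \<longlongrightarrow> Gamma (a + c + 1)) (at_right 0)"
    by (rule LIM_zero_cancel)
qed

text \<open>
  The difference \<open>D\<close> of the two sides solves Kummer's equation, and its Wronskian with the
  solution \<open>hyp1F1 a b\<close>, weighted by \<open>x powr b * exp (- x)\<close>, is constant. The behaviour at 0 shows
  that this constant and \<open>D\<close> itself vanish.
\<close>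

lemma tricomi_U_integral:
  fixes a b x :: real
  assumes a: "0 < a" and ab: "a + 1 < b" and b: "b < 2" and x: "0 < x"
  shows "(\<integral>u. exp (- x * u) * tricomi_kernel a (b - a - 1) u \<partial>lborel) = Gamma a * tricomi_U a b x"
proof -
  define c where "c = b - a - 1"
  have c: "0 < c" "c \<le> 1" and ac: "a + c < 1" and bc: "b = a + c + 1" using a ab b by (auto simp: c_def)
  note int = integrable_tricomi_kernel[OF a c]
  note T0 = tricomi_kernel_eq_0[of _ a c]
  define I where "I x = (\<integral>u. exp (- x * u) * tricomi_kernel a c u \<partial>lborel)" for x
  define J where "J x = (\<integral>u. exp (- x * u) * (u * tricomi_kernel a c u) \<partial>lborel)" for x
  define L where "L x = (\<integral>u. exp (- x * u) * (u * (u * tricomi_kernel a c u)) \<partial>lborel)" for x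
  have dI: "(I has_real_derivative - J x) (at x)" if "0 < x" for x
    unfolding I_def[abs_def] J_def by (rule laplace_has_real_derivative[OF _ T0 int that]) auto
  have dJ: "(J has_real_derivative - L x) (at x)" if "0 < x" for x
    unfolding J_def[abs_def] L_def
  proof (rule laplace_has_real_derivative[OF _ _ _ that])
    show "integrable lborel (\<lambda>u. exp (- x * u) * (u * tricomi_kernel a c u))" if "0 < x" for x
      using laplace_times_power[OF _ T0 int that, of 1] by simp
  qed (auto simp: T0)
  have odeI: "x * L x - (b - x) * J x = a * I x" if "0 < x" for x
    using tricomi_kernel_ode[OF a c that] by (simp add: I_def J_def L_def bc)

  define m where "m = hyp1F1 a b"
  define m' where "m' x = a / b * hyp1F1 (a + 1) (b + 1) x" for x
  define m'' where "m'' x = a / b * ((a + 1) / (b + 1) * hyp1F1 (a + 2) (b + 2) x)" for x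
  have b0: "0 < b" using a ab by simp
  have dm: "(m has_real_derivative m' x) (at x)" for x
    unfolding m_def m'_def by (rule hyp1F1_has_real_derivative[OF b0])
  have dm': "(m' has_real_derivative m'' x) (at x)" for x
    unfolding m'_def[abs_def] m''_def
    using hyp1F1_has_real_derivative[of "b + 1" "a + 1" x] b0 by (intro DERIV_cmult) (simp add: add.assoc)
  have odem: "x * m'' x + (b - x) * m' x = a * m x" for x
    using hyp1F1_ode[OF b0, of x a] by (simp add: m_def m'_def m''_def)

  define p where "p = a - b + 1"
  define q where "q = 2 - b"
  have q0: "0 < q" using b by (simp add: q_def)
  define v where "v = hyp1F1 p q"
  define v' where "v' x = p / q * hyp1F1 (p + 1) (q + 1) x" for x
  define v'' where "v'' x = p / q * ((p + 1) / (q + 1) * hyp1F1 (p + 2) (q + 2) x)" for x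
  have dv: "(v has_real_derivative v' x) (at x)" for x
    unfolding v_def v'_def by (rule hyp1F1_has_real_derivative[OF q0])
  have dv': "(v' has_real_derivative v'' x) (at x)" for x
    unfolding v'_def[abs_def] v''_def
    using hyp1F1_has_real_derivative[of "q + 1" "p + 1" x] q0 by (intro DERIV_cmult) (simp add: add.assoc)
  have odev: "x * v'' x + (q - x) * v' x = p * v x" for x
    using hyp1F1_ode[OF q0, of x p] by (simp add: v_def v'_def v''_def)
  \<comment> \<open>The second solution of Kummer's equation; as b > 1, it carries the singularity
    x^(1 - b) at 0.\<close>
  define w where "w x = x powr (1 - b) * v x" for x
  define w' where "w' x = x powr (1 - b) * ((1 - b) / x * v x + v' x)" for x
  define w'' where "w'' x = x powr (1 - b) * ((1 - b) * (- b) / x\<^sup>2 * v x + 2 * (1 - b) / x * v' x + v'' x)" for x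
  have dpow: "((\<lambda>x. x powr (1 - b)) has_real_derivative (1 - b) / x * x powr (1 - b)) (at x)" if "0 < x" for x :: real
  proof -
    have "x powr (1 - b - 1) = x powr (1 - b) / x" using that by (simp add: powr_diff powr_minus_divide)
    thus ?thesis using that by (auto intro!: derivative_eq_intros)
  qed
  have dw: "(w has_real_derivative w' x) (at x)" if "0 < x" for x
    using DERIV_mult[OF dpow[OF that] dv[of x]] by (simp add: w_def[abs_def] w'_def algebra_simps)
  have dw': "(w' has_real_derivative w'' x) (at x)" if x: "0 < x" for x
  proof -
    have "((\<lambda>x. (1 - b) / x * v x + v' x) has_real_derivative (- (1 - b) / x\<^sup>2) * v x + (1 - b) / x * v' x + v'' x) (at x)"
      using x by (auto intro!: derivative_eq_intros dv dv') (simp add: field_simps power2_eq_square)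
    from DERIV_mult[OF dpow[OF x] this]
    have "(w' has_real_derivative (1 - b) / x * x powr (1 - b) * ((1 - b) / x * v x + v' x)
       + ((- (1 - b) / x\<^sup>2) * v x + (1 - b) / x * v' x + v'' x) * x powr (1 - b)) (at x)"
      by (simp add: w'_def[abs_def])
    moreover have "(1 - b) / x * x powr (1 - b) * ((1 - b) / x * v x + v' x)
       + ((- (1 - b) / x\<^sup>2) * v x + (1 - b) / x * v' x + v'' x) * x powr (1 - b) = w'' x"
    proof -
      have "(1 - b) / x * ((1 - b) / x * v x) + (- (1 - b) / x\<^sup>2) * v x = (1 - b) * (- b) / x\<^sup>2 * v x"
        using x by (simp add: field_simps power2_eq_square)
      moreover have "e * P * (e * V + V1) + (g * V + e * V1 + V2) * P = P * (h * V + 2 * e * V1 + V2)"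
        if "e * (e * V) + g * V = h * V" for e g h P V V1 V2 :: real
        using that by algebra
      ultimately show ?thesis unfolding w''_def times_divide_eq_right[symmetric, of 2] by blast
    qed
    ultimately show ?thesis by simp
  qed
  have odew: "x * w'' x + (b - x) * w' x = a * w x" if x: "0 < x" for x
  proof -
    have "x * ((1 - b) * (- b) / x\<^sup>2 * v x + 2 * (1 - b) / x * v' x + v'' x) + (b - x) * ((1 - b) / x * v x + v' x)
       = (x * v'' x + (q - x) * v' x) + (b - 1) * v x"
      using x by (simp add: field_simps power2_eq_square q_def)
    also have "\<dots> = a * v x" unfolding odev by (simp add: p_def algebra_simps)
    finally have "x powr (1 - b) * (x * ((1 - b) * (- b) / x\<^sup>2 * v x + 2 * (1 - b) / x * v' x + v'' x) + (b - x) * ((1 - b) / x * v x + v' x)) = x powr (1 - b) * (a * v x)"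
      by simp
    thus ?thesis by (simp add: w_def w'_def w''_def algebra_simps)
  qed

  \<comment> \<open>The coefficients are read off the expansion of \<open>I\<close> at 0: \<beta>
    removes the singular power x^(1 - b), and \<alpha> removes the constant that is left.\<close>
  define \<alpha> where "\<alpha> = c * (Gamma a * Gamma (1 - a - c) / Gamma (1 - c)) / (a + c)"
  define \<beta> where "\<beta> = Gamma (a + c)"
  define D where "D x = I x - \<alpha> * m x - \<beta> * w x" for x
  define D' where "D' x = - J x - \<alpha> * m' x - \<beta> * w' x" for x
  define D'' where "D'' x = L x - \<alpha> * m'' x - \<beta> * w'' x" for x
  have dD: "(D has_real_derivative D' x) (at x)" if "0 < x" for x
    unfolding D_def[abs_def] D'_def using that by (intro DERIV_diff DERIV_cmult dI dm dw)
  have dD': "(D' has_real_derivative D'' x) (at x)" if "0 < x" for x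
    unfolding D'_def[abs_def] D''_def using DERIV_minus[OF dJ[OF that]] that by (intro DERIV_diff DERIV_cmult dm' dw') simp
  have odeD: "x * D'' x + (b - x) * D' x = a * D x" if "0 < x" for x
    using odeI[OF that] odem[of x] odew[OF that] unfolding D_def D'_def D''_def
    by algebra

  have m_lim: "(m \<longlongrightarrow> 1) (at_right 0)" 
    using DERIV_isCont[OF dm[of 0]] by (simp add: isCont_def m_def filterlim_at_split)
  have m'_lim: "(m' \<longlongrightarrow> m' 0) (at_right 0)"
    using DERIV_isCont[OF dm'[of 0]] by (simp add: isCont_def filterlim_at_split)
  have v_lim: "(v \<longlongrightarrow> 1) (at_right 0)" 
    using DERIV_isCont[OF dv[of 0]] by (simp add: isCont_def v_def filterlim_at_split)
  have v'_lim: "(v' \<longlongrightarrow> v' 0) (at_right 0)"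
    using DERIV_isCont[OF dv'[of 0]] by (simp add: isCont_def filterlim_at_split)
  \<comment> \<open>As b < 2, the correction x^(1 - b) (v x - 1) = x^(2 - b) ((v x - 1) / x) of the
    singular solution still vanishes at 0.\<close>
  have vq_lim: "((\<lambda>x. (v x - 1) / x) \<longlongrightarrow> v' 0) (at_right 0)"
    using dv[of 0] by (simp add: DERIV_def v_def filterlim_at_split)
  have pow_lim: "((\<lambda>x::real. x powr s) \<longlongrightarrow> 0) (at_right 0)" if "0 < s" for s
    using that by real_asymp
  have D_lim: "(D \<longlongrightarrow> 0) (at_right 0)"
  proof -
    have "((\<lambda>x. (I x - \<beta> * x powr (- (a + c))) - \<alpha> * m x - \<beta> * (x powr (2 - b) * ((v x - 1) / x))) \<longlongrightarrow> \<alpha> - \<alpha> * 1 - \<beta> * (0 * v' 0)) (at_right 0)"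
      using tricomi_kernel_asymp_0(1)[OF a c(1) ac] b
      by (intro tendsto_intros m_lim vq_lim pow_lim) (auto simp: I_def \<alpha>_def \<beta>_def)
    moreover have "(I x - \<beta> * x powr (- (a + c))) - \<alpha> * m x - \<beta> * (x powr (2 - b) * ((v x - 1) / x)) = D x" if "0 < x" for x
    proof -
      have "x powr (2 - b) = x * x powr (1 - b)" using that by (simp add: powr_mult_base)
      hence e: "x powr (2 - b) * ((v x - 1) / x) = x powr (1 - b) * (v x - 1)" using that by simp
      have "x powr (- (a + c)) = x powr (1 - b)" by (simp add: bc)
      thus ?thesis unfolding e D_def w_def by (simp add: algebra_simps)
    qed
    ultimately show ?thesis
      by (auto intro: Lim_transform_eventually[OF _ eventually_at_right_0I])
  qed
  have D'_lim: "((\<lambda>x. x powr b * D' x) \<longlongrightarrow> 0) (at_right 0)"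
  proof -
    have "((\<lambda>x. - (x powr b * J x) - \<alpha> * (x powr b * m' x) - \<beta> * ((1 - b) * v x + x * v' x)) \<longlongrightarrow>
       - Gamma b - \<alpha> * (0 * m' 0) - \<beta> * ((1 - b) * 1 + 0 * v' 0)) (at_right 0)"
      using tricomi_kernel_asymp_0(2)[OF a c(1) ac] b0
      by (intro tendsto_intros m'_lim v_lim v'_lim pow_lim) (auto simp: J_def bc)
    \<comment> \<open>The singular parts of the two derivatives cancel because Gamma(b) = (b - 1)
      Gamma(b - 1).\<close>
    moreover have "- Gamma b - \<alpha> * (0 * m' 0) - \<beta> * ((1 - b) * 1 + 0 * v' 0) = 0"
    proof -
      have "a + c \<notin> \<int>\<^sub>\<le>\<^sub>0" using a c by (auto elim!: nonpos_Ints_cases')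
      from Gamma_plus1[OF this] show ?thesis by (simp add: \<beta>_def bc algebra_simps)
    qed
    moreover have "- (x powr b * J x) - \<alpha> * (x powr b * m' x) - \<beta> * ((1 - b) * v x + x * v' x) = x powr b * D' x" if "0 < x" for x
    proof -
      have "x powr b * x powr (1 - b) = x" using that by (simp add: powr_add[symmetric])
      hence "x powr b * w' x = x * ((1 - b) / x * v x + v' x)" by (simp add: w'_def mult.assoc[symmetric])
      also have "\<dots> = (1 - b) * v x + x * v' x" using that by (simp add: field_simps)
      finally show ?thesis by (simp add: D'_def right_diff_distrib mult.left_commute[of _ \<beta>] mult.left_commute[of _ \<alpha>])
    qed
    ultimately show ?thesis
      by (auto intro: Lim_transform_eventually[OF _ eventually_at_right_0I])
  qed
  define W where "W x = x powr b * exp (- x) * (D x * m' x - D' x * m x)" for x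
  have "W x = 0" if x: "0 < x" for x
  proof (rule constant_on_pos_tendsto[OF _ _ x])
    fix x :: real assume x: "0 < x"
    have pb: "((\<lambda>x. x powr b) has_real_derivative b / x * x powr b) (at x)"
    proof -
      have "x powr (b - 1) = x powr b / x" using x by (simp add: powr_diff)
      thus ?thesis using x by (auto intro!: derivative_eq_intros)
    qed
    have "(W has_real_derivative (b / x * x powr b * exp (- x) - x powr b * exp (- x)) * (D x * m' x - D' x * m x)
       + x powr b * exp (- x) * (D x * m'' x - D'' x * m x)) (at x)"
    proof -
      have "((\<lambda>x. exp (- x)) has_real_derivative - exp (- x)) (at x)"
        by (auto intro!: derivative_eq_intros)
      from DERIV_mult[OF DERIV_mult[OF pb this] DERIV_diff[OF DERIV_mult[OF dD[OF x] dm'] DERIV_mult[OF dD'[OF x] dm]]]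
      show ?thesis unfolding W_def[abs_def] by (rule DERIV_cong) (simp add: algebra_simps)
    qed
    moreover have "(b / x * x powr b * exp (- x) - x powr b * exp (- x)) * (D x * m' x - D' x * m x)
       + x powr b * exp (- x) * (D x * m'' x - D'' x * m x) = 0"
    proof -
      have "(b - x) * (D x * m' x - D' x * m x) + (D x * (x * m'' x) - (x * D'' x) * m x) = 0"
        using odeD[OF x] odem[of x] by algebra
      hence "x powr b * exp (- x) / x * ((b - x) * (D x * m' x - D' x * m x) + (D x * (x * m'' x) - (x * D'' x) * m x)) = 0"
        by simp
      thus ?thesis using x by (simp add: field_simps)
    qed
    ultimately show "(W has_real_derivative 0) (at x)" by simp
  next
    have "((\<lambda>x. exp (- x) * (D x * (x powr b * m' x) - (x powr b * D' x) * m x)) \<longlongrightarrow> exp (- 0) * (0 * (0 * m' 0) - 0 * 1)) (at_right 0)"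
      by (intro tendsto_intros D_lim D'_lim m_lim m'_lim pow_lim b0)
    moreover have "exp (- x) * (D x * (x powr b * m' x) - (x powr b * D' x) * m x) = W x" for x
      by (simp add: W_def algebra_simps)
    ultimately show "(W \<longlongrightarrow> 0) (at_right 0)" by simp
  qed
  hence wr: "D x * m' x - D' x * m x = 0" if "0 < x" for x
    using that unfolding W_def by (metis exp_not_eq_zero mult_eq_0_iff powr_eq_0_iff less_irrefl)
  have mpos: "0 < m x" if "0 < x" for x unfolding m_def using a b0 that by (intro hyp1F1_pos) auto
  \<comment> \<open>A vanishing Wronskian makes \<open>D\<close> a constant multiple of
    \<open>m\<close>; the limits at 0 show that the constant is 0.\<close>
  have "D x / m x = 0"
  proof (rule constant_on_pos_tendsto[OF _ _ x])
    fix x :: real assume x: "0 < x"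
    have "((\<lambda>x. D x / m x) has_real_derivative (D' x * m x - D x * m' x) / (m x * m x)) (at x)"
      using mpos[OF x] by (intro DERIV_divide dD[OF x] dm) auto
    thus "((\<lambda>x. D x / m x) has_real_derivative 0) (at x)" using wr[OF x] by simp
  next
    have "((\<lambda>x. D x / m x) \<longlongrightarrow> 0 / 1) (at_right 0)" by (intro tendsto_intros D_lim m_lim) simp
    thus "((\<lambda>x. D x / m x) \<longlongrightarrow> 0) (at_right 0)" by simp
  qed
  hence "D x = 0" using mpos[OF x] by simp
  hence "I x = \<alpha> * m x + \<beta> * w x" by (simp add: D_def)
  also have "\<dots> = Gamma a * tricomi_U a b x"
  proof -
    \<comment> \<open>The definition of \<open>tricomi_U\<close> evaluates Gamma at -(a + c) and -c;
      one shift brings both into (0, 1), where \<alpha> is expressed.\<close>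
    have Gm: "Gamma (- s) = - Gamma (1 - s) / s" if "0 < s" "s < 1" for s :: real
    proof -
      have "- s \<notin> \<int>\<^sub>\<le>\<^sub>0" using that by (auto elim!: nonpos_Ints_cases')
      from Gamma_plus1[OF this] show ?thesis using that by (simp add: field_simps)
    qed
    have 1: "Gamma (1 - b) = - Gamma (1 - a - c) / (a + c)"
      using Gm[of "a + c"] a c ac by (simp add: bc algebra_simps)
    have 2: "Gamma (a - b + 1) = - Gamma (1 - c) / c"
      using Gm[of c] a c ac by (simp add: bc)
    have 3: "Gamma a \<noteq> 0" "Gamma (1 - c) \<noteq> 0" using a c ac by (auto intro!: less_imp_neq[THEN not_sym] Gamma_real_pos)
    have "\<alpha> = Gamma a * (Gamma (1 - b) / Gamma (a - b + 1))"
      unfolding 1 2 \<alpha>_def using c 3 by (simp add: mult_ac)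
    moreover have "\<beta> = Gamma (b - 1)" by (simp add: \<beta>_def bc)
    ultimately show ?thesis
      using 3 by (simp add: tricomi_U_def m_def w_def v_def p_def q_def algebra_simps)
  qed
  finally show ?thesis by (simp add: I_def c_def)
qed

section \<open>The resolvent of the killed maximum process\<close>

text \<open>The intermediate point of Taylor's formula lies between t - r and t, hence is
  nonnegative, and there the third derivative is at most 1 in absolute value. The hypothesis r \<le>
  t is the case of a step that does not cross the boundary.\<close>

lemma exp_minus_taylor3:
  fixes t r :: real
  assumes "0 \<le> t" "r \<le> t"
  shows "\<bar>exp (- (t - r)) - exp (- t) * (1 + r + r\<^sup>2 / 2)\<bar> \<le> \<bar>r\<bar> ^ 3"
proof (cases "r = 0")
  case False
  define d where "d m y = (- 1) ^ m * exp (- y)" for m :: nat and y :: real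
  have "\<exists>x. (if t - r < t then t - r < x \<and> x < t else t < x \<and> x < t - r) \<and>
    exp (- (t - r)) = (\<Sum>m<3. d m t / fact m * (t - r - t) ^ m) + d 3 x / fact 3 * (t - r - t) ^ 3"
  proof (rule Taylor[where a = "min t (t - r)" and b = "max t (t - r)"])
    show "\<forall>m x. m < 3 \<and> min t (t - r) \<le> x \<and> x \<le> max t (t - r) \<longrightarrow> DERIV (d m) x :> d (Suc m) x"
      unfolding d_def by (auto intro!: derivative_eq_intros)
  qed (use False in \<open>auto simp: d_def\<close>)
  then obtain x where x: "if t - r < t then t - r < x \<and> x < t else t < x \<and> x < t - r"
    "exp (- (t - r)) = (\<Sum>m<3. d m t / fact m * (t - r - t) ^ m) + d 3 x / fact 3 * (t - r - t) ^ 3" by blast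
  have "0 \<le> x" using x(1) assms by (auto split: if_splits)
  hence "exp (- x) \<le> 1" by simp
  have "exp (- (t - r)) - exp (- t) * (1 + r + r\<^sup>2 / 2) = exp (- x) / 6 * r ^ 3"
    unfolding x(2) by (simp add: d_def eval_nat_numeral algebra_simps)
  hence "\<bar>exp (- (t - r)) - exp (- t) * (1 + r + r\<^sup>2 / 2)\<bar> = \<bar>exp (- x) / 6 * r ^ 3\<bar>"
    by (rule arg_cong)
  also have "\<bar>exp (- x) / 6 * r ^ 3\<bar> = exp (- x) / 6 * \<bar>r\<bar> ^ 3"
    by (simp add: abs_mult power_abs)
  also have "\<dots> \<le> 1 * \<bar>r\<bar> ^ 3"
  proof (rule mult_right_mono)
    show "exp (- x) / 6 \<le> 1" using \<open>exp (- x) \<le> 1\<close> by linarith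
  qed simp
  finally show ?thesis by simp
qed simp

text \<open>
  By the Gamma integral, \<open>laplace_g \<beta> 0 p = \<integral>\<^sub>0\<^sup>\<infinity> exp (- w) (p + \<beta> w) powr (- 2/3) dw\<close>. In the form below
  the equation \<open>g - \<beta> g' = p powr (- 2/3)\<close>, which encodes the boundary condition of the
  resolvent, holds pointwise under the integral. The index \<open>n\<close> counts derivatives, up to sign.
\<close>

definition laplace_kernel :: "real \<Rightarrow> nat \<Rightarrow> real \<Rightarrow> real" where
  "laplace_kernel \<beta> n u = u ^ n * (indicator {0<..} u * (u powr (- 1/3) / (1 + \<beta> * u) / Gamma (2/3)))"

definition laplace_g :: "real \<Rightarrow> nat \<Rightarrow> real \<Rightarrow> real" where
  "laplace_g \<beta> n p = (\<integral>u. exp (- p * u) * laplace_kernel \<beta> n u \<partial>lborel)"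

lemma laplace_kernel_measurable [measurable]: "laplace_kernel \<beta> n \<in> borel_measurable borel"
  unfolding laplace_kernel_def[abs_def] by measurable

lemma laplace_g_measurable [measurable]: "laplace_g \<beta> n \<in> borel_measurable borel"
  unfolding laplace_g_def[abs_def] by measurable

lemma Gamma_two_thirds_pos: "0 < Gamma (2/3 :: real)" "Gamma (2/3 :: real) \<noteq> 0"
proof -
  show "0 < Gamma (2/3 :: real)" by (rule Gamma_real_pos) simp
  thus "Gamma (2/3 :: real) \<noteq> 0" by linarith
qed

lemma laplace_kernel_bounds:
  assumes "0 \<le> \<beta>"
  shows "0 \<le> laplace_kernel \<beta> n u"
    and "laplace_kernel \<beta> n u \<le> indicator {0<..} u * u powr (real n + 2/3 - 1) / Gamma (2/3)"
proof -
  show "0 \<le> laplace_kernel \<beta> n u" using assms by (auto simp: laplace_kernel_def indicator_def)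
  show "laplace_kernel \<beta> n u \<le> indicator {0<..} u * u powr (real n + 2/3 - 1) / Gamma (2/3)"
  proof (cases "0 < u")
    case True
    have "u powr (- 1/3) / (1 + \<beta> * u) \<le> u powr (- 1/3)" using assms True by (simp add: divide_le_eq mult_le_cancel_left1)
    hence "u ^ n * (u powr (- 1/3) / (1 + \<beta> * u)) \<le> u ^ n * u powr (- 1/3)" using True by (intro mult_left_mono) auto
    also have "u ^ n * u powr (- 1/3) = u powr (real n + 2/3 - 1)"
      using True by (simp add: powr_realpow[symmetric] powr_add[symmetric])
    finally have "u ^ n * (u powr (- 1/3) / (1 + \<beta> * u)) / Gamma (2/3) \<le> u powr (real n + 2/3 - 1) / Gamma (2/3)"
      using Gamma_two_thirds_pos by (intro divide_right_mono) auto
    thus ?thesis using True by (simp add: laplace_kernel_def)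
  qed (simp add: laplace_kernel_def)
qed

lemma laplace_g_integral_bound:
  assumes "0 < p"
  shows "has_bochner_integral lborel (\<lambda>u. exp (- p * u) * (indicator {0<..} u * u powr (real n + 2/3 - 1) / Gamma (2/3)))
    (Gamma (real n + 2/3) / Gamma (2/3) * p powr (- (real n + 2/3)))"
proof -
  have "has_bochner_integral lborel (\<lambda>u. (indicator {0<..} u * (u powr (real n + 2/3 - 1) * exp (- p * u))) / Gamma (2/3))
    ((Gamma (real n + 2/3) * p powr (- (real n + 2/3))) / Gamma (2/3))"
    using assms by (intro has_bochner_integral_divide_zero has_bochner_integral_Gamma) auto
  thus ?thesis by (simp add: mult_ac)
qed

lemma integrable_laplace_kernel:
  assumes "0 \<le> \<beta>" "0 < p"
  shows "integrable lborel (\<lambda>u. exp (- p * u) * laplace_kernel \<beta> n u)"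
proof (rule Bochner_Integration.integrable_bound[OF has_bochner_integral_iff[THEN iffD1, OF laplace_g_integral_bound[OF assms(2), of n], THEN conjunct1]])
  show "AE u in lborel. norm (exp (- p * u) * laplace_kernel \<beta> n u) \<le> norm (exp (- p * u) * (indicator {0<..} u * u powr (real n + 2/3 - 1) / Gamma (2/3)))"
  proof (rule AE_I2)
    fix u
    have "exp (- p * u) * laplace_kernel \<beta> n u \<le> exp (- p * u) * (indicator {0<..} u * u powr (real n + 2/3 - 1) / Gamma (2/3))"
      by (intro mult_left_mono laplace_kernel_bounds(2)[OF assms(1)]) simp
    moreover have "0 \<le> exp (- p * u) * laplace_kernel \<beta> n u"
      using laplace_kernel_bounds(1)[OF assms(1)] by simp
    ultimately show "norm (exp (- p * u) * laplace_kernel \<beta> n u) \<le> norm (exp (- p * u) * (indicator {0<..} u * u powr (real n + 2/3 - 1) / Gamma (2/3)))"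
      unfolding real_norm_def by linarith
  qed
qed measurable

lemma laplace_g_bounds:
  assumes "0 \<le> \<beta>" "0 < p"
  shows "0 \<le> laplace_g \<beta> n p" "laplace_g \<beta> n p \<le> Gamma (real n + 2/3) / Gamma (2/3) * p powr (- (real n + 2/3))"
proof -
  show "0 \<le> laplace_g \<beta> n p" unfolding laplace_g_def
    using laplace_kernel_bounds[OF assms(1), of n] by (intro integral_nonneg_AE) auto
  have "laplace_g \<beta> n p \<le> (\<integral>u. exp (- p * u) * (indicator {0<..} u * u powr (real n + 2/3 - 1) / Gamma (2/3)) \<partial>lborel)"
    unfolding laplace_g_def
    using laplace_kernel_bounds[OF assms(1), of n] laplace_g_integral_bound[OF assms(2), of n]
    by (intro integral_mono integrable_laplace_kernel[OF assms] mult_left_mono) (auto simp: has_bochner_integral_iff)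
  thus "laplace_g \<beta> n p \<le> Gamma (real n + 2/3) / Gamma (2/3) * p powr (- (real n + 2/3))"
    unfolding has_bochner_integral_integral_eq[OF laplace_g_integral_bound[OF assms(2), of n]] .
qed

lemma laplace_g_has_real_derivative:
  assumes "0 \<le> \<beta>" "0 < p"
  shows "(laplace_g \<beta> n has_real_derivative - laplace_g \<beta> (Suc n) p) (at p)"
proof -
  have "((\<lambda>x. \<integral>u. exp (- x * u) * laplace_kernel \<beta> n u \<partial>lborel) has_real_derivative - (\<integral>u. exp (- p * u) * (u * laplace_kernel \<beta> n u) \<partial>lborel)) (at p)"
    by (rule laplace_has_real_derivative[OF _ _ integrable_laplace_kernel[OF assms(1)] assms(2)]) (auto simp: laplace_kernel_def)
  thus ?thesis by (simp add: laplace_g_def[abs_def] laplace_kernel_def mult_ac)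
qed

lemma laplace_g_equation:
  assumes "0 \<le> \<beta>" "0 < p"
  shows "laplace_g \<beta> 0 p + \<beta> * laplace_g \<beta> 1 p = p powr (- 2/3)"
proof -
  have eq: "exp (- p * u) * laplace_kernel \<beta> 0 u + \<beta> * (exp (- p * u) * laplace_kernel \<beta> 1 u)
    = exp (- p * u) * (indicator {0<..} u * u powr (real 0 + 2/3 - 1) / Gamma (2/3))" for u
  proof (cases "0 < u")
    case True
    hence "1 + \<beta> * u > 0" using assms(1) by (simp add: add_pos_nonneg)
    hence "u powr (- 1/3) / (1 + \<beta> * u) + \<beta> * (u * (u powr (- 1/3) / (1 + \<beta> * u))) = u powr (- 1/3)"
      by (simp add: divide_simps) (simp add: algebra_simps)
    moreover define W where "W = u powr (- 1/3) / (1 + \<beta> * u)"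
    ultimately have W: "u powr (- 1/3) = W + \<beta> * (u * W)" by simp
    have "laplace_kernel \<beta> 0 u = W / Gamma (2/3)" "laplace_kernel \<beta> 1 u = u * (W / Gamma (2/3))"
      using True by (simp_all add: laplace_kernel_def W_def)
    moreover have "real 0 + 2/3 - 1 = (- 1/3 :: real)" by simp
    ultimately show ?thesis using True by (simp only: W) (simp add: algebra_simps add_divide_distrib)
  qed (simp add: laplace_kernel_def)
  have "laplace_g \<beta> 0 p + \<beta> * laplace_g \<beta> 1 p = (\<integral>u. exp (- p * u) * laplace_kernel \<beta> 0 u + \<beta> * (exp (- p * u) * laplace_kernel \<beta> 1 u) \<partial>lborel)"
    unfolding laplace_g_def using integrable_laplace_kernel[OF assms, of 0] integrable_laplace_kernel[OF assms, of 1] by simp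
  also have "\<dots> = p powr (- 2/3)"
    unfolding eq using laplace_g_integral_bound[OF assms(2), of 0] Gamma_two_thirds_pos by (simp add: has_bochner_integral_iff)
  finally show ?thesis .
qed

text \<open>The summand 1 is the rate of the independent exponential time.\<close>

definition kill_rate :: "real \<Rightarrow> real \<Rightarrow> real" where
  "kill_rate \<theta> s = 1 + \<theta> * s"

text \<open>With p = q^(3/2) and g the Laplace integral of order 0, this is c = F(s, 0) - 1/q = g(p)
  - p^(-2/3) = \<beta> g'(p), where \<open>laplace_g \<beta> 1\<close> is - g'.\<close>

definition resolvent_coeff :: "real \<Rightarrow> real \<Rightarrow> real" where
  "resolvent_coeff \<theta> s = - (3 * \<theta> / (2 * sqrt 2)) * laplace_g (3 * \<theta> / (2 * sqrt 2)) 1 (kill_rate \<theta> s powr (3/2))"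

definition resolvent :: "real \<Rightarrow> real \<Rightarrow> real \<Rightarrow> real" where
  "resolvent \<theta> s y = 1 / kill_rate \<theta> s + resolvent_coeff \<theta> s * exp (- sqrt (2 * kill_rate \<theta> s) * y)"

definition resolvent_dy :: "real \<Rightarrow> real \<Rightarrow> real \<Rightarrow> real" where
  "resolvent_dy \<theta> s y = - sqrt (2 * kill_rate \<theta> s) * resolvent_coeff \<theta> s * exp (- sqrt (2 * kill_rate \<theta> s) * y)"

lemma resolvent_measurable [measurable]:
  "(\<lambda>x. resolvent \<theta> (fst x) (snd x)) \<in> borel_measurable (borel \<Otimes>\<^sub>M borel)"
  "(\<lambda>x. resolvent_dy \<theta> (fst x) (snd x)) \<in> borel_measurable (borel \<Otimes>\<^sub>M borel)"
  unfolding resolvent_def resolvent_dy_def resolvent_coeff_def kill_rate_def by measurable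

section \<open>Bounds on the resolvent that are uniform in the maximum\<close>

lemma kill_rate_ge_1: "0 \<le> \<theta> \<Longrightarrow> 0 \<le> s \<Longrightarrow> 1 \<le> kill_rate \<theta> s"
  by (simp add: kill_rate_def)


lemma resolvent_0:
  assumes "0 \<le> \<theta>" "0 \<le> s"
  shows "resolvent \<theta> s 0 = laplace_g (3 * \<theta> / (2 * sqrt 2)) 0 (kill_rate \<theta> s powr (3/2))"
proof -
  have "0 < kill_rate \<theta> s" using kill_rate_ge_1[OF assms] by simp
  hence "(kill_rate \<theta> s powr (3/2)) powr (- 2/3) = 1 / kill_rate \<theta> s"
    by (simp add: powr_powr powr_minus_divide)
  thus ?thesis using laplace_g_equation[of "3 * \<theta> / (2 * sqrt 2)" "kill_rate \<theta> s powr (3/2)"] assms \<open>0 < kill_rate \<theta> s\<close>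
    by (simp add: resolvent_def resolvent_coeff_def)
qed

text \<open>Dropping the denominator 1 + \<beta> u of the kernel gives the decay p^(-5/3) =
  q^(-5/2). The bound by 1/q expresses that the resolvent is nonnegative on the boundary y =
  0.\<close>

lemma resolvent_coeff_bounds:
  assumes "0 \<le> \<theta>" "0 \<le> s"
  shows "resolvent_coeff \<theta> s \<le> 0" "- resolvent_coeff \<theta> s \<le> \<theta> * kill_rate \<theta> s powr (- 5/2)" "- resolvent_coeff \<theta> s \<le> 1 / kill_rate \<theta> s"
proof -
  define \<beta> where "\<beta> = 3 * \<theta> / (2 * sqrt 2)"
  define p where "p = kill_rate \<theta> s powr (3/2)"
  have q: "1 \<le> kill_rate \<theta> s" using kill_rate_ge_1[OF assms] .
  have \<beta>: "0 \<le> \<beta>" and p: "0 < p" using assms q by (auto simp: \<beta>_def p_def)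
  have c: "resolvent_coeff \<theta> s = - \<beta> * laplace_g \<beta> 1 p" by (simp add: resolvent_coeff_def \<beta>_def p_def)
  show "resolvent_coeff \<theta> s \<le> 0" unfolding c using laplace_g_bounds(1)[OF \<beta> p, of 1] \<beta> by simp
  have "Gamma (real 1 + 2/3) / Gamma (2/3) = (2/3 :: real)"
  proof -
    have "(2/3 :: real) \<notin> \<int>\<^sub>\<le>\<^sub>0" by (auto elim!: nonpos_Ints_cases')
    from Gamma_plus1[OF this] show ?thesis using Gamma_two_thirds_pos by (simp add: add.commute)
  qed
  from laplace_g_bounds(2)[OF \<beta> p, of 1, unfolded this]
  have "laplace_g \<beta> 1 p \<le> 2/3 * p powr (- (5/3))" by simp
  also have "p powr (- (5/3)) = kill_rate \<theta> s powr (- 5/2)" by (simp add: p_def powr_powr)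
  finally have "\<beta> * laplace_g \<beta> 1 p \<le> \<beta> * (2/3 * kill_rate \<theta> s powr (- 5/2))" using \<beta> by (intro mult_left_mono)
  also have "\<dots> = \<theta> / sqrt 2 * kill_rate \<theta> s powr (- 5/2)" by (simp add: \<beta>_def)
  also have "\<dots> \<le> \<theta> * kill_rate \<theta> s powr (- 5/2)"
    using assms by (intro mult_right_mono) (auto simp: divide_le_eq mult_le_cancel_left1)
  finally show "- resolvent_coeff \<theta> s \<le> \<theta> * kill_rate \<theta> s powr (- 5/2)" unfolding c by simp
  show "- resolvent_coeff \<theta> s \<le> 1 / kill_rate \<theta> s"
    using resolvent_0[OF assms] laplace_g_bounds(1)[OF \<beta> p, of 0] by (simp add: resolvent_def \<beta>_def p_def)
qed

lemma resolvent_bounds: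
  assumes "0 \<le> \<theta>" "0 \<le> s" "0 \<le> y"
  shows "0 \<le> resolvent \<theta> s y" "resolvent \<theta> s y \<le> 1 / kill_rate \<theta> s"
proof -
  note b = resolvent_coeff_bounds[OF assms(1,2)]
  have q: "1 \<le> kill_rate \<theta> s" using kill_rate_ge_1[OF assms(1,2)] .
  have e: "exp (- sqrt (2 * kill_rate \<theta> s) * y) \<le> 1" using q assms(3) by simp
  have "- resolvent_coeff \<theta> s * exp (- sqrt (2 * kill_rate \<theta> s) * y) \<le> - resolvent_coeff \<theta> s * 1"
    using e b(1) by (intro mult_left_mono) auto
  thus "0 \<le> resolvent \<theta> s y" using b(3) by (simp add: resolvent_def)
  have "resolvent_coeff \<theta> s * exp (- sqrt (2 * kill_rate \<theta> s) * y) \<le> 0"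
    using b(1) by (intro mult_nonpos_nonneg) auto
  thus "resolvent \<theta> s y \<le> 1 / kill_rate \<theta> s" by (simp add: resolvent_def)
qed

text \<open>These are the sizes of the y-derivatives up to order three. The growth q^(3/2) of the
  worst factor is beaten by the decay q^(-5/2) of the coefficient, so the unbounded killing rate
  does not enter.\<close>

lemma resolvent_coeff_power_bound:
  assumes "0 \<le> \<theta>" "0 \<le> s" "n \<le> 3"
  shows "- resolvent_coeff \<theta> s * sqrt (2 * kill_rate \<theta> s) ^ n \<le> 3 * \<theta>"
proof -
  define q where "q = kill_rate \<theta> s"
  have q: "1 \<le> q" using kill_rate_ge_1[OF assms(1,2)] by (simp add: q_def)
  have "sqrt (2 * q) ^ n \<le> sqrt (2 * q) ^ 3" using q assms(3) by (intro power_increasing) auto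
  also have "sqrt (2 * q) ^ 3 = 2 * sqrt 2 * q powr (3/2)"
  proof -
    have "sqrt (2 * q) ^ 3 = sqrt (2 * q) * sqrt (2 * q) * sqrt (2 * q)" by (simp add: eval_nat_numeral)
    also have "sqrt (2 * q) * sqrt (2 * q) = 2 * q" using q by simp
    also have "2 * q * sqrt (2 * q) = 2 * sqrt 2 * (q * sqrt q)" by (simp add: real_sqrt_mult)
    also have "q * sqrt q = q powr (3/2)" using q by (simp add: powr_half_sqrt[symmetric] powr_mult_base)
    finally show ?thesis .
  qed
  also have "\<dots> \<le> 3 * q powr (3/2)"
  proof (rule mult_right_mono)
    have "sqrt 2 \<le> 3/2" by (rule real_le_lsqrt) (auto simp: power2_eq_square)
    thus "2 * sqrt 2 \<le> (3::real)" by simp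
  qed simp
  finally have "- resolvent_coeff \<theta> s * sqrt (2 * q) ^ n \<le> - resolvent_coeff \<theta> s * (3 * q powr (3/2))"
    using resolvent_coeff_bounds(1)[OF assms(1,2)] by (intro mult_left_mono) auto
  also have "\<dots> \<le> (\<theta> * q powr (- 5/2)) * (3 * q powr (3/2))"
    using resolvent_coeff_bounds(2)[OF assms(1,2)] by (intro mult_right_mono) (auto simp: q_def)
  also have "\<dots> = 3 * \<theta> * q powr (- 1)"
  proof -
    have "q powr (- 5/2) * q powr (3/2) = q powr (- 1)" by (simp only: powr_add[symmetric]) simp
    thus ?thesis by (simp only: mult_ac)
  qed
  also have "\<dots> \<le> 3 * \<theta> * 1"
    using q assms(1) by (intro mult_left_mono) (auto simp: powr_minus_divide)
  finally show ?thesis by (simp add: q_def)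
qed

lemma resolvent_dy_bound:
  assumes "0 \<le> \<theta>" "0 \<le> s" "0 \<le> y"
  shows "\<bar>resolvent_dy \<theta> s y\<bar> \<le> 3 * \<theta>"
proof -
  have q: "1 \<le> kill_rate \<theta> s" using kill_rate_ge_1[OF assms(1,2)] .
  have e: "exp (- sqrt (2 * kill_rate \<theta> s) * y) \<le> 1" using q assms(3) by simp
  have "\<bar>resolvent_dy \<theta> s y\<bar> = (- resolvent_coeff \<theta> s * sqrt (2 * kill_rate \<theta> s) ^ 1) * exp (- sqrt (2 * kill_rate \<theta> s) * y)"
    using resolvent_coeff_bounds(1)[OF assms(1,2)] q by (simp add: resolvent_dy_def abs_mult)
  also have "\<dots> \<le> 3 * \<theta> * 1"
    using resolvent_coeff_bounds(1)[OF assms(1,2)] q e assms by (intro mult_mono resolvent_coeff_power_bound) auto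
  finally show ?thesis by simp
qed

text \<open>The boundary condition enters here: the s-derivative at y = 0 equals - F_y, that is
  sqrt(2 q) c. The second derivative along the boundary is bounded uniformly in \<open>s\<close>,
  and two applications of the mean value theorem conclude.\<close>

lemma resolvent_0_taylor:
  assumes "0 \<le> \<theta>" "0 \<le> s" "0 \<le> h"
  shows "\<bar>resolvent \<theta> (s + h) 0 - resolvent \<theta> s 0 - h * (sqrt (2 * kill_rate \<theta> s) * resolvent_coeff \<theta> s)\<bar> \<le> (4 * \<theta>\<^sup>2) * h\<^sup>2"
proof -
  define \<beta> where "\<beta> = 3 * \<theta> / (2 * sqrt 2)"
  have \<beta>: "0 \<le> \<beta>" using assms by (simp add: \<beta>_def)
  define q where "q = kill_rate \<theta>"
  define G where "G x = laplace_g \<beta> 0 (q x powr (3/2))" for x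
  define G' where "G' x = - (3/2 * \<theta> * sqrt (q x) * laplace_g \<beta> 1 (q x powr (3/2)))" for x
  define G'' where "G'' x = - (3/2 * \<theta> * (\<theta> / (2 * sqrt (q x))) * laplace_g \<beta> 1 (q x powr (3/2))) + 9/4 * \<theta>\<^sup>2 * q x * laplace_g \<beta> 2 (q x powr (3/2))" for x
  have q1: "1 \<le> q x" if "0 \<le> x" for x using kill_rate_ge_1[OF assms(1) that] by (simp add: q_def)
  have dq: "(q has_real_derivative \<theta>) (at x)" for x unfolding q_def kill_rate_def by (auto intro!: derivative_eq_intros)
  have dp: "((\<lambda>x. q x powr (3/2)) has_real_derivative 3/2 * \<theta> * sqrt (q x)) (at x)" if "0 \<le> x" for x
    using q1[OF that] by (auto intro!: derivative_eq_intros dq simp: powr_half_sqrt)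
  have dg: "((\<lambda>x. laplace_g \<beta> n (q x powr (3/2))) has_real_derivative - laplace_g \<beta> (Suc n) (q x powr (3/2)) * (3/2 * \<theta> * sqrt (q x))) (at x)" if "0 \<le> x" for x n
    by (rule DERIV_chain2[where f = "laplace_g \<beta> n" and g = "\<lambda>x. q x powr (3/2)", OF laplace_g_has_real_derivative[OF \<beta>] dp[OF that]])
       (use q1[OF that] in auto)
  have dG: "(G has_real_derivative G' x) (at x)" if "0 \<le> x" for x
    using dg[OF that, of 0] by (simp add: G_def[abs_def] G'_def mult_ac)
  have dG': "(G' has_real_derivative G'' x) (at x)" if x: "0 \<le> x" for x
  proof -
    have ds: "((\<lambda>x. sqrt (q x)) has_real_derivative \<theta> / (2 * sqrt (q x))) (at x)"
      using q1[OF x] by (auto intro!: derivative_eq_intros dq simp: field_simps)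
    have sq: "sqrt (q x) * sqrt (q x) = q x" using q1[OF x] by simp
    from DERIV_cmult[OF DERIV_mult[OF ds dg[OF x, of 1]], of "- (3/2 * \<theta>)"]
    have "(G' has_real_derivative - (3/2 * \<theta>) * (\<theta> / (2 * sqrt (q x)) * laplace_g \<beta> 1 (q x powr (3/2)) + (- laplace_g \<beta> (Suc 1) (q x powr (3/2)) * (3/2 * \<theta> * sqrt (q x))) * sqrt (q x))) (at x)"
      by (simp add: G'_def[abs_def] mult_ac)
    moreover have "- (3/2 * \<theta>) * (\<theta> / (2 * sqrt (q x)) * laplace_g \<beta> 1 (q x powr (3/2)) + (- laplace_g \<beta> (Suc 1) (q x powr (3/2)) * (3/2 * \<theta> * sqrt (q x))) * sqrt (q x)) = G'' x"
    proof -
      have "- (3/2 * \<theta>) * (T * L1 + (- L2 * (3/2 * \<theta> * S)) * S) = - (3/2 * \<theta> * T * L1) + 9/4 * \<theta>\<^sup>2 * Q * L2"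
        if "S * S = Q" for S Q L1 L2 T :: real
        unfolding that[symmetric] by (simp add: power2_eq_square algebra_simps)
      from this[OF sq] show ?thesis unfolding G''_def Suc_1 by blast
    qed
    ultimately show ?thesis by simp
  qed
  have np: "(2/3 :: real) \<notin> \<int>\<^sub>\<le>\<^sub>0" "(5/3 :: real) \<notin> \<int>\<^sub>\<le>\<^sub>0" by (auto elim!: nonpos_Ints_cases')
  have Ga1: "Gamma (real 1 + 2/3) / Gamma (2/3) = (2/3 :: real)"
    using Gamma_plus1[OF np(1)] Gamma_two_thirds_pos by (simp add: add.commute)
  have Ga2: "Gamma (real 2 + 2/3) / Gamma (2/3) = (10/9 :: real)"
  proof -
    have "Gamma (5/3 :: real) = 2/3 * Gamma (2/3)" "Gamma (8/3 :: real) = 5/3 * Gamma (5/3)"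
      using Gamma_plus1[OF np(1)] Gamma_plus1[OF np(2)] by (simp_all add: add.commute)
    hence "Gamma (8/3 :: real) = 10/9 * Gamma (2/3)" by simp
    thus ?thesis using Gamma_two_thirds_pos by simp
  qed
  \<comment> \<open>The two terms contribute at most 1/2 and 5/2 times the square of \<theta>,
    within the rounded constant 4.\<close>
  have bG'': "\<bar>G'' x\<bar> \<le> 4 * \<theta>\<^sup>2" if x: "0 \<le> x" for x
  proof -
    define p where "p = q x powr (3/2)"
    have p: "1 \<le> p" using q1[OF x] by (simp add: p_def ge_one_powr_ge_zero)
    have b1: "0 \<le> laplace_g \<beta> 1 p" "laplace_g \<beta> 1 p \<le> 2/3"
    proof -
      have "laplace_g \<beta> 1 p \<le> 2/3 * p powr (- (5/3))" using laplace_g_bounds(2)[OF \<beta>, of p 1, unfolded Ga1] p by simp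
      also have "\<dots> \<le> 2/3 * 1" using p powr_mono[of "- (5/3)" 0 p] by (intro mult_left_mono) auto
      finally show "laplace_g \<beta> 1 p \<le> 2/3" by simp
    qed (use laplace_g_bounds(1)[OF \<beta>, of p 1] p in auto)
    have b2: "0 \<le> q x * laplace_g \<beta> 2 p" "q x * laplace_g \<beta> 2 p \<le> 10/9"
    proof -
      have "laplace_g \<beta> 2 p \<le> 10/9 * p powr (- (8/3))" using laplace_g_bounds(2)[OF \<beta>, of p 2, unfolded Ga2] p by simp
      hence "q x * laplace_g \<beta> 2 p \<le> q x * (10/9 * p powr (- (8/3)))" using q1[OF x] by (intro mult_left_mono) auto
      also have "\<dots> = 10/9 * q x powr (- 3)" using q1[OF x] by (simp add: p_def powr_powr powr_mult_base)
      also have "\<dots> \<le> 10/9 * 1" using q1[OF x] powr_mono[of "- 3" 0 "q x"] by (intro mult_left_mono) auto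
      finally show "q x * laplace_g \<beta> 2 p \<le> 10/9" by simp
    qed (use laplace_g_bounds(1)[OF \<beta>, of p 2] p q1[OF x] in auto)
    have s: "1 \<le> sqrt (q x)" using q1[OF x] by simp
    have t1: "\<bar>3/2 * \<theta> * (\<theta> / (2 * sqrt (q x))) * laplace_g \<beta> 1 p\<bar> \<le> 3/4 * \<theta>\<^sup>2 * (2/3)"
    proof -
      have "3/2 * \<theta> * (\<theta> / (2 * sqrt (q x))) = 3/4 * \<theta>\<^sup>2 / sqrt (q x)" by (simp add: power2_eq_square)
      also have "\<dots> \<le> 3/4 * \<theta>\<^sup>2 / 1" using s by (intro divide_left_mono) auto
      finally have e: "3/2 * \<theta> * (\<theta> / (2 * sqrt (q x))) \<le> 3/4 * \<theta>\<^sup>2" by simp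
      have "3/2 * \<theta> * (\<theta> / (2 * sqrt (q x))) * laplace_g \<beta> 1 p \<le> 3/4 * \<theta>\<^sup>2 * (2/3)"
        by (rule mult_mono[OF e b1(2)]) (use b1 in auto)
      thus ?thesis using b1 assms(1) s by (simp add: abs_mult)
    qed
    have t2: "\<bar>9/4 * \<theta>\<^sup>2 * q x * laplace_g \<beta> 2 p\<bar> \<le> 9/4 * \<theta>\<^sup>2 * (10/9)"
    proof -
      have "9/4 * \<theta>\<^sup>2 * (q x * laplace_g \<beta> 2 p) \<le> 9/4 * \<theta>\<^sup>2 * (10/9)"
        by (rule mult_left_mono[OF b2(2)]) simp
      moreover have "0 \<le> 9/4 * \<theta>\<^sup>2 * (q x * laplace_g \<beta> 2 p)"
        by (rule mult_nonneg_nonneg[OF _ b2(1)]) simp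
      ultimately show ?thesis by (simp only: mult.assoc abs_of_nonneg)
    qed
    have "\<bar>G'' x\<bar> \<le> 3/4 * \<theta>\<^sup>2 * (2/3) + 9/4 * \<theta>\<^sup>2 * (10/9)"
      unfolding G''_def p_def[symmetric] using t1 t2 by linarith
    also have "\<dots> \<le> 4 * \<theta>\<^sup>2" by simp
    finally show ?thesis .
  qed
  have GG: "resolvent \<theta> x 0 = G x" if "0 \<le> x" for x using resolvent_0[OF assms(1) that] by (simp add: G_def \<beta>_def q_def)
  have G'eq: "sqrt (2 * kill_rate \<theta> s) * resolvent_coeff \<theta> s = G' s"
    by (simp add: G'_def resolvent_coeff_def \<beta>_def q_def real_sqrt_mult)
  have "\<bar>G (s + h) - G s - h * G' s\<bar> \<le> 4 * \<theta>\<^sup>2 * h\<^sup>2"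
  proof (cases "h = 0")
    case False
    hence h: "0 < h" using assms by simp
    have "\<exists>z. s < z \<and> z < s + h \<and> G (s + h) - G s = (s + h - s) * G' z"
      using h assms by (intro MVT2) (auto intro: dG)
    then obtain z where z: "s < z" "z < s + h" "G (s + h) - G s = h * G' z" by auto
    have "\<exists>y. s < y \<and> y < z \<and> G' z - G' s = (z - s) * G'' y"
      using z assms by (intro MVT2) (auto intro: dG')
    then obtain y where y: "s < y" "G' z - G' s = (z - s) * G'' y" by auto
    have "G (s + h) - G s - h * G' s = h * ((z - s) * G'' y)" unfolding z(3) y(2)[symmetric] by (simp add: algebra_simps)
    hence "\<bar>G (s + h) - G s - h * G' s\<bar> = h * ((z - s) * \<bar>G'' y\<bar>)" using h z by (simp add: abs_mult)
    also have "\<dots> \<le> h * (h * (4 * \<theta>\<^sup>2))" using h z y assms by (intro mult_left_mono mult_mono bG'') auto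
    finally show ?thesis by (simp add: power2_eq_square mult_ac)
  qed simp
  thus ?thesis unfolding G'eq using GG assms by simp
qed

text \<open>
  When \<open>z > y\<close> a new maximum is reached. The polynomial on the left then expands \<open>F\<close> across the
  boundary \<open>y = 0\<close>, and the boundary condition matches it with the new value to first order.
\<close>

lemma resolvent_step:
  assumes "0 \<le> \<theta>" "0 \<le> s" "0 \<le> y"
  shows "\<bar>resolvent \<theta> (s + max 0 (z - y)) (max 0 (y - z))
     - (resolvent \<theta> s y - z * resolvent_dy \<theta> s y + z\<^sup>2 * (kill_rate \<theta> s * resolvent \<theta> s y - 1))\<bar>
     \<le> (6 * \<theta> + 4 * \<theta>\<^sup>2) * (\<bar>z\<bar> ^ 3 + (max 0 (z - y))\<^sup>2)"
proof -
  let ?P = "(resolvent \<theta> s y - z * resolvent_dy \<theta> s y + z\<^sup>2 * (kill_rate \<theta> s * resolvent \<theta> s y - 1))"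
  let ?N = "resolvent \<theta> (s + max 0 (z - y)) (max 0 (y - z))"
  define q where "q = kill_rate \<theta> s"
  define c where "c = resolvent_coeff \<theta> s"
  define k where "k = sqrt (2 * q)"
  have q: "1 \<le> q" using kill_rate_ge_1[OF assms(1,2)] by (simp add: q_def)
  have k: "0 \<le> k" "k\<^sup>2 = 2 * q" using q by (auto simp: k_def)
  have c: "c \<le> 0" using resolvent_coeff_bounds(1)[OF assms(1,2)] by (simp add: c_def)
  have ck: "- c * k ^ n \<le> 3 * \<theta>" if "n \<le> 3" for n
    using resolvent_coeff_power_bound[OF assms(1,2) that] by (simp add: c_def k_def q_def)
  \<comment> \<open>Because F_yy / 2 = q F - 1, the polynomial is the Taylor polynomial of degree
    two in z of F(s, y - z).\<close>
  have poly: "resolvent \<theta> s y - z * resolvent_dy \<theta> s y + z\<^sup>2 * (kill_rate \<theta> s * resolvent \<theta> s y - 1)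
    = 1 / q + c * (exp (- (k * y)) * (1 + k * z + (k * z)\<^sup>2 / 2))"
    unfolding resolvent_def resolvent_dy_def q_def[symmetric] c_def[symmetric] k_def[symmetric]
    using q k(2) by (simp add: field_simps)
  show ?thesis
  proof (cases "z \<le> y")
    case True
    have "?N = 1 / q + c * exp (- (k * y - k * z))"
      unfolding resolvent_def using True
      by (simp add: q_def[symmetric] c_def[symmetric]) (simp add: k_def algebra_simps)
    hence "?N - ?P
      = c * (exp (- (k * y - k * z)) - exp (- (k * y)) * (1 + k * z + (k * z)\<^sup>2 / 2))"
      unfolding poly by (simp add: algebra_simps)
    hence "\<bar>?N - ?P\<bar>
      = - c * \<bar>exp (- (k * y - k * z)) - exp (- (k * y)) * (1 + k * z + (k * z)\<^sup>2 / 2)\<bar>"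
      using c by (simp add: abs_mult)
    also have "\<dots> \<le> - c * \<bar>k * z\<bar> ^ 3"
      using c k True assms by (intro mult_left_mono exp_minus_taylor3) (auto intro: mult_left_mono)
    also have "\<dots> = (- c * k ^ 3) * \<bar>z\<bar> ^ 3" using k by (simp add: abs_mult power_mult_distrib)
    also have "\<dots> \<le> 3 * \<theta> * \<bar>z\<bar> ^ 3" using ck[of 3] by (intro mult_right_mono) auto
    also have "\<dots> \<le> (6 * \<theta> + 4 * \<theta>\<^sup>2) * (\<bar>z\<bar> ^ 3 + (max 0 (z - y))\<^sup>2)"
      using assms(1) by (intro mult_mono) auto
    finally show ?thesis .
  next
    case False
    \<comment> \<open>In units of 1/k, \<open>a\<close> is the distance to the boundary and
      \<open>b\<close> the overshoot beyond it.\<close>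
    define a where "a = k * y"
    define b where "b = k * (z - y)"
    have a: "0 \<le> a" and b: "0 \<le> b" using k assms False by (auto simp: a_def b_def)
    have kz: "k * z = a + b" by (simp add: a_def b_def algebra_simps)
    define R1 where "R1 = resolvent \<theta> (s + (z - y)) 0 - resolvent \<theta> s 0 - (z - y) * (k * c)"
    have R1: "\<bar>R1\<bar> \<le> 4 * \<theta>\<^sup>2 * (z - y)\<^sup>2"
      unfolding R1_def k_def q_def c_def using assms False by (intro resolvent_0_taylor) auto
    have r0: "resolvent \<theta> s 0 = 1 / q + c" by (simp add: resolvent_def q_def c_def)
    have "?N = 1 / q + c * (1 + b) + R1"
      using False r0 by (simp add: R1_def b_def algebra_simps)
    hence "?N - ?P
       = R1 - c * (exp (- a) * (1 + (a + b) + (a + b)\<^sup>2 / 2) - (1 + b))"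
      unfolding poly kz a_def[symmetric] by (simp add: algebra_simps)
    \<comment> \<open>Regrouped by powers of the overshoot: the three terms are bounded by a^3, b
      a^2 and b^2, after the first-order value 1 + b required by the boundary condition has been
      removed.\<close>
    also have "exp (- a) * (1 + (a + b) + (a + b)\<^sup>2 / 2) - (1 + b) =
       (exp (- a) * (1 + a + a\<^sup>2 / 2) - 1) + b * (exp (- a) * (1 + a) - 1) + exp (- a) * b\<^sup>2 / 2"
      by (simp add: power2_eq_square algebra_simps)
    finally have eq: "?N - ?P
       = R1 - c * ((exp (- a) * (1 + a + a\<^sup>2 / 2) - 1) + b * (exp (- a) * (1 + a) - 1) + exp (- a) * b\<^sup>2 / 2)" .
    have e1: "\<bar>exp (- a) * (1 + a + a\<^sup>2 / 2) - 1\<bar> \<le> a ^ 3"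
      using exp_minus_taylor3[of a a] a by simp
    have e2: "\<bar>b * (exp (- a) * (1 + a) - 1)\<bar> \<le> b * a\<^sup>2"
    proof -
      have "exp (- a) * (1 + a) \<le> exp (- a) * exp a" by (intro mult_left_mono) auto
      hence 1: "exp (- a) * (1 + a) \<le> 1" by (simp add: exp_add[symmetric])
      have "(1 - a) * (1 + a) \<le> exp (- a) * (1 + a)" using exp_ge_add_one_self[of "- a"] a by (intro mult_right_mono) auto
      hence 2: "1 - a\<^sup>2 \<le> exp (- a) * (1 + a)" by (simp add: power2_eq_square algebra_simps)
      have "\<bar>exp (- a) * (1 + a) - 1\<bar> \<le> a\<^sup>2" using 1 2 by linarith
      thus ?thesis using b by (simp add: abs_mult mult_left_mono)
    qed
    have e3: "\<bar>exp (- a) * b\<^sup>2 / 2\<bar> \<le> b\<^sup>2"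
    proof -
      have "exp (- a) * b\<^sup>2 \<le> 1 * b\<^sup>2" using a by (intro mult_right_mono) auto
      moreover have "0 \<le> exp (- a) * b\<^sup>2" "0 \<le> b\<^sup>2" by auto
      ultimately show ?thesis by linarith
    qed
    have z: "0 \<le> z" using False assms by simp
    have ab: "a ^ 3 + b * a\<^sup>2 \<le> (k * z) ^ 3"
    proof -
      have "a ^ 3 + b * a\<^sup>2 = k * z * a\<^sup>2" unfolding kz by (simp add: eval_nat_numeral algebra_simps)
      also have "\<dots> \<le> k * z * (k * z)\<^sup>2" using a b k z by (intro mult_left_mono power_mono) (auto simp: kz)
      finally show ?thesis by (simp add: eval_nat_numeral)
    qed
    have "\<bar>?N - ?P\<bar>
      \<le> \<bar>R1\<bar> + \<bar>c * ((exp (- a) * (1 + a + a\<^sup>2 / 2) - 1) + b * (exp (- a) * (1 + a) - 1) + exp (- a) * b\<^sup>2 / 2)\<bar>"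
      unfolding eq by (rule abs_triangle_ineq4)
    also have "\<dots> = \<bar>R1\<bar> + - c * \<bar>(exp (- a) * (1 + a + a\<^sup>2 / 2) - 1) + b * (exp (- a) * (1 + a) - 1) + exp (- a) * b\<^sup>2 / 2\<bar>"
      using c by (simp add: abs_mult)
    also have "\<dots> \<le> 4 * \<theta>\<^sup>2 * (z - y)\<^sup>2 + - c * ((k * z) ^ 3 + b\<^sup>2)"
      using R1 e1 e2 e3 ab c by (intro add_mono mult_left_mono) linarith+
    also have "- c * ((k * z) ^ 3 + b\<^sup>2) = (- c * k ^ 3) * z ^ 3 + (- c * k\<^sup>2) * (z - y)\<^sup>2"
      unfolding b_def power_mult_distrib by (simp only: distrib_left mult_ac)
    also have "\<dots> \<le> 3 * \<theta> * z ^ 3 + 3 * \<theta> * (z - y)\<^sup>2"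
      using ck[of 3] ck[of 2] z by (intro add_mono mult_right_mono) auto
    also have "4 * \<theta>\<^sup>2 * (z - y)\<^sup>2 + (3 * \<theta> * z ^ 3 + 3 * \<theta> * (z - y)\<^sup>2) \<le> (6 * \<theta> + 4 * \<theta>\<^sup>2) * (z ^ 3 + (z - y)\<^sup>2)"
    proof -
      have "0 \<le> \<theta> * z ^ 3" "0 \<le> \<theta> * (z - y)\<^sup>2" "0 \<le> \<theta>\<^sup>2 * z ^ 3" using assms(1) z by auto
      thus ?thesis by (simp add: distrib_right distrib_left)
    qed
    finally show ?thesis using False z by simp
  qed
qed

section \<open>Gaussian random walks\<close>

definition walk :: "(nat \<Rightarrow> real) \<Rightarrow> nat \<Rightarrow> real" where
  "walk z k = (\<Sum>i<k. z i)"

primrec walk_max :: "(nat \<Rightarrow> real) \<Rightarrow> nat \<Rightarrow> real" where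
  "walk_max z 0 = 0"
| "walk_max z (Suc k) = max (walk_max z k) (walk z (Suc k))"

text \<open>A left-endpoint sum: \<open>walk_area z (Suc k)\<close> involves only the first k steps
  and is thus independent of the step \<open>z k\<close>.\<close>

definition walk_area :: "(nat \<Rightarrow> real) \<Rightarrow> nat \<Rightarrow> real" where
  "walk_area z k = (\<Sum>j<k. walk_max z j)"

lemma walk_Suc: "walk z (Suc k) = walk z k + z k"
  by (simp add: walk_def)

lemma walk_le_max: "walk z k \<le> walk_max z k"
  by (cases k) (auto simp: walk_def)

lemma walk_max_nonneg: "0 \<le> walk_max z k"
  by (induction k) auto

text \<open>Together with \<open>walk_gap_step\<close> this is the motion of the pair of maximum and
  gap, in exactly the form of the arguments in \<open>resolvent_step\<close>.\<close>

lemma walk_max_step: "walk_max z (Suc k) = walk_max z k + max 0 (z k - (walk_max z k - walk z k))"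
  by (auto simp: walk_Suc max_def)

lemma walk_gap_step: "walk_max z (Suc k) - walk z (Suc k) = max 0 ((walk_max z k - walk z k) - z k)"
  by (auto simp: walk_Suc max_def)

lemma walk_max_increment:
  "walk_max z k \<le> walk_max z (Suc k)" "walk_max z (Suc k) - walk_max z k \<le> \<bar>z k\<bar>"
  using walk_le_max[of z k] unfolding walk_max_step by (auto simp: max_def)

lemma walk_max_le_sum: "walk_max z k \<le> (\<Sum>i<k. \<bar>z i\<bar>)"
proof (induction k)
  case (Suc k)
  thus ?case using walk_max_increment(2)[of z k] by (simp del: walk_max.simps)
qed simp

lemma walk_abs_le_sum: "\<bar>walk z k\<bar> \<le> (\<Sum>i<k. \<bar>z i\<bar>)"
  unfolding walk_def by (rule sum_abs)

lemma walk_cong: "(\<And>i. i < k \<Longrightarrow> z i = z' i) \<Longrightarrow> walk z k = walk z' k"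
  by (simp add: walk_def)

lemma walk_max_cong: "(\<And>i. i < k \<Longrightarrow> z i = z' i) \<Longrightarrow> walk_max z k = walk_max z' k"
  by (induction k) (simp_all add: walk_def)

lemma walk_area_cong: "(\<And>i. i < k \<Longrightarrow> z i = z' i) \<Longrightarrow> walk_area z k = walk_area z' k"
  unfolding walk_area_def by (intro sum.cong walk_max_cong) auto

lemma walk_area_nonneg: "0 \<le> walk_area z k"
  unfolding walk_area_def by (intro sum_nonneg walk_max_nonneg)

lemma walk_max_scale:
  assumes "0 \<le> c"
  shows "walk_max (\<lambda>i. c * z i) k = c * walk_max z k"
  using assms by (induction k) (simp_all add: walk_def sum_distrib_left[symmetric] max_mult_distrib_left)

lemma walk_measurable_PiM [measurable]:
  assumes "k \<le> n"
  shows "(\<lambda>z. walk z k) \<in> borel_measurable (Pi\<^sub>M {..<n} (\<lambda>_. borel))"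
  unfolding walk_def by (intro borel_measurable_sum measurable_component_singleton) (use assms in auto)

lemma walk_max_measurable_PiM [measurable]:
  "k \<le> n \<Longrightarrow> (\<lambda>z. walk_max z k) \<in> borel_measurable (Pi\<^sub>M {..<n} (\<lambda>_. borel))"
  by (induction k) (auto intro!: borel_measurable_max walk_measurable_PiM)

lemma walk_area_measurable_PiM [measurable]:
  "k \<le> Suc n \<Longrightarrow> (\<lambda>z. walk_area z k) \<in> borel_measurable (Pi\<^sub>M {..<n} (\<lambda>_. borel))"
  unfolding walk_area_def by (intro borel_measurable_sum walk_max_measurable_PiM) auto

text \<open>Abstracting the steps lets the unit increments of Brownian motion and the rescaled
  increments of a fine grid instantiate the same locale, which is what the scaling argument
  compares.\<close>

locale gaussian_walk = prob_space M for M :: "'a measure" +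
  fixes \<zeta> :: "nat \<Rightarrow> 'a \<Rightarrow> real"
  assumes indep: "\<And>n. indep_vars (\<lambda>_. borel) \<zeta> {..<n}"
    and normal: "\<And>k. distributed M lborel (\<zeta> k) std_normal_density"
begin

abbreviation \<xi> :: "'a \<Rightarrow> nat \<Rightarrow> real" where "\<xi> \<omega> \<equiv> (\<lambda>i. \<zeta> i \<omega>)"

section \<open>Moments of the walk and of its maximum\<close>

lemma zeta_measurable [measurable]: "\<zeta> k \<in> borel_measurable M"
  using distributed_measurable[OF normal[of k]] by simp

lemma walk_measurable [measurable]: "(\<lambda>\<omega>. walk (\<xi> \<omega>) k) \<in> borel_measurable M"
  unfolding walk_def by measurable

lemma walk_max_measurable [measurable]: "(\<lambda>\<omega>. walk_max (\<xi> \<omega>) k) \<in> borel_measurable M"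
  by (induction k) auto

lemma walk_area_measurable [measurable]: "(\<lambda>\<omega>. walk_area (\<xi> \<omega>) k) \<in> borel_measurable M"
  unfolding walk_area_def by measurable

lemma zeta_power_integrable: "integrable M (\<lambda>\<omega>. \<zeta> k \<omega> ^ n)" "integrable M (\<lambda>\<omega>. \<bar>\<zeta> k \<omega>\<bar> ^ n)"
  using distributed_integrable[OF normal[of k], of "\<lambda>x. x ^ n"] distributed_integrable[OF normal[of k], of "\<lambda>x. \<bar>x\<bar> ^ n"]
    integrable_std_normal_moment[of n] integrable_std_normal_moment_abs[of n] by auto

lemma zeta_moments:
  "expectation (\<zeta> k) = 0" "expectation (\<lambda>\<omega>. (\<zeta> k \<omega>)\<^sup>2) = 1" "expectation (\<lambda>\<omega>. \<bar>\<zeta> k \<omega>\<bar> ^ 3) \<le> 2"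
proof -
  show "expectation (\<zeta> k) = 0"
    using distributed_integral[OF normal[of k], of "\<lambda>x. x"] integral_std_normal_moment_odd[of 0] by simp
  show "expectation (\<lambda>\<omega>. (\<zeta> k \<omega>)\<^sup>2) = 1"
    using distributed_integral[OF normal[of k], of "\<lambda>x. x\<^sup>2"] integral_std_normal_moment_even[of 1] by simp
  have "expectation (\<lambda>\<omega>. \<bar>\<zeta> k \<omega>\<bar> ^ 3) = 2 * sqrt (2 / pi)"
    using distributed_integral[OF normal[of k], of "\<lambda>x. \<bar>x\<bar> ^ 3"] integral_std_normal_moment_abs_odd[of 1] by simp
  also have "sqrt (2 / pi) \<le> 1" using pi_ge_two by simp
  finally show "expectation (\<lambda>\<omega>. \<bar>\<zeta> k \<omega>\<bar> ^ 3) \<le> 2" by simp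
qed

text \<open>The premise on \<open>restrict\<close> says that \<open>f\<close> depends on the first k
  steps alone, hence its value is independent of the next one.\<close>

lemma indep_past:
  assumes f: "f \<in> borel_measurable (Pi\<^sub>M {..<k} (\<lambda>_. borel))" and f_restrict: "\<And>z. f (restrict z {..<k}) = f z"
  shows "indep_var borel (\<lambda>\<omega>. f (\<xi> \<omega>)) borel (\<zeta> k)"
proof -
  have "indep_var (Pi\<^sub>M {..<k} (\<lambda>_. borel)) (\<lambda>\<omega>. restrict (\<xi> \<omega>) {..<k}) (Pi\<^sub>M {k} (\<lambda>_. borel)) (\<lambda>\<omega>. restrict (\<xi> \<omega>) {k})"
    by (rule indep_var_restrict[OF indep[of "Suc k"]]) auto
  from indep_var_compose[OF this f, of "\<lambda>z. z k" borel]
  have "indep_var borel (f \<circ> (\<lambda>\<omega>. restrict (\<xi> \<omega>) {..<k})) borel ((\<lambda>z. z k) \<circ> (\<lambda>\<omega>. restrict (\<xi> \<omega>) {k}))"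
    by (simp add: measurable_component_singleton)
  moreover have "f \<circ> (\<lambda>\<omega>. restrict (\<xi> \<omega>) {..<k}) = (\<lambda>\<omega>. f (\<xi> \<omega>))" by (simp add: fun_eq_iff f_restrict)
  moreover have "(\<lambda>z. z k) \<circ> (\<lambda>\<omega>. restrict (\<xi> \<omega>) {k}) = \<zeta> k" by (simp add: fun_eq_iff)
  ultimately show ?thesis by simp
qed

text \<open>The replacement for stochastic calculus: against a function of the past, a step averages
  to 0 and its square to 1.\<close>

lemma expectation_past_times_zeta:
  assumes f: "f \<in> borel_measurable (Pi\<^sub>M {..<k} (\<lambda>_. borel))" and f_restrict: "\<And>z. f (restrict z {..<k}) = f z"
    and int: "integrable M (\<lambda>\<omega>. f (\<xi> \<omega>))"
  shows "integrable M (\<lambda>\<omega>. f (\<xi> \<omega>) * \<zeta> k \<omega>)" "expectation (\<lambda>\<omega>. f (\<xi> \<omega>) * \<zeta> k \<omega>) = 0"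
    "integrable M (\<lambda>\<omega>. f (\<xi> \<omega>) * (\<zeta> k \<omega>)\<^sup>2)" "expectation (\<lambda>\<omega>. f (\<xi> \<omega>) * (\<zeta> k \<omega>)\<^sup>2) = expectation (\<lambda>\<omega>. f (\<xi> \<omega>))"
proof -
  note ind = indep_past[OF f f_restrict]
  have ind2: "indep_var borel (\<lambda>\<omega>. f (\<xi> \<omega>)) borel (\<lambda>\<omega>. (\<zeta> k \<omega>)\<^sup>2)"
    using indep_var_compose[OF ind, of "\<lambda>x. x" borel "\<lambda>x. x\<^sup>2" borel] by (simp add: o_def)
  have i1: "integrable M (\<zeta> k)" "integrable M (\<lambda>\<omega>. (\<zeta> k \<omega>)\<^sup>2)"
    using zeta_power_integrable(1)[of k 1] zeta_power_integrable(1)[of k 2] by auto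
  show "integrable M (\<lambda>\<omega>. f (\<xi> \<omega>) * \<zeta> k \<omega>)" "integrable M (\<lambda>\<omega>. f (\<xi> \<omega>) * (\<zeta> k \<omega>)\<^sup>2)"
    by (rule indep_var_integrable[OF ind int i1(1)], rule indep_var_integrable[OF ind2 int i1(2)])
  show "expectation (\<lambda>\<omega>. f (\<xi> \<omega>) * \<zeta> k \<omega>) = 0" "expectation (\<lambda>\<omega>. f (\<xi> \<omega>) * (\<zeta> k \<omega>)\<^sup>2) = expectation (\<lambda>\<omega>. f (\<xi> \<omega>))"
    using indep_var_lebesgue_integral[OF ind int i1(1)] indep_var_lebesgue_integral[OF ind2 int i1(2)] zeta_moments by auto
qed

lemma square_integrable_bound:
  assumes [measurable]: "X \<in> borel_measurable M" and b: "\<And>\<omega>. \<bar>X \<omega>\<bar> \<le> (\<Sum>i<k. \<bar>\<zeta> i \<omega>\<bar>)"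
  shows "integrable M X" "integrable M (\<lambda>\<omega>. (X \<omega>)\<^sup>2)"
proof -
  have z1: "integrable M (\<lambda>\<omega>. \<bar>\<zeta> i \<omega>\<bar>)" for i using zeta_power_integrable(2)[of i 1] by simp
  show "integrable M X"
  proof (rule Bochner_Integration.integrable_bound)
    show "integrable M (\<lambda>\<omega>. \<Sum>i<k. \<bar>\<zeta> i \<omega>\<bar>)" by (intro Bochner_Integration.integrable_sum z1)
    show "AE \<omega> in M. norm (X \<omega>) \<le> norm (\<Sum>i<k. \<bar>\<zeta> i \<omega>\<bar>)"
      using b by (intro AE_I2) (auto intro: order_trans[OF _ abs_ge_self])
  qed simp
  show "integrable M (\<lambda>\<omega>. (X \<omega>)\<^sup>2)"
  proof (rule Bochner_Integration.integrable_bound)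
    show "integrable M (\<lambda>\<omega>. real k * (\<Sum>i<k. (\<zeta> i \<omega>)\<^sup>2))"
      by (intro integrable_mult_right Bochner_Integration.integrable_sum zeta_power_integrable)
    show "AE \<omega> in M. norm ((X \<omega>)\<^sup>2) \<le> norm (real k * (\<Sum>i<k. (\<zeta> i \<omega>)\<^sup>2))"
    proof (rule AE_I2)
      fix \<omega>
      have "(X \<omega>)\<^sup>2 \<le> (\<Sum>i<k. \<bar>\<zeta> i \<omega>\<bar>)\<^sup>2" using power_mono[OF b[of \<omega>], of 2] by simp
      also have "\<dots> \<le> (\<Sum>i<k. 1\<^sup>2) * (\<Sum>i<k. \<bar>\<zeta> i \<omega>\<bar>\<^sup>2)"
        using Cauchy_Schwarz_ineq_sum[of "\<lambda>_. 1" "\<lambda>i. \<bar>\<zeta> i \<omega>\<bar>" "{..<k}"] by simp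
      finally show "norm ((X \<omega>)\<^sup>2) \<le> norm (real k * (\<Sum>i<k. (\<zeta> i \<omega>)\<^sup>2))"
        by (simp add: sum_nonneg)
    qed
  qed simp
qed

lemma walk_integrable: "integrable M (\<lambda>\<omega>. walk (\<xi> \<omega>) k)" "integrable M (\<lambda>\<omega>. (walk (\<xi> \<omega>) k)\<^sup>2)"
  by (rule square_integrable_bound[where k = k]; simp add: walk_abs_le_sum)+

lemma walk_max_integrable: "integrable M (\<lambda>\<omega>. walk_max (\<xi> \<omega>) k)" "integrable M (\<lambda>\<omega>. (walk_max (\<xi> \<omega>) k)\<^sup>2)"
  by (rule square_integrable_bound[where k = k]; simp add: walk_max_le_sum walk_max_nonneg)+

lemma walk_max_increment_integrable:
  "integrable M (\<lambda>\<omega>. (walk_max (\<xi> \<omega>) (Suc k) - walk_max (\<xi> \<omega>) k)\<^sup>2)"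
proof (rule Bochner_Integration.integrable_bound[OF zeta_power_integrable(1)[of k 2]])
  show "AE \<omega> in M. norm ((walk_max (\<xi> \<omega>) (Suc k) - walk_max (\<xi> \<omega>) k)\<^sup>2) \<le> norm ((\<zeta> k \<omega>)\<^sup>2)"
  proof (rule AE_I2)
    fix \<omega>
    show "norm ((walk_max (\<xi> \<omega>) (Suc k) - walk_max (\<xi> \<omega>) k)\<^sup>2) \<le> norm ((\<zeta> k \<omega>)\<^sup>2)"
      using walk_max_increment[of "\<xi> \<omega>" k] unfolding real_norm_def power_abs by (intro power_mono) auto
  qed
qed measurable

lemma expectation_walk_square: "expectation (\<lambda>\<omega>. (walk (\<xi> \<omega>) k)\<^sup>2) = real k"
proof (induction k)
  case (Suc k)
  have P: "integrable M (\<lambda>\<omega>. walk (\<xi> \<omega>) k * \<zeta> k \<omega>)" "expectation (\<lambda>\<omega>. walk (\<xi> \<omega>) k * \<zeta> k \<omega>) = 0"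
    by (rule expectation_past_times_zeta[where f = "\<lambda>z. walk z k"]; auto intro!: walk_measurable_PiM walk_integrable walk_cong)+
  have "expectation (\<lambda>\<omega>. (walk (\<xi> \<omega>) (Suc k))\<^sup>2) = expectation (\<lambda>\<omega>. (walk (\<xi> \<omega>) k)\<^sup>2 + 2 * (walk (\<xi> \<omega>) k * \<zeta> k \<omega>) + (\<zeta> k \<omega>)\<^sup>2)"
    by (intro Bochner_Integration.integral_cong) (auto simp: walk_Suc power2_eq_square algebra_simps)
  also have "\<dots> = real k + 2 * 0 + 1"
    using P walk_integrable(2)[of k] zeta_power_integrable(1)[of k 2] zeta_moments(2)[of k] Suc by simp
  finally show ?case by simp
qed (simp add: walk_def)

text \<open>A discrete Doob inequality: the process \<open>2 M W - M\<^sup>2\<close> increases by \<open>2 M \<zeta> + (\<Delta>M)\<^sup>2\<close>.\<close>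

lemma expectation_walk_max_square: "expectation (\<lambda>\<omega>. (walk_max (\<xi> \<omega>) k)\<^sup>2) \<le> 4 * real k"
proof -
  define Q where "Q k \<omega> = 2 * walk_max (\<xi> \<omega>) k * walk (\<xi> \<omega>) k - (walk_max (\<xi> \<omega>) k)\<^sup>2" for k \<omega>
  have le: "2 * walk_max (\<xi> \<omega>) k * walk (\<xi> \<omega>) k \<le> (walk_max (\<xi> \<omega>) k)\<^sup>2 / 2 + 2 * (walk (\<xi> \<omega>) k)\<^sup>2" for k \<omega>
    using zero_le_power2[of "walk_max (\<xi> \<omega>) k - 2 * walk (\<xi> \<omega>) k"] by (simp add: power2_eq_square algebra_simps)
  have le': "\<bar>2 * walk_max (\<xi> \<omega>) k * walk (\<xi> \<omega>) k\<bar> \<le> (walk_max (\<xi> \<omega>) k)\<^sup>2 / 2 + 2 * (walk (\<xi> \<omega>) k)\<^sup>2" for k \<omega>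
    using le[of \<omega> k] zero_le_power2[of "walk_max (\<xi> \<omega>) k + 2 * walk (\<xi> \<omega>) k"] by (simp add: power2_eq_square algebra_simps)
  have iMW: "integrable M (\<lambda>\<omega>. 2 * walk_max (\<xi> \<omega>) k * walk (\<xi> \<omega>) k)" for k
  proof (rule Bochner_Integration.integrable_bound)
    show "integrable M (\<lambda>\<omega>. (walk_max (\<xi> \<omega>) k)\<^sup>2 / 2 + 2 * (walk (\<xi> \<omega>) k)\<^sup>2)"
      using walk_integrable(2) walk_max_integrable(2) by auto
    show "AE \<omega> in M. norm (2 * walk_max (\<xi> \<omega>) k * walk (\<xi> \<omega>) k) \<le> norm ((walk_max (\<xi> \<omega>) k)\<^sup>2 / 2 + 2 * (walk (\<xi> \<omega>) k)\<^sup>2)"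
      using le' by (intro AE_I2) (auto intro: order_trans[OF _ abs_ge_self])
  qed measurable
  have iQ: "integrable M (Q k)" for k
    unfolding Q_def by (intro Bochner_Integration.integrable_diff iMW walk_max_integrable)
  have Q0: "0 \<le> expectation (Q k)" for k
  proof (induction k)
    case (Suc k)
    have P: "integrable M (\<lambda>\<omega>. walk_max (\<xi> \<omega>) k * \<zeta> k \<omega>)" "expectation (\<lambda>\<omega>. walk_max (\<xi> \<omega>) k * \<zeta> k \<omega>) = 0"
      by (rule expectation_past_times_zeta[where f = "\<lambda>z. walk_max z k"]; auto intro!: walk_max_measurable_PiM walk_max_integrable walk_max_cong)+
    have QS: "Q (Suc k) \<omega> = Q k \<omega> + 2 * (walk_max (\<xi> \<omega>) k * \<zeta> k \<omega>) + (walk_max (\<xi> \<omega>) (Suc k) - walk_max (\<xi> \<omega>) k)\<^sup>2" for \<omega>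
    proof (cases "walk_max (\<xi> \<omega>) k \<le> walk (\<xi> \<omega>) (Suc k)")
      case True
      hence "walk_max (\<xi> \<omega>) (Suc k) = walk (\<xi> \<omega>) (Suc k)" by simp
      thus ?thesis by (simp add: Q_def walk_Suc power2_eq_square algebra_simps)
    next
      case False
      hence "walk_max (\<xi> \<omega>) (Suc k) = walk_max (\<xi> \<omega>) k" by simp
      thus ?thesis by (simp add: Q_def walk_Suc power2_eq_square algebra_simps del: walk_max.simps)
    qed
    have "expectation (Q (Suc k)) = expectation (Q k) + 2 * 0 + expectation (\<lambda>\<omega>. (walk_max (\<xi> \<omega>) (Suc k) - walk_max (\<xi> \<omega>) k)\<^sup>2)"
      unfolding QS using iQ[of k] P walk_max_increment_integrable[of k] by (simp del: walk_max.simps)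
    thus ?case using Suc by (simp add: add_nonneg_nonneg del: walk_max.simps)
  qed (simp add: Q_def)
  \<comment> \<open>Nonnegativity of the mean of \<open>Q\<close> bounds the second moment of the
    maximum by the mixed term; completing the square returns half of it plus 2 k, and that half is
    absorbed.\<close>
  have "expectation (\<lambda>\<omega>. (walk_max (\<xi> \<omega>) k)\<^sup>2) \<le> expectation (\<lambda>\<omega>. 2 * walk_max (\<xi> \<omega>) k * walk (\<xi> \<omega>) k)"
    using Q0[of k] Bochner_Integration.integral_diff[OF iMW[of k] walk_max_integrable(2)[of k]] by (simp add: Q_def[abs_def])
  also have "\<dots> \<le> expectation (\<lambda>\<omega>. (walk_max (\<xi> \<omega>) k)\<^sup>2 / 2 + 2 * (walk (\<xi> \<omega>) k)\<^sup>2)"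
    using walk_integrable(2) walk_max_integrable(2) by (intro integral_mono iMW le) auto
  also have "\<dots> = expectation (\<lambda>\<omega>. (walk_max (\<xi> \<omega>) k)\<^sup>2) / 2 + 2 * real k"
    using walk_integrable(2)[of k] walk_max_integrable(2)[of k] by (simp add: expectation_walk_square)
  finally show ?thesis by simp
qed

text \<open>From m \<le> (m^2 / r + r) / 2 and the second moment bound 4 r^2; the constant is (4 +
  1) / 2.\<close>

lemma expectation_walk_max:
  assumes "0 < r" "real k \<le> r\<^sup>2"
  shows "expectation (\<lambda>\<omega>. walk_max (\<xi> \<omega>) k) \<le> 5/2 * r"
proof -
  have "expectation (\<lambda>\<omega>. walk_max (\<xi> \<omega>) k) \<le> expectation (\<lambda>\<omega>. ((walk_max (\<xi> \<omega>) k)\<^sup>2 / r + r) / 2)"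
  proof (rule integral_mono)
    show "walk_max (\<xi> \<omega>) k \<le> ((walk_max (\<xi> \<omega>) k)\<^sup>2 / r + r) / 2" for \<omega>
      using zero_le_power2[of "walk_max (\<xi> \<omega>) k - r"] assms(1) by (simp add: field_simps power2_eq_square)
  qed (use walk_max_integrable in auto)
  also have "\<dots> = (expectation (\<lambda>\<omega>. (walk_max (\<xi> \<omega>) k)\<^sup>2) / r + r) / 2"
    using walk_max_integrable(2)[of k] by (simp add: prob_space)
  also have "\<dots> \<le> (4 * r\<^sup>2 / r + r) / 2"
    using expectation_walk_max_square[of k] assms by (intro divide_right_mono add_right_mono) auto
  also have "\<dots> = 5/2 * r" using assms(1) by (simp add: power2_eq_square)
  finally show ?thesis .
qed

text \<open>The trivial bound k would not vanish after multiplication by the time step, so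
  increments are split at the threshold \<open>a\<close>. Those up to \<open>a\<close> have square
  at most \<open>a\<close> times themselves and telescope to the maximum, of order r. Larger ones
  are charged to the third absolute moment of the step, divided by \<open>a\<close>.\<close>

lemma expectation_walk_max_increments:
  assumes a: "0 < a" and r: "0 < r" "real k \<le> r\<^sup>2"
  shows "(\<Sum>j<k. expectation (\<lambda>\<omega>. (walk_max (\<xi> \<omega>) (Suc j) - walk_max (\<xi> \<omega>) j)\<^sup>2)) \<le> 5/2 * a * r + 2 * real k / a"
proof -
  let ?m = "\<lambda>j. expectation (\<lambda>\<omega>. walk_max (\<xi> \<omega>) j)"
  let ?v = "\<lambda>j. expectation (\<lambda>\<omega>. (walk_max (\<xi> \<omega>) (Suc j) - walk_max (\<xi> \<omega>) j)\<^sup>2)"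
  let ?s = "\<lambda>j. expectation (\<lambda>\<omega>. walk_max (\<xi> \<omega>) (Suc j))"
  have "?v j
     \<le> a * (?s j - ?m j) + 2 / a" for j
  proof -
    have "?v j
       \<le> expectation (\<lambda>\<omega>. a * (walk_max (\<xi> \<omega>) (Suc j) - walk_max (\<xi> \<omega>) j) + \<bar>\<zeta> j \<omega>\<bar> ^ 3 / a)"
    proof (rule integral_mono[OF walk_max_increment_integrable])
      show "integrable M (\<lambda>\<omega>. a * (walk_max (\<xi> \<omega>) (Suc j) - walk_max (\<xi> \<omega>) j) + \<bar>\<zeta> j \<omega>\<bar> ^ 3 / a)"
        by (intro Bochner_Integration.integrable_add integrable_mult_right Bochner_Integration.integrable_diff walk_max_integrable integrable_divide_zero zeta_power_integrable)
      fix \<omega>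
      define d where "d = walk_max (\<xi> \<omega>) (Suc j) - walk_max (\<xi> \<omega>) j"
      have d: "0 \<le> d" "d \<le> \<bar>\<zeta> j \<omega>\<bar>" using walk_max_increment[of "\<xi> \<omega>" j] by (auto simp: d_def)
      show "(walk_max (\<xi> \<omega>) (Suc j) - walk_max (\<xi> \<omega>) j)\<^sup>2 \<le> a * (walk_max (\<xi> \<omega>) (Suc j) - walk_max (\<xi> \<omega>) j) + \<bar>\<zeta> j \<omega>\<bar> ^ 3 / a"
        unfolding d_def[symmetric]
      proof (cases "d \<le> a")
        case True
        have "d\<^sup>2 \<le> a * d" using True d by (simp add: power2_eq_square mult_right_mono)
        thus "d\<^sup>2 \<le> a * d + \<bar>\<zeta> j \<omega>\<bar> ^ 3 / a" using a by (simp add: add_increasing2)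
      next
        case False
        have "a * d\<^sup>2 \<le> d * d\<^sup>2" using False by (intro mult_right_mono) auto
        also have "\<dots> = d ^ 3" by (simp add: eval_nat_numeral)
        also have "\<dots> \<le> \<bar>\<zeta> j \<omega>\<bar> ^ 3" using d by (intro power_mono) auto
        finally have "d\<^sup>2 \<le> \<bar>\<zeta> j \<omega>\<bar> ^ 3 / a" using a by (simp add: field_simps)
        thus "d\<^sup>2 \<le> a * d + \<bar>\<zeta> j \<omega>\<bar> ^ 3 / a" using a d by (simp add: add_increasing)
      qed
    qed
    also have "\<dots> = a * (?s j - ?m j) + expectation (\<lambda>\<omega>. \<bar>\<zeta> j \<omega>\<bar> ^ 3) / a"
      using walk_max_integrable(1)[of j] walk_max_integrable(1)[of "Suc j"] zeta_power_integrable(2)[of j 3]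
      by (simp del: walk_max.simps)
    also have "\<dots> \<le> a * (?s j - ?m j) + 2 / a"
      using zeta_moments(3)[of j] a by (intro add_left_mono divide_right_mono) auto
    finally show ?thesis .
  qed
  hence "(\<Sum>j<k. ?v j)
    \<le> (\<Sum>j<k. a * (?s j - ?m j) + 2 / a)"
    by (rule sum_mono)
  also have "\<dots> = a * (\<Sum>j<k. ?s j - ?m j) + 2 * real k / a"
    by (simp add: sum.distrib sum_distrib_left del: walk_max.simps)
  also have "(\<Sum>j<k. ?s j - ?m j) = expectation (\<lambda>\<omega>. walk_max (\<xi> \<omega>) k)"
    using sum_lessThan_telescope[of "\<lambda>j. ?m j" k] by (simp del: walk_max.simps(2))
  also have "a * \<dots> \<le> a * (5/2 * r)" using a expectation_walk_max[OF r] by (intro mult_left_mono) auto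
  finally show ?thesis by (simp add: mult_ac)
qed

end

text \<open>To first order in the time step d, killing cancels the generator term d q F and leaves
  the running gain d. The hypothesis q F \<le> 1 keeps the error linear in q; this matters because q
  grows with the maximum and enters the later bound through the mean of the maximum.\<close>

lemma discount_error:
  fixes d q F :: real
  assumes d: "0 \<le> d" and q: "0 \<le> q" and F: "0 \<le> F" "q * F \<le> 1"
  shows "\<bar>exp (- (d * q)) * (F + d * (q * F - 1)) - (F - d)\<bar> \<le> 3 * (d\<^sup>2 * q)"
proof -
  define x where "x = d * q"
  define r where "r = exp (- x) - 1 + x"
  have x: "0 \<le> x" using d q by (simp add: x_def)
  have r0: "0 \<le> r" using exp_ge_add_one_self[of "- x"] by (simp add: r_def)
  have rx: "r \<le> x" using x by (simp add: r_def)
  have rx2: "r \<le> x\<^sup>2"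
  proof -
    have "exp (- x) \<le> 1 / (1 + x)"
      using exp_ge_add_one_self[of x] x by (simp add: exp_minus divide_inverse le_imp_inverse_le)
    also have "\<dots> \<le> 1 - x + x\<^sup>2"
    proof -
      have "1 \<le> (1 - x + x\<^sup>2) * (1 + x)" using x by (simp add: algebra_simps power2_eq_square)
      thus ?thesis using x by (simp add: divide_le_eq)
    qed
    finally show ?thesis by (simp add: r_def)
  qed
  have xF: "x * F \<le> d" using mult_left_mono[OF F(2) d] by (simp add: x_def mult_ac)
  have 1: "x * (x * F) \<le> x * d" "0 \<le> x * (x * F)" using xF x F by (auto intro: mult_left_mono)
  have 2: "r * F \<le> x * d" "0 \<le> r * F"
    using mult_right_mono[OF rx2 F(1)] 1 r0 F by (auto simp: power2_eq_square mult.assoc)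
  have 3: "r * (x * F) \<le> x * d" "0 \<le> r * (x * F)"
    using mult_mono[OF rx xF x] r0 x F by auto
  have 4: "r * d \<le> x * d" "0 \<le> r * d" using mult_right_mono[OF rx d] r0 d by auto
  have "exp (- x) * (F + (x * F - d)) - (F - d) = - (x * (x * F)) + x * d + r * F + r * (x * F) - r * d"
    by (simp add: r_def algebra_simps)
  hence "\<bar>exp (- x) * (F + (x * F - d)) - (F - d)\<bar> \<le> 3 * (x * d)" using 1 2 3 4 by linarith
  moreover have "x * d = d\<^sup>2 * q" "x * F - d = d * (q * F - 1)"
    by (simp_all add: x_def power2_eq_square algebra_simps)
  ultimately show ?thesis by (simp only: x_def[symmetric])
qed

text \<open>The killing factor up to time e^2 k under diffusive scaling, with space step e and time
  step e^2.\<close>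

definition discount :: "real \<Rightarrow> real \<Rightarrow> nat \<Rightarrow> (nat \<Rightarrow> real) \<Rightarrow> real" where
  "discount \<theta> e k z = exp (- (e\<^sup>2 * (\<Sum>j<k. kill_rate \<theta> (e * walk_max z j))))"

lemma discount_Suc: "discount \<theta> e (Suc k) z = discount \<theta> e k z * exp (- (e\<^sup>2 * kill_rate \<theta> (e * walk_max z k)))"
  by (simp add: discount_def exp_add[symmetric] algebra_simps)

lemma discount_eq: "discount \<theta> e k z = exp (- (e\<^sup>2 * real k)) * exp (- (\<theta> * (e ^ 3 * walk_area z k)))"
  by (simp add: discount_def kill_rate_def walk_area_def sum.distrib exp_add[symmetric] sum_distrib_left algebra_simps eval_nat_numeral)

lemma discount_le:
  assumes "0 \<le> \<theta>" "0 \<le> e"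
  shows "discount \<theta> e k z \<le> exp (- (e\<^sup>2 * real k))" "0 \<le> discount \<theta> e k z" "discount \<theta> e k z \<le> 1"
proof -
  show 1: "discount \<theta> e k z \<le> exp (- (e\<^sup>2 * real k))"
    unfolding discount_eq using assms walk_area_nonneg[of z k] by (simp add: mult_le_cancel_left2)
  show "0 \<le> discount \<theta> e k z" by (simp add: discount_def)
  show "discount \<theta> e k z \<le> 1" using 1 by (rule order_trans) simp
qed

section \<open>Telescoping the discounted resolvent along the walk\<close>

context gaussian_walk
begin

text \<open>A discrete form of Dynkin's formula: over one step the discounted resolvent loses on
  average the time step times the discount. The two summands of the error come from
  \<open>discount_error\<close> and \<open>resolvent_step\<close>.\<close>

lemma resolvent_step_expectation:
  assumes \<theta>: "0 \<le> \<theta>" and e: "0 \<le> e"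
  defines "F \<equiv> \<lambda>k z. resolvent \<theta> (e * walk_max z k) (e * (walk_max z k - walk z k))"
  shows "\<bar>expectation (\<lambda>\<omega>. discount \<theta> e (Suc k) (\<xi> \<omega>) * F (Suc k) (\<xi> \<omega>)) - expectation (\<lambda>\<omega>. discount \<theta> e k (\<xi> \<omega>) * F k (\<xi> \<omega>))
       + e\<^sup>2 * expectation (\<lambda>\<omega>. discount \<theta> e k (\<xi> \<omega>))\<bar>
    \<le> 3 * e ^ 4 * (1 + \<theta> * e * expectation (\<lambda>\<omega>. walk_max (\<xi> \<omega>) k))
       + (6 * \<theta> + 4 * \<theta>\<^sup>2) * (2 * e ^ 3 + e\<^sup>2 * expectation (\<lambda>\<omega>. (walk_max (\<xi> \<omega>) (Suc k) - walk_max (\<xi> \<omega>) k)\<^sup>2))"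
proof -
  define C where "C = 6 * \<theta> + 4 * \<theta>\<^sup>2"
  have C: "0 \<le> C" using \<theta> by (simp add: C_def)
  define q where "q z = kill_rate \<theta> (e * walk_max z k)" for z
  \<comment> \<open>\<open>f1\<close> and \<open>f2\<close> are the coefficients of the linear and
    quadratic terms of the step. The discount at \<open>Suc k\<close> is still a function of the
    first k steps, since it sees the maximum only up to index k.\<close>
  define f1 where "f1 z = discount \<theta> e (Suc k) z * resolvent_dy \<theta> (e * walk_max z k) (e * (walk_max z k - walk z k))" for z
  define f2 where "f2 z = discount \<theta> e (Suc k) z * (q z * F k z - 1)" for z
  have s: "0 \<le> e * walk_max z j" and y: "0 \<le> e * (walk_max z j - walk z j)" for z j
    using e walk_max_nonneg[of z j] walk_le_max[of z j] by auto
  have q: "1 \<le> q z" for z unfolding q_def by (rule kill_rate_ge_1[OF \<theta> s])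
  have F: "0 \<le> F j z" "F j z \<le> 1" for j z
  proof -
    show "0 \<le> F j z" unfolding F_def by (rule resolvent_bounds[OF \<theta> s y])
    have "F j z \<le> 1 / kill_rate \<theta> (e * walk_max z j)" unfolding F_def by (rule resolvent_bounds[OF \<theta> s y])
    also have "\<dots> \<le> 1" using kill_rate_ge_1[OF \<theta> s, of z j] by simp
    finally show "F j z \<le> 1" .
  qed
  have qF: "q z * F k z \<le> 1" for z
    using resolvent_bounds(2)[OF \<theta> s y, of z k] q[of z] unfolding F_def q_def by (simp add: field_simps)
  have qF0: "0 \<le> q z * F k z" for z using q[of z] F(1)[of k z] by simp
  note D = discount_le[OF \<theta> e]
  have mPi: "(\<lambda>z. resolvent \<theta> (e * walk_max z k) (e * (walk_max z k - walk z k))) \<in> borel_measurable (Pi\<^sub>M {..<k} (\<lambda>_. borel))"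
    "(\<lambda>z. resolvent_dy \<theta> (e * walk_max z k) (e * (walk_max z k - walk z k))) \<in> borel_measurable (Pi\<^sub>M {..<k} (\<lambda>_. borel))"
    using measurable_compose[OF _ resolvent_measurable(1), of "\<lambda>z. (e * walk_max z k, e * (walk_max z k - walk z k))"]
      measurable_compose[OF _ resolvent_measurable(2), of "\<lambda>z. (e * walk_max z k, e * (walk_max z k - walk z k))"] by auto
  have dPi: "discount \<theta> e (Suc k) \<in> borel_measurable (Pi\<^sub>M {..<k} (\<lambda>_. borel))"
    unfolding discount_eq[abs_def] by measurable
  have restr: "walk_max (restrict z {..<k}) j = walk_max z j" "walk (restrict z {..<k}) j = walk z j" if "j \<le> k" for z :: "nat \<Rightarrow> real" and j
    using that by (auto intro!: walk_max_cong walk_cong)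
  have drestr: "discount \<theta> e (Suc k) (restrict z {..<k}) = discount \<theta> e (Suc k) z" for z
    by (simp add: discount_def restr)
  have f1Pi: "f1 \<in> borel_measurable (Pi\<^sub>M {..<k} (\<lambda>_. borel))" "f1 (restrict z {..<k}) = f1 z" for z
    unfolding f1_def[abs_def] using mPi dPi by (auto simp: restr drestr)
  have f2Pi: "f2 \<in> borel_measurable (Pi\<^sub>M {..<k} (\<lambda>_. borel))" "f2 (restrict z {..<k}) = f2 z" for z
    unfolding f2_def[abs_def] q_def F_def kill_rate_def using mPi dPi by (auto simp: restr drestr)
  have mF [measurable]: "(\<lambda>\<omega>. F j (\<xi> \<omega>)) \<in> borel_measurable M" for j
    unfolding F_def using measurable_compose[OF _ resolvent_measurable(1), of "\<lambda>\<omega>. (e * walk_max (\<xi> \<omega>) j, e * (walk_max (\<xi> \<omega>) j - walk (\<xi> \<omega>) j))"] by simp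
  have mD [measurable]: "(\<lambda>\<omega>. discount \<theta> e j (\<xi> \<omega>)) \<in> borel_measurable M" for j
    unfolding discount_eq by measurable
  have mR [measurable]: "(\<lambda>\<omega>. resolvent_dy \<theta> (e * walk_max (\<xi> \<omega>) k) (e * (walk_max (\<xi> \<omega>) k - walk (\<xi> \<omega>) k))) \<in> borel_measurable M"
    using measurable_compose[OF _ resolvent_measurable(2), of "\<lambda>\<omega>. (e * walk_max (\<xi> \<omega>) k, e * (walk_max (\<xi> \<omega>) k - walk (\<xi> \<omega>) k))"] by simp
  have mq [measurable]: "(\<lambda>\<omega>. q (\<xi> \<omega>)) \<in> borel_measurable M" unfolding q_def kill_rate_def by measurable
  have i1: "integrable M (\<lambda>\<omega>. f1 (\<xi> \<omega>))"
  proof (rule integrable_const_bound[where B = "1 * (3 * \<theta>)"])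
    show "AE \<omega> in M. norm (f1 (\<xi> \<omega>)) \<le> 1 * (3 * \<theta>)"
      unfolding f1_def real_norm_def abs_mult using D resolvent_dy_bound[OF \<theta> s y]
      by (intro AE_I2 mult_mono) auto
    show "(\<lambda>\<omega>. f1 (\<xi> \<omega>)) \<in> borel_measurable M" unfolding f1_def by measurable
  qed
  have i2: "integrable M (\<lambda>\<omega>. f2 (\<xi> \<omega>))"
  proof (rule integrable_const_bound[where B = "1 * 1"])
    show "AE \<omega> in M. norm (f2 (\<xi> \<omega>)) \<le> 1 * 1"
      unfolding f2_def real_norm_def abs_mult
    proof (intro AE_I2 mult_mono)
      show "\<bar>q (\<xi> \<omega>) * F k (\<xi> \<omega>) - 1\<bar> \<le> 1" for \<omega> using qF[of "\<xi> \<omega>"] qF0[of "\<xi> \<omega>"] by linarith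
    qed (use D in auto)
    show "(\<lambda>\<omega>. f2 (\<xi> \<omega>)) \<in> borel_measurable M" unfolding f2_def by measurable
  qed
  note E1 = expectation_past_times_zeta[OF f1Pi i1] and E2 = expectation_past_times_zeta[OF f2Pi i2]
  have iDF: "integrable M (\<lambda>\<omega>. discount \<theta> e j (\<xi> \<omega>) * F j (\<xi> \<omega>))" for j
  proof (rule integrable_const_bound[where B = "1 * 1"])
    show "AE \<omega> in M. norm (discount \<theta> e j (\<xi> \<omega>) * F j (\<xi> \<omega>)) \<le> 1 * 1"
      unfolding real_norm_def abs_mult using D F by (intro AE_I2 mult_mono) (auto simp: abs_of_nonneg)
  qed measurable
  have iD: "integrable M (\<lambda>\<omega>. discount \<theta> e j (\<xi> \<omega>))" for j
    by (rule integrable_const_bound[where B = 1]) (use D in \<open>auto simp: abs_of_nonneg\<close>)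
  \<comment> \<open>The extra terms, in \<zeta> and in \<zeta>^2 - 1, have mean zero. Including them
    makes the error small at every sample point and not merely on average.\<close>
  define Err where "Err \<omega> = discount \<theta> e (Suc k) (\<xi> \<omega>) * F (Suc k) (\<xi> \<omega>) - discount \<theta> e k (\<xi> \<omega>) * F k (\<xi> \<omega>) + e\<^sup>2 * discount \<theta> e k (\<xi> \<omega>)
     + e * (f1 (\<xi> \<omega>) * \<zeta> k \<omega>) - e\<^sup>2 * (f2 (\<xi> \<omega>) * (\<zeta> k \<omega>)\<^sup>2) + e\<^sup>2 * f2 (\<xi> \<omega>)" for \<omega>
  have EErr: "expectation Err = expectation (\<lambda>\<omega>. discount \<theta> e (Suc k) (\<xi> \<omega>) * F (Suc k) (\<xi> \<omega>)) - expectation (\<lambda>\<omega>. discount \<theta> e k (\<xi> \<omega>) * F k (\<xi> \<omega>))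
       + e\<^sup>2 * expectation (\<lambda>\<omega>. discount \<theta> e k (\<xi> \<omega>))"
    unfolding Err_def using iDF[of k] iDF[of "Suc k"] iD[of k] E1 E2 i1 i2 by simp
  have iErr: "integrable M Err"
    unfolding Err_def using iDF[of k] iDF[of "Suc k"] iD[of k] E1 E2 i1 i2
    by (intro Bochner_Integration.integrable_add Bochner_Integration.integrable_diff integrable_mult_right)
  define bd where "bd \<omega> = 3 * e ^ 4 * (1 + \<theta> * e * walk_max (\<xi> \<omega>) k) + C * (e ^ 3 * \<bar>\<zeta> k \<omega>\<bar> ^ 3 + e\<^sup>2 * (walk_max (\<xi> \<omega>) (Suc k) - walk_max (\<xi> \<omega>) k)\<^sup>2)" for \<omega>
  have ibd: "integrable M bd"
    unfolding bd_def using walk_max_integrable(1)[of k] walk_max_increment_integrable[of k] zeta_power_integrable(2)[of k 3] by simp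
  have pw: "\<bar>Err \<omega>\<bar> \<le> bd \<omega>" for \<omega>
  proof -
    define z where "z = \<xi> \<omega>"
    define ss where "ss = e * walk_max z k"
    define yy where "yy = e * (walk_max z k - walk z k)"
    define zz where "zz = e * z k"
    have max_e: "e * max 0 t = max 0 (e * t)" for t using e by (simp add: max_mult_distrib_left)
    have incr: "max 0 (zz - yy) = e * (walk_max z (Suc k) - walk_max z k)"
      unfolding walk_max_step zz_def yy_def by (simp add: max_e right_diff_distrib)
    have ss': "e * walk_max z (Suc k) = ss + max 0 (zz - yy)"
      unfolding incr ss_def by (simp add: algebra_simps del: walk_max.simps)
    have yy': "e * (walk_max z (Suc k) - walk z (Suc k)) = max 0 (yy - zz)"
      unfolding walk_gap_step zz_def yy_def by (simp add: max_e right_diff_distrib)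
    define R where "R = F (Suc k) z - (F k z - zz * resolvent_dy \<theta> ss yy + zz\<^sup>2 * (q z * F k z - 1))"
    have FF: "F (Suc k) z = resolvent \<theta> (ss + max 0 (zz - yy)) (max 0 (yy - zz))"
      unfolding F_def ss' yy' ..
    have Fk: "F k z = resolvent \<theta> ss yy" by (simp add: F_def ss_def yy_def)
    have qk: "q z = kill_rate \<theta> ss" by (simp add: q_def ss_def)
    have R: "\<bar>R\<bar> \<le> C * (\<bar>zz\<bar> ^ 3 + (max 0 (zz - yy))\<^sup>2)"
      unfolding R_def FF Fk qk C_def by (rule resolvent_step[OF \<theta>]) (auto simp: ss_def yy_def intro: s y)
    define d where "d = discount \<theta> e k z"
    define d' where "d' = discount \<theta> e (Suc k) z"
    have dd: "d' = d * exp (- (e\<^sup>2 * q z))" by (simp add: d_def d'_def discount_Suc q_def)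
    have d: "0 \<le> d" "d \<le> 1" "0 \<le> d'" "d' \<le> 1" using D by (auto simp: d_def d'_def)
    \<comment> \<open>The first summand is the interplay of killing and generator, the second the
      Taylor remainder across the possibly crossed boundary.\<close>
    have Err_eq: "Err \<omega> = d * (exp (- (e\<^sup>2 * q z)) * (F k z + e\<^sup>2 * (q z * F k z - 1)) - (F k z - e\<^sup>2)) + d' * R"
    proof -
      have "Err \<omega> = d' * F (Suc k) z - d * F k z + e\<^sup>2 * d + e * (d' * resolvent_dy \<theta> ss yy * z k) - e\<^sup>2 * (d' * (q z * F k z - 1) * (z k)\<^sup>2) + e\<^sup>2 * (d' * (q z * F k z - 1))"
        by (simp add: Err_def z_def d_def d'_def f1_def f2_def ss_def yy_def)
      also have "F (Suc k) z = R + (F k z - zz * resolvent_dy \<theta> ss yy + zz\<^sup>2 * (q z * F k z - 1))"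
        by (simp add: R_def)
      finally show ?thesis unfolding dd zz_def by (simp add: algebra_simps power_mult_distrib)
    qed
    have "\<bar>Err \<omega>\<bar> \<le> 1 * (3 * ((e\<^sup>2)\<^sup>2 * q z)) + 1 * (C * (\<bar>zz\<bar> ^ 3 + (max 0 (zz - yy))\<^sup>2))"
      unfolding Err_eq
    proof (rule order_trans[OF abs_triangle_ineq], unfold abs_mult[of d] abs_mult[of d'], intro add_mono mult_mono)
      show "\<bar>exp (- (e\<^sup>2 * q z)) * (F k z + e\<^sup>2 * (q z * F k z - 1)) - (F k z - e\<^sup>2)\<bar> \<le> 3 * ((e\<^sup>2)\<^sup>2 * q z)"
        using q[of z] F qF by (intro discount_error) auto
    qed (use d R in auto)
    also have "\<dots> = bd \<omega>"
    proof -
      have "bd \<omega> = 3 * e ^ 4 * (1 + \<theta> * e * walk_max z k) + C * (e ^ 3 * \<bar>z k\<bar> ^ 3 + e\<^sup>2 * (walk_max z (Suc k) - walk_max z k)\<^sup>2)"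
        by (simp add: bd_def z_def del: walk_max.simps)
      moreover have "\<bar>zz\<bar> ^ 3 = e ^ 3 * \<bar>z k\<bar> ^ 3" using e by (simp add: zz_def abs_mult power_mult_distrib)
      moreover have "(e\<^sup>2)\<^sup>2 = e ^ 4" by (simp add: power_mult[symmetric])
      ultimately show ?thesis
        unfolding incr power_mult_distrib q_def kill_rate_def by (simp add: mult_ac del: walk_max.simps)
    qed
    finally show ?thesis .
  qed
  have "\<bar>expectation Err\<bar> \<le> expectation (\<lambda>\<omega>. \<bar>Err \<omega>\<bar>)" by (rule integral_abs_bound)
  also have "\<dots> \<le> expectation bd" using pw by (intro integral_mono integrable_abs iErr ibd)
  also have "\<dots> = 3 * e ^ 4 * (1 + \<theta> * e * expectation (\<lambda>\<omega>. walk_max (\<xi> \<omega>) k)) + C * (e ^ 3 * expectation (\<lambda>\<omega>. \<bar>\<zeta> k \<omega>\<bar> ^ 3) + e\<^sup>2 * expectation (\<lambda>\<omega>. (walk_max (\<xi> \<omega>) (Suc k) - walk_max (\<xi> \<omega>) k)\<^sup>2))"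
    unfolding bd_def using walk_max_integrable(1)[of k] walk_max_increment_integrable[of k] zeta_power_integrable(2)[of k 3]
    by (simp add: prob_space del: walk_max.simps)
  also have "\<dots> \<le> 3 * e ^ 4 * (1 + \<theta> * e * expectation (\<lambda>\<omega>. walk_max (\<xi> \<omega>) k)) + C * (e ^ 3 * 2 + e\<^sup>2 * expectation (\<lambda>\<omega>. (walk_max (\<xi> \<omega>) (Suc k) - walk_max (\<xi> \<omega>) k)\<^sup>2))"
    using e C zeta_moments(3)[of k] by (intro add_left_mono mult_left_mono add_right_mono) auto
  finally show ?thesis unfolding EErr C_def by (simp add: mult.commute)
qed

end

context gaussian_walk
begin

text \<open>Summing the one-step estimates telescopes to the initial value F(0, 0) minus a terminal
  value, which is at most the discount exp(- e^2 K) because the resolvent is at most 1.\<close>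

lemma resolvent_sum_bound:
  assumes \<theta>: "0 \<le> \<theta>" and e: "0 \<le> e" and a: "0 < a" and r: "0 < r" "real K \<le> r\<^sup>2"
  shows "\<bar>e\<^sup>2 * (\<Sum>k<K. expectation (\<lambda>\<omega>. discount \<theta> e k (\<xi> \<omega>))) - resolvent \<theta> 0 0\<bar>
    \<le> exp (- (e\<^sup>2 * real K)) + (3 * e ^ 4 * real K * (1 + \<theta> * e * (5/2 * r))
       + (6 * \<theta> + 4 * \<theta>\<^sup>2) * (2 * e ^ 3 * real K + e\<^sup>2 * (5/2 * a * r + 2 * real K / a)))"
proof -
  define C where "C = 6 * \<theta> + 4 * \<theta>\<^sup>2"
  have C: "0 \<le> C" using \<theta> by (simp add: C_def)
  define F where "F k z = resolvent \<theta> (e * walk_max z k) (e * (walk_max z k - walk z k))" for k z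
  define u where "u k = expectation (\<lambda>\<omega>. discount \<theta> e k (\<xi> \<omega>) * F k (\<xi> \<omega>))" for k
  define v where "v k = expectation (\<lambda>\<omega>. discount \<theta> e k (\<xi> \<omega>))" for k
  define m2 where "m2 k = expectation (\<lambda>\<omega>. (walk_max (\<xi> \<omega>) (Suc k) - walk_max (\<xi> \<omega>) k)\<^sup>2)" for k
  note D = discount_le[OF \<theta> e]
  have step: "\<bar>u (Suc k) - u k + e\<^sup>2 * v k\<bar> \<le> 3 * e ^ 4 * (1 + \<theta> * e * (5/2 * r)) + C * (2 * e ^ 3 + e\<^sup>2 * m2 k)" if "k < K" for k
  proof -
    have "\<bar>u (Suc k) - u k + e\<^sup>2 * v k\<bar> \<le> 3 * e ^ 4 * (1 + \<theta> * e * expectation (\<lambda>\<omega>. walk_max (\<xi> \<omega>) k)) + C * (2 * e ^ 3 + e\<^sup>2 * m2 k)"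
      unfolding u_def v_def F_def m2_def C_def by (rule resolvent_step_expectation[OF \<theta> e])
    also have "\<dots> \<le> 3 * e ^ 4 * (1 + \<theta> * e * (5/2 * r)) + C * (2 * e ^ 3 + e\<^sup>2 * m2 k)"
      using that r \<theta> e by (intro add_right_mono mult_left_mono add_left_mono expectation_walk_max) auto
    finally show ?thesis .
  qed
  have "(\<Sum>k<K. u (Suc k) - u k + e\<^sup>2 * v k) = u K - u 0 + e\<^sup>2 * (\<Sum>k<K. v k)"
    using sum_lessThan_telescope[of u K] by (simp add: sum.distrib sum_distrib_left)
  moreover have "\<bar>\<Sum>k<K. u (Suc k) - u k + e\<^sup>2 * v k\<bar> \<le> (\<Sum>k<K. 3 * e ^ 4 * (1 + \<theta> * e * (5/2 * r)) + C * (2 * e ^ 3 + e\<^sup>2 * m2 k))"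
    by (rule order_trans[OF sum_abs sum_mono]) (use step in blast)
  moreover have "(\<Sum>k<K. 3 * e ^ 4 * (1 + \<theta> * e * (5/2 * r)) + C * (2 * e ^ 3 + e\<^sup>2 * m2 k))
     = 3 * e ^ 4 * real K * (1 + \<theta> * e * (5/2 * r)) + C * (2 * e ^ 3 * real K + e\<^sup>2 * (\<Sum>k<K. m2 k))"
    by (simp only: sum.distrib sum_distrib_left[symmetric] sum_constant card_lessThan) (simp add: algebra_simps)
  moreover have "C * (2 * e ^ 3 * real K + e\<^sup>2 * (\<Sum>k<K. m2 k)) \<le> C * (2 * e ^ 3 * real K + e\<^sup>2 * (5/2 * a * r + 2 * real K / a))"
    using expectation_walk_max_increments[OF a r] C unfolding m2_def
    by (intro mult_left_mono add_left_mono) auto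
  moreover have "u 0 = resolvent \<theta> 0 0" by (simp add: u_def F_def discount_def walk_def prob_space)
  moreover have "0 \<le> u K" "u K \<le> exp (- (e\<^sup>2 * real K))"
  proof -
    have s: "0 \<le> e * walk_max z K" and y: "0 \<le> e * (walk_max z K - walk z K)" for z
      using e walk_max_nonneg[of z K] walk_le_max[of z K] by auto
    have F: "0 \<le> F K z" "F K z \<le> 1" for z
    proof -
      show "0 \<le> F K z" unfolding F_def by (rule resolvent_bounds[OF \<theta> s y])
      have "F K z \<le> 1 / kill_rate \<theta> (e * walk_max z K)" unfolding F_def by (rule resolvent_bounds[OF \<theta> s y])
      also have "\<dots> \<le> 1" using kill_rate_ge_1[OF \<theta> s, of z] by simp
      finally show "F K z \<le> 1" .
    qed
    show "0 \<le> u K" unfolding u_def using F D by (intro integral_nonneg_AE AE_I2) auto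
    have [measurable]: "(\<lambda>\<omega>. F K (\<xi> \<omega>)) \<in> borel_measurable M"
      unfolding F_def using measurable_compose[OF _ resolvent_measurable(1), of "\<lambda>\<omega>. (e * walk_max (\<xi> \<omega>) K, e * (walk_max (\<xi> \<omega>) K - walk (\<xi> \<omega>) K))"] by simp
    have [measurable]: "(\<lambda>\<omega>. discount \<theta> e K (\<xi> \<omega>)) \<in> borel_measurable M"
      unfolding discount_eq by measurable
    have "u K \<le> expectation (\<lambda>\<omega>. exp (- (e\<^sup>2 * real K)) * 1)"
      unfolding u_def
    proof (rule integral_mono)
      show "integrable M (\<lambda>\<omega>. discount \<theta> e K (\<xi> \<omega>) * F K (\<xi> \<omega>))"
      proof (rule integrable_const_bound[where B = "1 * 1"])
        show "AE \<omega> in M. norm (discount \<theta> e K (\<xi> \<omega>) * F K (\<xi> \<omega>)) \<le> 1 * 1"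
          unfolding real_norm_def abs_mult using D F by (intro AE_I2 mult_mono) (auto simp: abs_of_nonneg)
      qed measurable
      show "discount \<theta> e K (\<xi> \<omega>) * F K (\<xi> \<omega>) \<le> exp (- (e\<^sup>2 * real K)) * 1" for \<omega>
        using D F by (intro mult_mono) auto
    qed simp
    thus "u K \<le> exp (- (e\<^sup>2 * real K))" by (simp add: prob_space)
  qed
  ultimately show ?thesis unfolding v_def[symmetric] C_def[symmetric] by linarith
qed

text \<open>
  Mesh \<open>e = 1/j ^ 8\<close> with \<open>j ^ 18\<close> steps covers the time \<open>j\<^sup>2\<close>; taking \<open>r = j ^ 9\<close> and \<open>a = j ^ 4\<close> in the
  previous bound makes every error term vanish.
\<close>

lemma resolvent_limit:
  assumes \<theta>: "0 \<le> \<theta>"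
  shows "(\<lambda>j. (1 / real j ^ 8)\<^sup>2 * (\<Sum>k<j ^ 18. expectation (\<lambda>\<omega>. discount \<theta> (1 / real j ^ 8) k (\<xi> \<omega>)))) \<longlonglongrightarrow> resolvent \<theta> 0 0"
proof (rule LIM_zero_cancel, rule Lim_null_comparison)
  let ?b = "\<lambda>j. exp (- ((1 / real j ^ 8)\<^sup>2 * real j ^ 18)) + (3 * (1 / real j ^ 8) ^ 4 * real j ^ 18 * (1 + \<theta> * (1 / real j ^ 8) * (5/2 * real j ^ 9))
       + (6 * \<theta> + 4 * \<theta>\<^sup>2) * (2 * (1 / real j ^ 8) ^ 3 * real j ^ 18 + (1 / real j ^ 8)\<^sup>2 * (5/2 * real j ^ 4 * real j ^ 9 + 2 * real j ^ 18 / real j ^ 4)))"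
  show "\<forall>\<^sub>F j in sequentially. norm ((1 / real j ^ 8)\<^sup>2 * (\<Sum>k<j ^ 18. expectation (\<lambda>\<omega>. discount \<theta> (1 / real j ^ 8) k (\<xi> \<omega>))) - resolvent \<theta> 0 0) \<le> ?b j"
    using eventually_gt_at_top[of 0]
  proof eventually_elim
    case (elim j)
    have "real (j ^ 18) \<le> (real j ^ 9)\<^sup>2" by (simp add: power_mult[symmetric])
    from resolvent_sum_bound[OF \<theta> _ _ _ this, of "1 / real j ^ 8" "real j ^ 4"] elim
    show ?case by simp
  qed
  show "?b \<longlonglongrightarrow> 0" by real_asymp
qed

end

section \<open>From the walk to Brownian motion\<close>

text \<open>Both the discrete area and the sum over discounted steps are read as integrals of step
  functions, so that dominated convergence in t applies to each.\<close>

lemma has_bochner_integral_step_function: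
  fixes v :: "nat \<Rightarrow> real"
  assumes d: "0 < d"
  shows "has_bochner_integral lborel (\<lambda>t. indicator {0..<d * real K} t * v (nat \<lfloor>t / d\<rfloor>)) (d * (\<Sum>k<K. v k))"
proof (induction K)
  case (Suc K)
  have "has_bochner_integral lborel (\<lambda>t. indicator {d * real K..<d * real (Suc K)} t *\<^sub>R v K) (d *\<^sub>R v K)"
  proof (rule has_bochner_integral_scaleR_left)
    have "has_bochner_integral lborel (indicator {d * real K..<d * real (Suc K)}) (measure lborel {d * real K..<d * real (Suc K)})"
      using d by (intro has_bochner_integral_real_indicator) auto
    thus "has_bochner_integral lborel (indicator {d * real K..<d * real (Suc K)}) d"
      using d by (simp add: algebra_simps)
  qed
  from has_bochner_integral_add[OF Suc this]
  have "has_bochner_integral lborel (\<lambda>t. indicator {0..<d * real K} t * v (nat \<lfloor>t / d\<rfloor>) + indicator {d * real K..<d * real (Suc K)} t * v K) (d * (\<Sum>k<Suc K. v k))"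
    by (simp add: algebra_simps)
  moreover have "indicator {0..<d * real K} t * v (nat \<lfloor>t / d\<rfloor>) + indicator {d * real K..<d * real (Suc K)} t * v K = indicator {0..<d * real (Suc K)} t * v (nat \<lfloor>t / d\<rfloor>)" for t
  proof (cases "t \<in> {d * real K..<d * real (Suc K)}")
    case True
    hence "real K \<le> t / d" "t / d < real K + 1" using d by (auto simp: field_simps)
    hence "\<lfloor>t / d\<rfloor> = int K" by linarith
    moreover have "0 \<le> t" using True d by (auto intro: order_trans[of 0 "d * real K"])
    ultimately show ?thesis using True by (auto simp: indicator_def)
  next
    case False
    have "d * real K \<le> d * real (Suc K)" using d by simp
    thus ?thesis using False by (auto simp: indicator_def simp del: of_nat_Suc)
  qed
  ultimately show ?case by simp
qed (simp add: has_bochner_integral_zero)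

section \<open>Grid approximation of the running maximum and of its area\<close>

lemma walk_max_ge: "i \<le> j \<Longrightarrow> walk z i \<le> walk_max z j"
proof (induction j)
  case (Suc j)
  thus ?case using walk_le_max[of z "Suc j"] by (cases "i = Suc j") (auto intro: max.coboundedI1)
qed (simp add: walk_def)

lemma walk_max_attained: "\<exists>i\<le>j. walk_max z j = walk z i"
proof (induction j)
  case (Suc j)
  then obtain i where "i \<le> j" "walk_max z j = walk z i" by blast
  thus ?case by (auto simp: max_def intro: exI[of _ i] exI[of _ "Suc j"])
qed (simp add: walk_def)

definition grid_increments :: "(real \<Rightarrow> real) \<Rightarrow> nat \<Rightarrow> nat \<Rightarrow> real" where
  "grid_increments x k i = x (real (Suc i) / real k) - x (real i / real k)"

lemma walk_grid_increments: "walk (grid_increments x k) i = x (real i / real k) - x 0"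
  using sum_lessThan_telescope[of "\<lambda>i. x (real i / real k)" i] by (simp add: walk_def grid_increments_def)

lemma grid_floor_tendsto:
  fixes u :: real
  assumes "0 \<le> u"
  shows "(\<lambda>k. real (nat \<lfloor>u * real k\<rfloor>) / real k) \<longlonglongrightarrow> u"
proof (rule real_tendsto_sandwich)
  show "\<forall>\<^sub>F k in sequentially. u - 1 / real k \<le> real (nat \<lfloor>u * real k\<rfloor>) / real k"
    using eventually_gt_at_top[of 0]
  proof eventually_elim
    case (elim k)
    have "u * real k - 1 \<le> real (nat \<lfloor>u * real k\<rfloor>)" using assms by linarith
    hence "(u * real k - 1) / real k \<le> real (nat \<lfloor>u * real k\<rfloor>) / real k" by (rule divide_right_mono) simp
    thus ?case using elim by (simp add: diff_divide_distrib)
  qed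
  show "\<forall>\<^sub>F k in sequentially. real (nat \<lfloor>u * real k\<rfloor>) / real k \<le> u"
    using eventually_gt_at_top[of 0]
  proof eventually_elim
    case (elim k)
    have "real (nat \<lfloor>u * real k\<rfloor>) \<le> u * real k" using assms by simp
    thus ?case using elim by (simp add: divide_le_eq)
  qed
  show "(\<lambda>k. u - 1 / real k) \<longlonglongrightarrow> u" by real_asymp
qed simp

text \<open>The grid maximum lies between the value at the grid point just to the left of a
  maximiser and the true maximum; continuity closes the gap.\<close>

lemma walk_max_grid_tendsto:
  fixes x :: "real \<Rightarrow> real"
  assumes x: "continuous_on {0..} x" and t: "0 \<le> t"
  shows "(\<lambda>k. walk_max (grid_increments x k) (nat \<lfloor>t * real k\<rfloor>)) \<longlonglongrightarrow> (SUP u\<in>{0..t}. x u) - x 0"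
proof -
  have xt: "continuous_on {0..t} x" by (rule continuous_on_subset[OF x]) auto
  have "\<exists>u\<in>{0..t}. \<forall>v\<in>{0..t}. x v \<le> x u" using t by (intro continuous_attains_sup xt) auto
  then obtain u where u: "0 \<le> u" "u \<le> t" "\<And>v. v \<in> {0..t} \<Longrightarrow> x v \<le> x u" by auto
  have S: "(SUP u\<in>{0..t}. x u) = x u" using u t by (intro cSup_eq_maximum) auto
  show ?thesis unfolding S
  proof (rule real_tendsto_sandwich)
    show "\<forall>\<^sub>F k in sequentially. x (real (nat \<lfloor>u * real k\<rfloor>) / real k) - x 0 \<le> walk_max (grid_increments x k) (nat \<lfloor>t * real k\<rfloor>)"
    proof (rule always_eventually, rule allI)
      fix k
      have "nat \<lfloor>u * real k\<rfloor> \<le> nat \<lfloor>t * real k\<rfloor>" using u by (intro nat_mono floor_mono mult_right_mono) auto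
      from walk_max_ge[OF this, of "grid_increments x k"]
      show "x (real (nat \<lfloor>u * real k\<rfloor>) / real k) - x 0 \<le> walk_max (grid_increments x k) (nat \<lfloor>t * real k\<rfloor>)"
        unfolding walk_grid_increments .
    qed
    show "\<forall>\<^sub>F k in sequentially. walk_max (grid_increments x k) (nat \<lfloor>t * real k\<rfloor>) \<le> x u - x 0"
      using eventually_gt_at_top[of 0]
    proof eventually_elim
      case (elim k)
      obtain i where i: "i \<le> nat \<lfloor>t * real k\<rfloor>" "walk_max (grid_increments x k) (nat \<lfloor>t * real k\<rfloor>) = x (real i / real k) - x 0"
        using walk_max_attained[of "nat \<lfloor>t * real k\<rfloor>" "grid_increments x k"] unfolding walk_grid_increments by blast
      have "real i \<le> t * real k" using i(1) t by (simp add: le_nat_iff le_floor_iff)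
      hence "real i / real k \<in> {0..t}" using elim by (simp add: divide_le_eq)
      thus ?case using u(3) i(2) by simp
    qed
    have "(\<lambda>k. x (real (nat \<lfloor>u * real k\<rfloor>) / real k)) \<longlonglongrightarrow> x u"
      by (rule continuous_on_tendsto_compose[OF x grid_floor_tendsto[OF u(1)]]) (use u in auto)
    thus "(\<lambda>k. x (real (nat \<lfloor>u * real k\<rfloor>) / real k) - x 0) \<longlonglongrightarrow> x u - x 0" by (intro tendsto_intros)
  qed simp
qed

lemma walk_area_grid_tendsto:
  fixes x :: "real \<Rightarrow> real"
  assumes x: "continuous_on {0..} x"
  shows "(\<lambda>k. walk_area (grid_increments x k) k / real k) \<longlonglongrightarrow> (LBINT t:{0..1}. (SUP u\<in>{0..t}. x u)) - x 0"
proof -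
  define S where "S t = (SUP u\<in>{0..t}. x u) - x 0" for t
  have "compact (x ` {0..1})" by (intro compact_continuous_image continuous_on_subset[OF x]) auto
  then obtain Bd where Bd: "\<And>t. 0 \<le> t \<Longrightarrow> t \<le> 1 \<Longrightarrow> \<bar>x t\<bar> \<le> Bd"
    using compact_imp_bounded bounded_iff by (metis atLeastAtMost_iff image_eqI real_norm_def)
  define f where "f k t = indicator {0..<1} t * walk_max (grid_increments x k) (nat \<lfloor>t * real k\<rfloor>)" for k :: nat and t :: real
  have f: "has_bochner_integral lborel (f k) (walk_area (grid_increments x k) k / real k)" if "0 < k" for k
    using has_bochner_integral_step_function[of "1 / real k" k "walk_max (grid_increments x k)"] that
    by (simp add: f_def[abs_def] walk_area_def)
  have lim: "(\<lambda>k. f k t) \<longlonglongrightarrow> indicator {0..<1} t * S t" for t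
    unfolding f_def S_def using walk_max_grid_tendsto[OF x, of t] by (cases "t \<in> {0..<1}") (auto intro: tendsto_mult_left)
  have mf: "f (Suc k) \<in> borel_measurable lborel" for k
    using f[of "Suc k"] by (auto simp: has_bochner_integral_iff)
  \<comment> \<open>The running supremum inherits measurability in t as a pointwise limit of step
    functions. The shift to \<open>Suc k\<close> keeps the mesh 1/k away from division by
    zero.\<close>
  have mS: "(\<lambda>t. indicator {0..<1} t * S t) \<in> borel_measurable lborel"
    by (rule borel_measurable_LIMSEQ_real[OF _ mf]) (rule LIMSEQ_Suc[OF lim])
  have "(\<lambda>k. \<integral>t. f (Suc k) t \<partial>lborel) \<longlonglongrightarrow> (\<integral>t. indicator {0..<1} t * S t \<partial>lborel)"
  proof (rule integral_dominated_convergence[where w = "\<lambda>t. indicator {0..<1} t * (2 * Bd)"])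
    show "AE t in lborel. (\<lambda>k. f (Suc k) t) \<longlonglongrightarrow> indicator {0..<1} t * S t"
      using LIMSEQ_Suc[OF lim] by (intro AE_I2)
    show "AE t in lborel. norm (f (Suc k) t) \<le> indicator {0..<1} t * (2 * Bd)" for k
    proof (rule AE_I2)
      fix t :: real
      show "norm (f (Suc k) t) \<le> indicator {0..<1} t * (2 * Bd)"
      proof (cases "t \<in> {0..<1}")
        case True
        obtain i where i: "i \<le> nat \<lfloor>t * real (Suc k)\<rfloor>" "walk_max (grid_increments x (Suc k)) (nat \<lfloor>t * real (Suc k)\<rfloor>) = x (real i / real (Suc k)) - x 0"
          using walk_max_attained[of "nat \<lfloor>t * real (Suc k)\<rfloor>" "grid_increments x (Suc k)"] unfolding walk_grid_increments by blast
        have "real i \<le> t * real (Suc k)" using i(1) True by (simp add: le_nat_iff le_floor_iff del: of_nat_Suc)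
        also have "\<dots> \<le> 1 * real (Suc k)" using True by (intro mult_right_mono) auto
        finally have "\<bar>x (real i / real (Suc k))\<bar> \<le> Bd" by (intro Bd) (auto simp: divide_le_eq)
        moreover have "\<bar>x 0\<bar> \<le> Bd" by (intro Bd) auto
        ultimately show ?thesis using True by (simp add: f_def i(2) del: of_nat_Suc)
      qed (simp add: f_def)
    qed
    show "(\<lambda>t. indicator {0..<1} t * S t) \<in> borel_measurable lborel" by (rule mS)
    show "f (Suc k) \<in> borel_measurable lborel" for k by (rule mf)
  qed simp
  moreover have "(\<integral>t. f (Suc k) t \<partial>lborel) = walk_area (grid_increments x (Suc k)) (Suc k) / real (Suc k)" for k
    using f[of "Suc k"] by (simp add: has_bochner_integral_iff)
  ultimately have conv: "(\<lambda>k. walk_area (grid_increments x k) k / real k) \<longlonglongrightarrow> (\<integral>t. indicator {0..<1} t * S t \<partial>lborel)"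
    by (simp add: LIMSEQ_imp_Suc[where f = "\<lambda>k. walk_area (grid_increments x k) k / real k"] del: of_nat_Suc)
  have "(\<integral>t. indicator {0..<1} t * S t \<partial>lborel) = (LBINT t:{0..1}. (SUP u\<in>{0..t}. x u)) - x 0"
  proof -
    have iS: "integrable lborel (\<lambda>t. indicator {0..<1} t * S t)"
    proof (rule Bochner_Integration.integrable_bound[where f = "\<lambda>t. indicator {0..<1} t * (2 * Bd)"])
      have B0: "0 \<le> Bd" using Bd[of 0] by simp
      show "AE t in lborel. norm (indicator {0..<1} t * S t) \<le> norm (indicator {0..<1::real} t * (2 * Bd))"
      proof (rule AE_I2)
        fix t :: real
        show "norm (indicator {0..<1} t * S t) \<le> norm (indicator {0..<1} t * (2 * Bd))"
        proof (cases "t \<in> {0..<1}")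
          case True
          have "continuous_on {0..t} x" by (rule continuous_on_subset[OF x]) auto
          hence "\<exists>u\<in>{0..t}. \<forall>v\<in>{0..t}. x v \<le> x u" using True by (intro continuous_attains_sup) auto
          then obtain u where u: "u \<in> {0..t}" "\<And>v. v \<in> {0..t} \<Longrightarrow> x v \<le> x u" by auto
          have "(SUP u\<in>{0..t}. x u) = x u" using u by (intro cSup_eq_maximum) auto
          thus ?thesis using True u(1) Bd[of u] Bd[of 0] B0 by (simp add: S_def)
        qed simp
      qed
      show "(\<lambda>t. indicator {0..<1} t * S t) \<in> borel_measurable lborel" by (rule mS)
    qed simp
    \<comment> \<open>The step functions live on the half-open interval, the area on the closed one;
      they differ by the null set t = 1.\<close>
    have AE1: "AE t in lborel. t \<noteq> (1::real)" by (rule AE_lborel_singleton)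
    have "(LBINT t:{0..1}. (SUP u\<in>{0..t}. x u)) = (\<integral>t. indicator {0..<1} t * S t + indicator {0..<1} t * x 0 \<partial>lborel)"
      unfolding set_lebesgue_integral_def
    proof (rule integral_cong_AE)
      show m: "(\<lambda>t. indicator {0..<1} t * S t + indicator {0..<1} t * x 0) \<in> borel_measurable lborel"
        using mS by measurable
      have e: "(\<lambda>t. indicator {0..1} t *\<^sub>R (SUP u\<in>{0..t}. x u)) = (\<lambda>t. (indicator {0..<1} t * S t + indicator {0..<1} t * x 0) + indicator {1} t * (SUP u\<in>{0..1}. x u))"
        by (auto simp: fun_eq_iff S_def indicator_def)
      show "(\<lambda>t. indicator {0..1} t *\<^sub>R (SUP u\<in>{0..t}. x u)) \<in> borel_measurable lborel"
        unfolding e using m by measurable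
      show "AE t in lborel. indicator {0..1} t *\<^sub>R (SUP u\<in>{0..t}. x u) = indicator {0..<1} t * S t + indicator {0..<1} t * x 0"
        using AE1 by eventually_elim (auto simp: S_def indicator_def)
    qed
    also have "\<dots> = (\<integral>t. indicator {0..<1} t * S t \<partial>lborel) + x 0"
      using iS by simp
    finally show ?thesis by simp
  qed
  thus ?thesis using conv by simp
qed

section \<open>Transfer to Brownian motion by discrete scaling\<close>

context gaussian_walk
begin

text \<open>Independence and the normal laws make the joint law of the first n steps a product
  measure that no longer mentions the probability space.\<close>

lemma expectation_eq_PiM:
  fixes f :: "(nat \<Rightarrow> real) \<Rightarrow> real"
  assumes f: "f \<in> borel_measurable (Pi\<^sub>M {..<n} (\<lambda>_. borel))" and f_restrict: "\<And>z. f (restrict z {..<n}) = f z"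
    and n: "0 < n"
  shows "expectation (\<lambda>\<omega>. f (\<xi> \<omega>)) = (\<integral>z. f z \<partial>(Pi\<^sub>M {..<n} (\<lambda>_. density lborel std_normal_density)))"
proof -
  have m: "(\<lambda>\<omega>. restrict (\<xi> \<omega>) {..<n}) \<in> measurable M (Pi\<^sub>M {..<n} (\<lambda>_. borel))"
    by (rule measurable_restrict) simp
  have "distr M (Pi\<^sub>M {..<n} (\<lambda>_. borel)) (\<lambda>\<omega>. restrict (\<xi> \<omega>) {..<n}) = Pi\<^sub>M {..<n} (\<lambda>i. distr M borel (\<zeta> i))"
    using indep_vars_iff_distr_eq_PiM[where I = "{..<n}" and M' = "\<lambda>_. borel" and X = \<zeta>] indep[of n] n by auto
  also have "\<dots> = Pi\<^sub>M {..<n} (\<lambda>_. density lborel std_normal_density)"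
  proof (rule PiM_cong)
    fix i
    have "distr M borel (\<zeta> i) = distr M lborel (\<zeta> i)" by (rule distr_cong) auto
    also have "\<dots> = density lborel std_normal_density" using normal[of i] by (simp add: distributed_def)
    finally show "distr M borel (\<zeta> i) = density lborel std_normal_density" .
  qed simp
  finally have D: "distr M (Pi\<^sub>M {..<n} (\<lambda>_. borel)) (\<lambda>\<omega>. restrict (\<xi> \<omega>) {..<n}) = Pi\<^sub>M {..<n} (\<lambda>_. density lborel std_normal_density)" .
  have "expectation (\<lambda>\<omega>. f (\<xi> \<omega>)) = expectation (\<lambda>\<omega>. f (restrict (\<xi> \<omega>) {..<n}))" by (simp add: f_restrict)
  also have "\<dots> = integral\<^sup>L (distr M (Pi\<^sub>M {..<n} (\<lambda>_. borel)) (\<lambda>\<omega>. restrict (\<xi> \<omega>) {..<n})) f"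
    using integral_distr[OF m f] by simp
  finally show ?thesis unfolding D .
qed

end

text \<open>The substitute for Brownian scaling: only finitely many steps are compared in law, never
  whole paths.\<close>

lemma gaussian_walk_expectation_eq:
  fixes f :: "(nat \<Rightarrow> real) \<Rightarrow> real"
  assumes 1: "gaussian_walk M \<zeta>" and 2: "gaussian_walk M' \<zeta>'"
    and f: "f \<in> borel_measurable (Pi\<^sub>M {..<n} (\<lambda>_. borel))" "\<And>z. f (restrict z {..<n}) = f z" and n: "0 < n"
  shows "(\<integral>\<omega>. f (\<lambda>i. \<zeta> i \<omega>) \<partial>M) = (\<integral>\<omega>. f (\<lambda>i. \<zeta>' i \<omega>) \<partial>M')"
  using gaussian_walk.expectation_eq_PiM[OF 1 f n] gaussian_walk.expectation_eq_PiM[OF 2 f n] by simp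

lemma walk_area_scale:
  assumes "0 \<le> c"
  shows "walk_area (\<lambda>i. c * z i) k = c * walk_area z k"
  unfolding walk_area_def by (simp add: walk_max_scale[OF assms] sum_distrib_left)

context standard_brownian_motion
begin

lemma gaussian_walk_increments:
  assumes k: "0 < k"
  shows "gaussian_walk M (\<lambda>i \<omega>. sqrt (real k) * grid_increments (\<lambda>t. B t \<omega>) k i)"
proof -
  have ind: "indep_vars (\<lambda>_. borel) (\<lambda>i \<omega>. B (real (Suc i) / real k) \<omega> - B (real i / real k) \<omega>) {..<n}" for n
    by (rule independent_increments[of "\<lambda>i. real i / real k"]) (use k in \<open>auto simp: divide_strict_right_mono\<close>)
  show ?thesis
  proof
    fix n
    have "indep_vars (\<lambda>_. borel) (\<lambda>i. (\<lambda>x. sqrt (real k) * x) \<circ> (\<lambda>\<omega>. B (real (Suc i) / real k) \<omega> - B (real i / real k) \<omega>)) {..<n}"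
      by (rule indep_vars_compose[OF ind]) simp
    thus "indep_vars (\<lambda>_. borel) (\<lambda>i \<omega>. sqrt (real k) * grid_increments (\<lambda>t. B t \<omega>) k i) {..<n}"
      by (simp add: o_def grid_increments_def)
  next
    fix i
    have "distributed M lborel (\<lambda>\<omega>. B (real (Suc i) / real k) \<omega> - B (real i / real k) \<omega>) (normal_density 0 (sqrt (real (Suc i) / real k - real i / real k)))"
      using k by (intro normal_increments) (auto simp: divide_strict_right_mono)
    moreover have "real (Suc i) / real k - real i / real k = 1 / real k" by (simp add: diff_divide_distrib[symmetric])
    ultimately have N: "distributed M lborel (\<lambda>\<omega>. B (real (Suc i) / real k) \<omega> - B (real i / real k) \<omega>) (normal_density 0 (sqrt (1 / real k)))"
      by simp
    have "distributed M lborel (\<lambda>\<omega>. 0 + sqrt (real k) * (B (real (Suc i) / real k) \<omega> - B (real i / real k) \<omega>)) (normal_density (0 + sqrt (real k) * 0) (\<bar>sqrt (real k)\<bar> * sqrt (1 / real k)))"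
      by (rule normal_density_affine[OF N]) (use k in auto)
    thus "distributed M lborel (\<lambda>\<omega>. sqrt (real k) * grid_increments (\<lambda>t. B t \<omega>) k i) std_normal_density"
      using k by (simp add: grid_increments_def real_sqrt_divide)
  qed
qed

definition grid_area :: "nat \<Rightarrow> 'a \<Rightarrow> real" where
  "grid_area k \<omega> = walk_area (grid_increments (\<lambda>t. B t \<omega>) k) k / real k"

lemma grid_area_tendsto:
  assumes "\<omega> \<in> space M"
  shows "(\<lambda>k. grid_area k \<omega>) \<longlonglongrightarrow> running_max_area B \<omega> - B 0 \<omega>"
  unfolding grid_area_def running_max_area_def running_max_def
  by (rule walk_area_grid_tendsto[OF continuous_paths[OF assms]])

lemma grid_area_nonneg: "0 \<le> grid_area k \<omega>"
  by (simp add: grid_area_def walk_area_nonneg)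

lemma grid_area_measurable [measurable]: "grid_area k \<in> borel_measurable M"
proof -
  have [measurable]: "B (real i / real j) \<in> borel_measurable M" for i j by (rule measurable_at) simp
  have [measurable]: "(\<lambda>\<omega>. walk (grid_increments (\<lambda>t. B t \<omega>) k) j) \<in> borel_measurable M" for j
    unfolding walk_def grid_increments_def by measurable
  have [measurable]: "(\<lambda>\<omega>. walk_max (grid_increments (\<lambda>t. B t \<omega>) k) j) \<in> borel_measurable M" for j
    by (induction j) auto
  show ?thesis unfolding grid_area_def[abs_def] walk_area_def by measurable
qed

text \<open>Grid areas, shifted by the initial value, converge at every sample point and not just
  almost surely, so measurability requires no completion of \<open>M\<close>.\<close>

lemma running_max_area_measurable [measurable]: "running_max_area B \<in> borel_measurable M"
proof -
  have [measurable]: "B 0 \<in> borel_measurable M" by (rule measurable_at) simp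
  show ?thesis
  proof (rule borel_measurable_LIMSEQ_real)
    fix \<omega> assume "\<omega> \<in> space M"
    from tendsto_add[OF grid_area_tendsto[OF this] tendsto_const[of "B 0 \<omega>"]]
    show "(\<lambda>k. grid_area k \<omega> + B 0 \<omega>) \<longlonglongrightarrow> running_max_area B \<omega>" by simp
  qed measurable
qed

lemma AE_grid_area_tendsto: "AE \<omega> in M. (\<lambda>k. grid_area k \<omega>) \<longlonglongrightarrow> running_max_area B \<omega>"
  using starts_at_zero AE_space
proof eventually_elim
  case (elim \<omega>)
  thus ?case using grid_area_tendsto[of \<omega>] by simp
qed

lemma AE_running_max_area_nonneg: "AE \<omega> in M. 0 \<le> running_max_area B \<omega>"
  using AE_grid_area_tendsto
proof eventually_elim
  case (elim \<omega>)
  show ?case by (rule LIMSEQ_le_const[OF elim]) (use grid_area_nonneg in auto)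
qed

lemma gaussian_walk_unit: "gaussian_walk M (\<lambda>i \<omega>. grid_increments (\<lambda>t. B t \<omega>) 1 i)"
  using gaussian_walk_increments[of 1] by simp

text \<open>In law, k unit steps are sqrt(k) times the k increments of mesh 1/k on [0, 1]. The
  scaled area of the walk thus becomes e^3 k sqrt(k) = (e^2 k)^(3/2) times the grid area, with e^2 k
  as elapsed time.\<close>

lemma expectation_discount:
  assumes k: "0 < k" and e: "0 \<le> e"
  shows "expectation (\<lambda>\<omega>. discount \<theta> e k (grid_increments (\<lambda>t. B t \<omega>) 1))
     = exp (- (e\<^sup>2 * real k)) * expectation (\<lambda>\<omega>. exp (- (\<theta> * ((e\<^sup>2 * real k) powr (3/2) * grid_area k \<omega>))))"
proof -
  have "expectation (\<lambda>\<omega>. discount \<theta> e k (grid_increments (\<lambda>t. B t \<omega>) 1)) = expectation (\<lambda>\<omega>. discount \<theta> e k (\<lambda>i. sqrt (real k) * grid_increments (\<lambda>t. B t \<omega>) k i))"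
  proof (rule gaussian_walk_expectation_eq[OF gaussian_walk_unit gaussian_walk_increments[OF k] _ _ k])
    show "discount \<theta> e k \<in> borel_measurable (Pi\<^sub>M {..<k} (\<lambda>_. borel))"
      unfolding discount_eq[abs_def] by measurable
    have "walk_area (restrict z {..<k}) k = walk_area z k" for z :: "nat \<Rightarrow> real" by (rule walk_area_cong) simp
    thus "discount \<theta> e k (restrict z {..<k}) = discount \<theta> e k z" for z by (simp add: discount_eq)
  qed
  also have "\<dots> = expectation (\<lambda>\<omega>. exp (- (e\<^sup>2 * real k)) * exp (- (\<theta> * ((e\<^sup>2 * real k) powr (3/2) * grid_area k \<omega>))))"
  proof (rule Bochner_Integration.integral_cong)
    fix \<omega>
    have "(e\<^sup>2 * real k) powr (3/2) = e ^ 3 * (real k * sqrt (real k))"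
    proof -
      have "(e\<^sup>2 * real k) powr (3/2) = (e\<^sup>2 * real k) * sqrt (e\<^sup>2 * real k)"
        using k e powr_mult_base[of "e\<^sup>2 * real k" "1/2"] by (simp add: powr_half_sqrt)
      also have "sqrt (e\<^sup>2 * real k) = e * sqrt (real k)" using e by (simp add: real_sqrt_mult)
      finally show ?thesis by (simp add: eval_nat_numeral mult_ac)
    qed
    thus "discount \<theta> e k (\<lambda>i. sqrt (real k) * grid_increments (\<lambda>t. B t \<omega>) k i) = exp (- (e\<^sup>2 * real k)) * exp (- (\<theta> * ((e\<^sup>2 * real k) powr (3/2) * grid_area k \<omega>)))"
      using k by (simp add: discount_eq walk_area_scale grid_area_def mult_ac)
  qed simp
  finally show ?thesis by simp
qed

text \<open>The time factor \<open>c\<close> and the grid size \<open>k\<close> vary together,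
  because at a fixed time t the number of walk steps grows as the mesh shrinks. Nonnegativity bounds
  every exponential by 1.\<close>

lemma grid_laplace_tendsto:
  assumes \<theta>: "0 \<le> \<theta>" and c0: "\<And>j. 0 \<le> c j" and c: "c \<longlonglongrightarrow> l" and k: "filterlim k at_top sequentially"
  shows "(\<lambda>j. expectation (\<lambda>\<omega>. exp (- (\<theta> * (c j * grid_area (k j) \<omega>))))) \<longlonglongrightarrow> expectation (\<lambda>\<omega>. exp (- (\<theta> * (l * running_max_area B \<omega>))))"
proof (rule integral_dominated_convergence[where w = "\<lambda>_. 1"])
  show "AE \<omega> in M. (\<lambda>j. exp (- (\<theta> * (c j * grid_area (k j) \<omega>)))) \<longlonglongrightarrow> exp (- (\<theta> * (l * running_max_area B \<omega>)))"
    using AE_grid_area_tendsto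
  proof eventually_elim
    case (elim \<omega>)
    from filterlim_compose[OF elim k] show ?case by (intro tendsto_intros c)
  qed
  show "AE \<omega> in M. norm (exp (- (\<theta> * (c j * grid_area (k j) \<omega>)))) \<le> 1" for j
    using \<theta> c0[of j] grid_area_nonneg by (intro AE_I2) simp
qed auto

text \<open>Both sides are F(0, 0). The discounted sums of \<open>resolvent_limit\<close> are
  integrals of the step functions \<open>f j\<close>; discrete scaling identifies their pointwise
  limit with the integrand on the left.\<close>

theorem running_max_area_laplace:
  assumes \<theta>: "0 < \<theta>"
  shows "(\<integral>t. indicator {0<..} t * (exp (- t) * expectation (\<lambda>\<omega>. exp (- (\<theta> * (t powr (3/2) * running_max_area B \<omega>))))) \<partial>lborel) = laplace_g (3 * \<theta> / (2 * sqrt 2)) 0 1"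
proof -
  interpret W: gaussian_walk M "\<lambda>i \<omega>. grid_increments (\<lambda>t. B t \<omega>) 1 i" by (rule gaussian_walk_unit)
  define e where "e j = 1 / real j ^ 8" for j
  define v where "v j k = expectation (\<lambda>\<omega>. discount \<theta> (e j) k (grid_increments (\<lambda>t. B t \<omega>) 1))" for j k
  define f where "f j t = indicator {0..<(e j)\<^sup>2 * real (j ^ 18)} t * v j (nat \<lfloor>t / (e j)\<^sup>2\<rfloor>)" for j and t :: real
  define g where "g t = indicator {0<..} t * (exp (- t) * expectation (\<lambda>\<omega>. exp (- (\<theta> * (t powr (3/2) * running_max_area B \<omega>)))))" for t
  have e: "0 < e j" if "0 < j" for j using that by (simp add: e_def)
  have e1: "(e j)\<^sup>2 \<le> 1" if "0 < j" for j using that by (simp add: e_def power_le_one one_le_power divide_le_eq)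
  have f: "has_bochner_integral lborel (f j) ((e j)\<^sup>2 * (\<Sum>k<j ^ 18. v j k))" if "0 < j" for j
    unfolding f_def using e[OF that] by (intro has_bochner_integral_step_function) simp
  have lim1: "(\<lambda>j. (e j)\<^sup>2 * (\<Sum>k<j ^ 18. v j k)) \<longlonglongrightarrow> resolvent \<theta> 0 0"
    unfolding e_def v_def using \<theta> by (intro W.resolvent_limit) simp
  have lim: "(\<lambda>j. f j t) \<longlonglongrightarrow> g t" if t: "t \<noteq> 0" for t
  proof (cases "0 < t")
    case False
    thus ?thesis using t by (simp add: f_def g_def indicator_def)
  next
    case True
    define k where "k j = nat \<lfloor>t / (e j)\<^sup>2\<rfloor>" for j
    have k_eq: "k j = nat \<lfloor>t * real (j ^ 16)\<rfloor>" for j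
      by (simp add: k_def e_def power_divide power_mult[symmetric])
    have k_top: "filterlim k at_top sequentially"
    proof -
      have "filterlim (\<lambda>j. t * real j ^ 16) at_top sequentially" using True by real_asymp
      hence "filterlim (\<lambda>j. nat \<lfloor>t * real j ^ 16\<rfloor>) at_top sequentially"
        by (intro filterlim_compose[OF filterlim_nat_sequentially] filterlim_compose[OF filterlim_floor_sequentially])
      thus ?thesis unfolding k_eq[abs_def] by simp
    qed
    have ek: "(\<lambda>j. (e j)\<^sup>2 * real (k j)) \<longlonglongrightarrow> t"
    proof -
      have "filterlim (\<lambda>j::nat. j ^ 16) sequentially sequentially" by real_asymp
      from filterlim_compose[OF grid_floor_tendsto[of t] this] True
      show ?thesis by (simp add: k_eq[abs_def] e_def power_divide power_mult[symmetric])
    qed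
    have "(\<lambda>j. exp (- ((e j)\<^sup>2 * real (k j))) * expectation (\<lambda>\<omega>. exp (- (\<theta> * (((e j)\<^sup>2 * real (k j)) powr (3/2) * grid_area (k j) \<omega>)))))
       \<longlonglongrightarrow> exp (- t) * expectation (\<lambda>\<omega>. exp (- (\<theta> * (t powr (3/2) * running_max_area B \<omega>))))"
      using \<theta> True by (intro tendsto_intros ek grid_laplace_tendsto k_top) auto
    moreover have "\<forall>\<^sub>F j in sequentially. exp (- ((e j)\<^sup>2 * real (k j))) * expectation (\<lambda>\<omega>. exp (- (\<theta> * (((e j)\<^sup>2 * real (k j)) powr (3/2) * grid_area (k j) \<omega>)))) = f j t"
    proof -
      have "\<forall>\<^sub>F j in sequentially. 0 < k j" using k_top eventually_gt_at_top[of "0::nat"] by (auto simp: filterlim_iff)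
      \<comment> \<open>The steps of the j-th walk cover the time interval up to j^2, so eventually
        the cut-off in \<open>f j\<close> does not affect t.\<close>
      moreover have "\<forall>\<^sub>F j::nat in sequentially. t < real j ^ 2" by real_asymp
      ultimately show ?thesis using eventually_gt_at_top[of 0]
      proof eventually_elim
        case (elim j)
        have "(e j)\<^sup>2 * real (j ^ 18) = real j ^ 2"
          using elim(3) by (simp add: e_def power_divide power_mult[symmetric] field_simps)
        hence "f j t = v j (k j)" using elim True by (simp add: f_def k_def)
        thus ?case unfolding v_def using expectation_discount[OF elim(1), of "e j" \<theta>] e[OF elim(3)] by simp
      qed
    qed
    ultimately have "(\<lambda>j. f j t) \<longlonglongrightarrow> exp (- t) * expectation (\<lambda>\<omega>. exp (- (\<theta> * (t powr (3/2) * running_max_area B \<omega>))))"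
      by (rule Lim_transform_eventually)
    thus ?thesis using True by (simp add: g_def)
  qed
  have v: "0 \<le> v j k" "v j k \<le> exp (- ((e j)\<^sup>2 * real k))" if j: "0 < j" for j k
  proof -
    have D: "0 \<le> discount \<theta> (e j) k z" "discount \<theta> (e j) k z \<le> exp (- ((e j)\<^sup>2 * real k))" "discount \<theta> (e j) k z \<le> 1" for z
      using discount_le[of \<theta> "e j"] \<theta> e[OF j] by auto
    show "0 \<le> v j k" unfolding v_def using D by (intro integral_nonneg_AE AE_I2) auto
    have m: "(\<lambda>\<omega>. discount \<theta> (e j) k (grid_increments (\<lambda>t. B t \<omega>) 1)) \<in> borel_measurable M"
      unfolding discount_eq by measurable
    have "v j k \<le> expectation (\<lambda>\<omega>. exp (- ((e j)\<^sup>2 * real k)))"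
      unfolding v_def
    proof (rule integral_mono)
      show "integrable M (\<lambda>\<omega>. discount \<theta> (e j) k (grid_increments (\<lambda>t. B t \<omega>) 1))"
        by (rule integrable_const_bound[where B = 1, OF _ m]) (use D in \<open>auto simp: abs_of_nonneg\<close>)
    qed (use D in auto)
    thus "v j k \<le> exp (- ((e j)\<^sup>2 * real k))" by (simp add: prob_space)
  qed
  have fmeas: "f (Suc j) \<in> borel_measurable lborel" for j
    using f[of "Suc j"] by (auto simp: has_bochner_integral_iff)
  have gmeas: "g \<in> borel_measurable lborel"
  proof (rule borel_measurable_LIMSEQ_real)
    \<comment> \<open>The factor removes t = 0, where \<open>f (Suc j)\<close> has the value 1 and
      the limit function 0.\<close>
    show "(\<lambda>j. indicator (- {0}) t * f (Suc j) t) \<longlonglongrightarrow> g t" for t :: real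
      using LIMSEQ_Suc[OF lim[of t]] by (cases "t = 0") (auto simp: g_def)
    show "(\<lambda>t. indicator (- {0}) t * f (Suc j) t) \<in> borel_measurable lborel" for j
      using fmeas[of j] by measurable
  qed
  have "(\<lambda>j. \<integral>t. f (Suc j) t \<partial>lborel) \<longlonglongrightarrow> (\<integral>t. g t \<partial>lborel)"
  \<comment> \<open>Rounding t down to the grid loses at most one time step, which is at most 1;
    this is the factor exp 1.\<close>
  proof (rule integral_dominated_convergence[where w = "\<lambda>t. exp 1 * (indicator {0..} t * exp (- t))"])
    show "integrable lborel (\<lambda>t. exp 1 * (indicator {0..} t * exp (- t) :: real))"
    proof -
      have "integrable lborel (\<lambda>t. indicator {0..} t * exp (- t) :: real)"
      proof (rule integrable_cong_AE_imp)
        show "integrable lborel (\<lambda>t. indicator {0<..} t * (t powr (1 - 1) * exp (- 1 * t)) :: real)"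
          using has_bochner_integral_Gamma[of 1 1] by (simp add: has_bochner_integral_iff)
        show "AE t in lborel. indicator {0<..} t * (t powr (1 - 1) * exp (- 1 * t)) = (indicator {0..} t * exp (- t) :: real)"
          using AE_lborel_singleton[of "0::real"] by eventually_elim (auto simp: indicator_def)
      qed simp
      thus ?thesis by simp
    qed
    show "AE t in lborel. (\<lambda>j. f (Suc j) t) \<longlonglongrightarrow> g t"
      using AE_lborel_singleton[of "0::real"] by eventually_elim (rule LIMSEQ_Suc[OF lim])
    show "AE t in lborel. norm (f (Suc j) t) \<le> exp 1 * (indicator {0..} t * exp (- t))" for j
    proof (rule AE_I2)
      fix t :: real
      show "norm (f (Suc j) t) \<le> exp 1 * (indicator {0..} t * exp (- t))"
      proof (cases "0 \<le> t")
        case True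
        define d where "d = (e (Suc j))\<^sup>2"
        have d: "0 < d" "d \<le> 1" using e[of "Suc j"] e1[of "Suc j"] by (auto simp: d_def)
        define k where "k = nat \<lfloor>t / d\<rfloor>"
        have "t / d - 1 \<le> real k" unfolding k_def using True d by linarith
        hence "d * (t / d - 1) \<le> d * real k" using d by (intro mult_left_mono) auto
        hence "t - 1 \<le> d * real k" using d by (simp add: right_diff_distrib)
        have "\<bar>f (Suc j) t\<bar> \<le> v (Suc j) k"
          using v(1)[of "Suc j" k] by (auto simp: f_def k_def d_def indicator_def)
        also have "\<dots> \<le> exp (- (d * real k))" using v(2)[of "Suc j" k] by (simp add: d_def)
        also have "\<dots> \<le> exp (1 - t)" using \<open>t - 1 \<le> d * real k\<close> by simp
        finally show ?thesis using True by (simp add: exp_diff exp_minus divide_inverse)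
      qed (simp add: f_def)
    qed
    show "g \<in> borel_measurable lborel" by (rule gmeas)
    show "f (Suc j) \<in> borel_measurable lborel" for j by (rule fmeas)
  qed
  moreover have "(\<integral>t. f (Suc j) t \<partial>lborel) = (e (Suc j))\<^sup>2 * (\<Sum>k<Suc j ^ 18. v (Suc j) k)" for j
    using f[of "Suc j"] by (simp add: has_bochner_integral_iff)
  ultimately have "(\<integral>t. g t \<partial>lborel) = resolvent \<theta> 0 0"
    using LIMSEQ_unique[OF _ LIMSEQ_Suc[OF lim1]] by simp
  thus ?thesis using resolvent_0[of \<theta> 0] \<theta> by (simp add: g_def[abs_def] kill_rate_def)
qed

end

section \<open>Moments and Laplace transforms\<close>

text \<open>The explicit sign in front of the last term is the point: after normalisation, the
  remainder is nonnegative for every order. The degenerate orders and arguments are included so that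
  the induction on moments can start at 0.\<close>

lemma exp_minus_maclaurin:
  fixes z :: real
  assumes "0 \<le> z"
  shows "\<exists>c. 0 \<le> c \<and> c \<le> z \<and> exp (- z) = (\<Sum>k<n. (- z) ^ k / fact k) + (- 1) ^ n * (exp (- c) * z ^ n / fact n)"
proof (cases "n = 0 \<or> z = 0")
  case True
  thus ?thesis
  proof
    assume "n = 0"
    thus ?thesis using assms by (intro exI[of _ z]) auto
  next
    assume z: "z = 0"
    show ?thesis
    proof (cases n)
      case (Suc m)
      have "(\<Sum>k<Suc m. (0::real) ^ k / fact k) = 1" by (subst sum.lessThan_Suc_shift) simp
      thus ?thesis using z Suc by (intro exI[of _ 0]) simp
    qed (use z in auto)
  qed
next
  case False
  define d where "d m y = (- 1) ^ m * exp (- y)" for m :: nat and y :: real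
  have "\<exists>t>0. t < z \<and> exp (- z) = (\<Sum>m<n. d m 0 / fact m * z ^ m) + d n t / fact n * z ^ n"
  proof (rule Maclaurin)
    show "\<forall>m t. m < n \<and> 0 \<le> t \<and> t \<le> z \<longrightarrow> DERIV (d m) t :> d (Suc m) t"
      unfolding d_def by (auto intro!: derivative_eq_intros)
  qed (use False assms in \<open>auto simp: d_def\<close>)
  then obtain t where t: "0 < t" "t < z" "exp (- z) = (\<Sum>m<n. d m 0 / fact m * z ^ m) + d n t / fact n * z ^ n" by blast
  have "(\<Sum>m<n. d m 0 / fact m * z ^ m) = (\<Sum>k<n. (- z) ^ k / fact k)"
    by (intro sum.cong) (auto simp: d_def power_minus[of z])
  thus ?thesis using t by (intro exI[of _ t]) (simp add: d_def mult_ac)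
qed

text \<open>
  Up to normalisation, \<open>T\<close> below is the remainder of \<open>exp (- \<theta> x)\<close> after \<open>n\<close> terms. It has constant
  sign and tends to \<open>x ^ n\<close> as \<open>\<theta>\<close> tends to 0, so Fatou's lemma yields the integrability of
  \<open>x ^ n\<close> under \<open>\<mu>\<close> without any tail estimate.
\<close>

lemma moments_eq_of_laplace_eq:
  fixes \<mu> \<nu> :: "real measure"
  assumes \<mu>: "real_distribution \<mu>" and \<nu>: "real_distribution \<nu>"
    and \<mu>0: "AE x in \<mu>. 0 \<le> x" and \<nu>0: "AE x in \<nu>. 0 \<le> x"
    and laplace: "\<And>\<theta>. 0 < \<theta> \<Longrightarrow> (\<integral>x. exp (- \<theta> * x) \<partial>\<mu>) = (\<integral>x. exp (- \<theta> * x) \<partial>\<nu>)"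
    and int\<nu>: "\<And>n. integrable \<nu> (\<lambda>x. x ^ n)"
  shows "integrable \<mu> (\<lambda>x. x ^ n) \<and> (\<integral>x. x ^ n \<partial>\<mu>) = (\<integral>x. x ^ n \<partial>\<nu>)"
proof (induction n rule: less_induct)
  case (less n)
  interpret M: real_distribution \<mu> by fact
  interpret N: real_distribution \<nu> by fact
  define T where "T \<theta> x = fact n * (- 1) ^ n * (exp (- \<theta> * x) - (\<Sum>k<n. (- \<theta>) ^ k / fact k * x ^ k)) / \<theta> ^ n" for \<theta> x :: real
  \<comment> \<open>The intermediate point c lies in [0, \<theta> x], and the normalised remainder
    is exp(- c) x^n.\<close>
  have T: "exp (- \<theta> * x) * x ^ n \<le> T \<theta> x" "T \<theta> x \<le> x ^ n" if \<theta>: "0 < \<theta>" and x: "0 \<le> x" for \<theta> x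
  proof -
    obtain c where c: "0 \<le> c" "c \<le> \<theta> * x" "exp (- (\<theta> * x)) = (\<Sum>k<n. (- (\<theta> * x)) ^ k / fact k) + (- 1) ^ n * (exp (- c) * (\<theta> * x) ^ n / fact n)"
      using exp_minus_maclaurin[of "\<theta> * x" n] \<theta> x by auto
    have "(\<Sum>k<n. (- (\<theta> * x)) ^ k / fact k) = (\<Sum>k<n. (- \<theta>) ^ k / fact k * x ^ k)"
      by (intro sum.cong) (auto simp: power_mult_distrib[symmetric])
    with c(3) have "exp (- \<theta> * x) - (\<Sum>k<n. (- \<theta>) ^ k / fact k * x ^ k) = (- 1) ^ n * (exp (- c) * (\<theta> * x) ^ n / fact n)" by simp
    hence "T \<theta> x = ((- 1) ^ n * (- 1) ^ n) * (exp (- c) * ((\<theta> * x) ^ n / \<theta> ^ n))"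
      unfolding T_def by simp
    also have "(- 1) ^ n * (- 1 :: real) ^ n = 1" by (simp add: power_add[symmetric])
    also have "(\<theta> * x) ^ n / \<theta> ^ n = x ^ n" using \<theta> by (simp add: power_mult_distrib)
    finally have eq: "T \<theta> x = exp (- c) * x ^ n" by simp
    have "exp (- \<theta> * x) \<le> exp (- c)" "exp (- c) \<le> 1" using c(1,2) by simp_all
    thus "exp (- \<theta> * x) * x ^ n \<le> T \<theta> x" "T \<theta> x \<le> x ^ n"
      unfolding eq using x by (auto intro!: mult_right_mono mult_left_le_one_le)
  qed
  have expint\<mu>: "integrable \<mu> (\<lambda>x. exp (- \<theta> * x))" if "0 < \<theta>" for \<theta>
    by (rule M.integrable_const_bound[where B = 1]) (use \<mu>0 that in \<open>auto elim!: eventually_mono\<close>)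
  have expint\<nu>: "integrable \<nu> (\<lambda>x. exp (- \<theta> * x))" if "0 < \<theta>" for \<theta>
    by (rule N.integrable_const_bound[where B = 1]) (use \<nu>0 that in \<open>auto elim!: eventually_mono\<close>)
  \<comment> \<open>Only powers below n occur in the subtracted polynomial; the induction hypothesis
    makes them integrable and, below, gives their integrals the same values under \<nu>.\<close>
  have Tint\<mu>: "integrable \<mu> (T \<theta>)" if "0 < \<theta>" for \<theta>
    unfolding T_def using less expint\<mu>[OF that]
    by (intro integrable_divide_zero integrable_mult_right Bochner_Integration.integrable_diff Bochner_Integration.integrable_sum) auto
  have Tint\<nu>: "integrable \<nu> (T \<theta>)" if "0 < \<theta>" for \<theta>
    unfolding T_def using int\<nu> expint\<nu>[OF that]
    by (intro integrable_divide_zero integrable_mult_right Bochner_Integration.integrable_diff Bochner_Integration.integrable_sum) auto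
  have Teq: "(\<integral>x. T \<theta> x \<partial>\<mu>) = (\<integral>x. T \<theta> x \<partial>\<nu>)" if \<theta>: "0 < \<theta>" for \<theta>
  proof -
    have "(\<integral>x. T \<theta> x \<partial>\<mu>) = fact n * (- 1) ^ n * ((\<integral>x. exp (- \<theta> * x) \<partial>\<mu>) - (\<Sum>k<n. (- \<theta>) ^ k / fact k * (\<integral>x. x ^ k \<partial>\<mu>))) / \<theta> ^ n"
      unfolding T_def using less expint\<mu>[OF \<theta>]
      by (subst integral_divide_zero, subst integral_mult_right_zero, subst Bochner_Integration.integral_diff)
         (auto simp: Bochner_Integration.integral_sum)
    also have "\<dots> = fact n * (- 1) ^ n * ((\<integral>x. exp (- \<theta> * x) \<partial>\<nu>) - (\<Sum>k<n. (- \<theta>) ^ k / fact k * (\<integral>x. x ^ k \<partial>\<nu>))) / \<theta> ^ n"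
      using less laplace[OF \<theta>] by simp
    also have "\<dots> = (\<integral>x. T \<theta> x \<partial>\<nu>)"
      unfolding T_def using int\<nu> expint\<nu>[OF \<theta>]
      by (subst integral_divide_zero, subst integral_mult_right_zero, subst Bochner_Integration.integral_diff)
         (auto simp: Bochner_Integration.integral_sum)
    finally show ?thesis .
  qed
  define th where "th m = 1 / real (Suc m)" for m
  have th: "0 < th m" for m by (simp add: th_def)
  have th0: "th \<longlonglongrightarrow> 0" unfolding th_def using LIMSEQ_inverse_real_of_nat by (simp add: inverse_eq_divide)
  have e_lim: "(\<lambda>m. exp (- th m * x) * x ^ n) \<longlonglongrightarrow> x ^ n" for x
  proof -
    have "(\<lambda>m. exp (- th m * x) * x ^ n) \<longlonglongrightarrow> exp (- 0 * x) * x ^ n" by (intro tendsto_intros th0)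
    thus ?thesis by simp
  qed
  have T_lim: "(\<lambda>m. T (th m) x) \<longlonglongrightarrow> x ^ n" if "0 \<le> x" for x
    by (rule tendsto_sandwich[OF _ _ e_lim tendsto_const]) (use T th that in auto)
  have int\<mu>: "integrable \<mu> (\<lambda>x. x ^ n)"
  proof (rule integrableI_nonneg)
    show "AE x in \<mu>. 0 \<le> x ^ n" using \<mu>0 by (auto elim: eventually_mono)
    have "(\<integral>\<^sup>+x. ennreal (x ^ n) \<partial>\<mu>) = (\<integral>\<^sup>+x. liminf (\<lambda>m. ennreal (T (th m) x)) \<partial>\<mu>)"
    proof (rule nn_integral_cong_AE)
      show "AE x in \<mu>. ennreal (x ^ n) = liminf (\<lambda>m. ennreal (T (th m) x))"
        using \<mu>0
      proof eventually_elim
        case (elim x)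
        have "(\<lambda>m. ennreal (T (th m) x)) \<longlonglongrightarrow> ennreal (x ^ n)" by (intro tendsto_ennrealI T_lim elim)
        thus ?case by (simp add: lim_imp_Liminf)
      qed
    qed
    also have "\<dots> \<le> liminf (\<lambda>m. \<integral>\<^sup>+x. ennreal (T (th m) x) \<partial>\<mu>)"
      by (rule nn_integral_liminf) (use borel_measurable_integrable[OF Tint\<mu>[OF th]] in auto)
    also have "\<dots> \<le> limsup (\<lambda>m. \<integral>\<^sup>+x. ennreal (T (th m) x) \<partial>\<mu>)"
      by (rule Liminf_le_Limsup) simp
    \<comment> \<open>The integral is moved to \<nu>, where the remainder is dominated by x^n, whose
      integral is known to be finite.\<close>
    also have "\<dots> \<le> ennreal (\<integral>x. x ^ n \<partial>\<nu>)"
    proof (rule Limsup_bounded, rule always_eventually, rule allI)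
      fix m
      have "AE x in \<mu>. 0 \<le> T (th m) x"
        using \<mu>0
      proof eventually_elim
        case (elim x)
        have "0 \<le> exp (- th m * x) * x ^ n" using elim by simp
        thus ?case using T(1)[OF th elim, of m] by linarith
      qed
      hence "(\<integral>\<^sup>+x. ennreal (T (th m) x) \<partial>\<mu>) = ennreal (\<integral>x. T (th m) x \<partial>\<mu>)"
        by (intro nn_integral_eq_integral Tint\<mu> th)
      also have "\<dots> \<le> ennreal (\<integral>x. x ^ n \<partial>\<nu>)"
        unfolding Teq[OF th]
        by (intro ennreal_leI integral_mono_AE Tint\<nu> th int\<nu>) (use \<nu>0 T th in \<open>auto elim!: eventually_mono\<close>)
      finally show "(\<integral>\<^sup>+x. ennreal (T (th m) x) \<partial>\<mu>) \<le> ennreal (\<integral>x. x ^ n \<partial>\<nu>)" .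
    qed
    finally show "(\<integral>\<^sup>+x. ennreal (x ^ n) \<partial>\<mu>) < \<infinity>" by (rule order_le_less_trans) simp
  qed simp
  have conv: "(\<lambda>m. \<integral>x. T (th m) x \<partial>\<rho>) \<longlonglongrightarrow> (\<integral>x. x ^ n \<partial>\<rho>)"
    if \<rho>0: "AE x in \<rho>. 0 \<le> x" and i: "integrable \<rho> (\<lambda>x. x ^ n)" and Ti: "\<And>m. integrable \<rho> (T (th m))" for \<rho> :: "real measure"
  proof (rule integral_dominated_convergence[where w = "\<lambda>x. x ^ n"])
    show "AE x in \<rho>. (\<lambda>m. T (th m) x) \<longlonglongrightarrow> x ^ n" using \<rho>0 by eventually_elim (rule T_lim)
    show "AE x in \<rho>. norm (T (th m) x) \<le> x ^ n" for m
      using \<rho>0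
    proof eventually_elim
      case (elim x)
      have "0 \<le> exp (- th m * x) * x ^ n" using elim by simp
      thus ?case using T[OF th elim, of m] by simp
    qed
  qed (use i Ti in \<open>auto dest: borel_measurable_integrable\<close>)
  have "(\<lambda>m. \<integral>x. T (th m) x \<partial>\<nu>) \<longlonglongrightarrow> (\<integral>x. x ^ n \<partial>\<mu>)"
    using conv[OF \<mu>0 int\<mu> Tint\<mu>[OF th]] by (simp add: Teq[OF th])
  from LIMSEQ_unique[OF this conv[OF \<nu>0 int\<nu> Tint\<nu>[OF th]]] int\<mu> show ?case by simp
qed

text \<open>Even orders suffice in the growth condition, since the Taylor polynomials of one parity
  already determine the characteristic function.\<close>

lemma distribution_eq_of_moments_eq:
  fixes \<mu> \<nu> :: "real measure"
  assumes \<mu>: "real_distribution \<mu>" and \<nu>: "real_distribution \<nu>"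
    and int: "\<And>n. integrable \<mu> (\<lambda>x. x ^ n)" "\<And>n. integrable \<nu> (\<lambda>x. x ^ n)"
    and eq: "\<And>n. (\<integral>x. x ^ n \<partial>\<mu>) = (\<integral>x. x ^ n \<partial>\<nu>)"
    and growth: "\<And>t. (\<lambda>n. \<bar>t\<bar> ^ (2 * n) / fact (2 * n) * (\<integral>x. x ^ (2 * n) \<partial>\<nu>)) \<longlonglongrightarrow> 0"
  shows "\<mu> = \<nu>"
proof (rule Levy_uniqueness[OF \<mu> \<nu>], rule ext)
  fix t
  interpret M: real_distribution \<mu> by fact
  interpret N: real_distribution \<nu> by fact
  define b where "b n = \<bar>t\<bar> ^ (2 * n) / fact (2 * n) * (\<integral>x. x ^ (2 * n) \<partial>\<nu>)" for n
  define s where "s n = (\<Sum>k\<le>n. ((\<i> * t) ^ k / fact k) * (\<integral>x. x ^ k \<partial>\<nu>))" for n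
  have abs_even: "\<bar>x\<bar> ^ (2 * n) = x ^ (2 * n)" for x :: real and n by (simp add: power_mult)
  have 1: "cmod (char \<mu> t - s (2 * n)) \<le> 2 * b n" for n
    using M.char_approx1[of "2 * n" t] int unfolding s_def b_def by (simp add: eq abs_even)
  have 2: "cmod (char \<nu> t - s (2 * n)) \<le> 2 * b n" for n
    using N.char_approx1[of "2 * n" t] int unfolding s_def b_def by (simp add: abs_even)
  have "cmod (char \<mu> t - char \<nu> t) \<le> 4 * b n" for n
    using norm_triangle_ineq4[of "char \<mu> t - s (2 * n)" "char \<nu> t - s (2 * n)"] 1[of n] 2[of n] by simp
  moreover have "(\<lambda>n. 4 * b n) \<longlonglongrightarrow> 4 * 0" using growth[of t] unfolding b_def by (intro tendsto_mult_left)
  ultimately have "cmod (char \<mu> t - char \<nu> t) \<le> 4 * 0"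
    using LIMSEQ_le_const[of "\<lambda>n. 4 * b n" "4 * 0" "cmod (char \<mu> t - char \<nu> t)"] by blast
  thus "char \<mu> t = char \<nu> t" by simp
qed

section \<open>Gamma laws and the product of an exponential and a Gamma variable\<close>

definition gamma_measure :: "real \<Rightarrow> real measure" where
  "gamma_measure s = density lborel (\<lambda>t. ennreal (indicator {0<..} t * (t powr (s - 1) * exp (- t)) / Gamma s))"

lemma sets_gamma_measure [simp, measurable_cong]: "sets (gamma_measure s) = sets borel"
  by (simp add: gamma_measure_def)

lemma space_gamma_measure [simp]: "space (gamma_measure s) = UNIV"
  by (simp add: gamma_measure_def)

lemma AE_gamma_measure_pos: "AE t in gamma_measure s. 0 < t"
  unfolding gamma_measure_def by (subst AE_density) (auto simp: indicator_def)

text \<open>Moments (p = 0) and Laplace transforms (q = 0) of the Gamma laws in one formula.\<close>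

lemma nn_integral_gamma_measure:
  assumes s: "0 < s" and q: "0 < s + q" and p: "0 \<le> p"
  shows "(\<integral>\<^sup>+t. ennreal (t powr q * exp (- p * t)) \<partial>gamma_measure s) = ennreal (Gamma (s + q) / Gamma s * (1 + p) powr (- (s + q)))"
proof -
  have G: "0 < Gamma s" "0 < Gamma (s + q)" using s q by auto
  have "(\<integral>\<^sup>+t. ennreal (t powr q * exp (- p * t)) \<partial>gamma_measure s)
    = (\<integral>\<^sup>+t. ennreal (1 / Gamma s) * ennreal (indicator {0<..} t * (t powr (s + q - 1) * exp (- (1 + p) * t))) \<partial>lborel)"
    unfolding gamma_measure_def
  proof (subst nn_integral_density)
    show "(\<integral>\<^sup>+t. ennreal (indicator {0<..} t * (t powr (s - 1) * exp (- t)) / Gamma s) * ennreal (t powr q * exp (- p * t)) \<partial>lborel)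
      = (\<integral>\<^sup>+t. ennreal (1 / Gamma s) * ennreal (indicator {0<..} t * (t powr (s + q - 1) * exp (- (1 + p) * t))) \<partial>lborel)"
    proof (rule nn_integral_cong)
      fix t :: real
      have "t powr (s - 1) * t powr q = t powr (s + q - 1)" by (simp add: powr_add[symmetric] algebra_simps)
      moreover have "exp (- t) * exp (- p * t) = exp (- (1 + p) * t)" by (simp add: exp_add[symmetric] algebra_simps)
      moreover have "indicator {0<..} t * (t powr (s - 1) * exp (- t)) / Gamma s * (t powr q * exp (- p * t))
         = 1 / Gamma s * (indicator {0<..} t * ((t powr (s - 1) * t powr q) * (exp (- t) * exp (- p * t))))"
        by (simp add: mult_ac)
      ultimately have "indicator {0<..} t * (t powr (s - 1) * exp (- t)) / Gamma s * (t powr q * exp (- p * t))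
         = 1 / Gamma s * (indicator {0<..} t * (t powr (s + q - 1) * exp (- (1 + p) * t)))"
        by (simp only:)
      thus "ennreal (indicator {0<..} t * (t powr (s - 1) * exp (- t)) / Gamma s) * ennreal (t powr q * exp (- p * t))
         = ennreal (1 / Gamma s) * ennreal (indicator {0<..} t * (t powr (s + q - 1) * exp (- (1 + p) * t)))"
        using G by (simp add: ennreal_mult[symmetric])
    qed
  qed auto
  also have "\<dots> = ennreal (1 / Gamma s) * ennreal (Gamma (s + q) * (1 + p) powr (- (s + q)))"
    by (subst nn_integral_cmult, simp, subst nn_integral_Gamma[OF q]) (use p in auto)
  also have "\<dots> = ennreal (Gamma (s + q) / Gamma s * (1 + p) powr (- (s + q)))"
    using G by (simp add: ennreal_mult[symmetric])
  finally show ?thesis .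
qed

lemma prob_space_gamma_measure:
  assumes "0 < s"
  shows "prob_space (gamma_measure s)"
proof
  have "(\<integral>\<^sup>+t. 1 \<partial>gamma_measure s) = (\<integral>\<^sup>+t. ennreal (t powr 0 * exp (- 0 * t)) \<partial>gamma_measure s)"
    using AE_gamma_measure_pos[of s] by (intro nn_integral_cong_AE) (auto elim: eventually_mono)
  also have "\<dots> = 1" using assms by (subst nn_integral_gamma_measure) (auto simp: less_imp_neq[OF Gamma_real_pos, THEN not_sym])
  finally show "emeasure (gamma_measure s) (space (gamma_measure s)) = 1" by simp
qed

section \<open>Moments of the area\<close>

lemma integral_gamma_measure:
  fixes f :: "real \<Rightarrow> real"
  assumes [measurable]: "f \<in> borel_measurable borel" and s: "0 < s"
  shows "(\<integral>t. f t \<partial>gamma_measure s) = (\<integral>t. indicator {0<..} t * (t powr (s - 1) * exp (- t)) / Gamma s * f t \<partial>lborel)"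
  unfolding gamma_measure_def using s
  by (subst integral_density) (auto intro!: AE_I2 less_imp_le[OF Gamma_real_pos])

text \<open>The law of 3 / (2 sqrt 2) W G from the overview. The absolute values change the variable
  on a null set only and make it nonnegative everywhere.\<close>

definition product_law :: "real measure" where
  "product_law = distr (gamma_measure 1 \<Otimes>\<^sub>M gamma_measure (2/3)) borel (\<lambda>(w, r). 3 / (2 * sqrt 2) * \<bar>w\<bar> * \<bar>r\<bar>)"

lemma real_distribution_product_law: "real_distribution product_law"
proof -
  interpret W: prob_space "gamma_measure 1" by (rule prob_space_gamma_measure) simp
  interpret R: prob_space "gamma_measure (2/3)" by (rule prob_space_gamma_measure) simp
  interpret P: pair_prob_space "gamma_measure 1" "gamma_measure (2/3)" ..
  show ?thesis unfolding product_law_def by (rule P.real_distribution_distr) measurable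
qed

lemma product_law_nonneg: "AE x in product_law. 0 \<le> x"
  unfolding product_law_def by (subst AE_distr_iff) (auto simp: case_prod_beta)

lemma product_law_moment:
  "has_bochner_integral product_law (\<lambda>x. x ^ n) ((3 / (2 * sqrt 2)) ^ n * fact n * Gamma (real n + 2/3) / Gamma (2/3))"
proof (rule has_bochner_integral_nn_integral)
  interpret W: prob_space "gamma_measure 1" by (rule prob_space_gamma_measure) simp
  interpret R: prob_space "gamma_measure (2/3)" by (rule prob_space_gamma_measure) simp
  interpret P: pair_prob_space "gamma_measure 1" "gamma_measure (2/3)" ..
  let ?c = "3 / (2 * sqrt 2) :: real"
  have m: "(\<integral>\<^sup>+t. ennreal (\<bar>t\<bar> ^ n) \<partial>gamma_measure s) = ennreal (Gamma (s + real n) / Gamma s)" if s: "0 < s" for s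
  proof -
    have "(\<integral>\<^sup>+t. ennreal (\<bar>t\<bar> ^ n) \<partial>gamma_measure s) = (\<integral>\<^sup>+t. ennreal (t powr real n * exp (- 0 * t)) \<partial>gamma_measure s)"
      using AE_gamma_measure_pos[of s] by (intro nn_integral_cong_AE) (auto elim!: eventually_mono simp: powr_realpow)
    thus ?thesis using s by (subst (asm) nn_integral_gamma_measure) auto
  qed
  have "(\<integral>\<^sup>+x. ennreal (x ^ n) \<partial>product_law) = (\<integral>\<^sup>+wr. ennreal ((?c * \<bar>fst wr\<bar> * \<bar>snd wr\<bar>) ^ n) \<partial>(gamma_measure 1 \<Otimes>\<^sub>M gamma_measure (2/3)))"
    unfolding product_law_def by (subst nn_integral_distr) (auto simp: case_prod_beta)
  also have "\<dots> = (\<integral>\<^sup>+w. \<integral>\<^sup>+r. ennreal ((?c * \<bar>w\<bar> * \<bar>r\<bar>) ^ n) \<partial>gamma_measure (2/3) \<partial>gamma_measure 1)"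
    by (subst R.nn_integral_fst[symmetric]) auto
  also have "\<dots> = (\<integral>\<^sup>+w. ennreal (?c ^ n * Gamma (2/3 + real n) / Gamma (2/3)) * ennreal (\<bar>w\<bar> ^ n) \<partial>gamma_measure 1)"
  proof (rule nn_integral_cong)
    fix w :: real
    have "(\<integral>\<^sup>+r. ennreal ((?c * \<bar>w\<bar> * \<bar>r\<bar>) ^ n) \<partial>gamma_measure (2/3)) = (\<integral>\<^sup>+r. ennreal ((?c * \<bar>w\<bar>) ^ n) * ennreal (\<bar>r\<bar> ^ n) \<partial>gamma_measure (2/3))"
      by (intro nn_integral_cong) (simp add: ennreal_mult[symmetric] power_mult_distrib[symmetric])
    also have "\<dots> = ennreal ((?c * \<bar>w\<bar>) ^ n) * ennreal (Gamma (2/3 + real n) / Gamma (2/3))"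
      by (subst nn_integral_cmult) (auto simp: m)
    also have "\<dots> = ennreal (?c ^ n * Gamma (2/3 + real n) / Gamma (2/3)) * ennreal (\<bar>w\<bar> ^ n)"
    proof -
      have "0 \<le> Gamma (2/3 + real n) / Gamma (2/3)" by (intro divide_nonneg_nonneg less_imp_le[OF Gamma_real_pos]) auto
      thus ?thesis unfolding power_mult_distrib[of ?c "\<bar>w\<bar>" n]
        by (subst (1 2) ennreal_mult[symmetric]) (auto simp: mult_ac)
    qed
    finally show "(\<integral>\<^sup>+r. ennreal ((?c * \<bar>w\<bar> * \<bar>r\<bar>) ^ n) \<partial>gamma_measure (2/3)) = ennreal (?c ^ n * Gamma (2/3 + real n) / Gamma (2/3)) * ennreal (\<bar>w\<bar> ^ n)" .
  qed
  also have "\<dots> = ennreal (?c ^ n * Gamma (2/3 + real n) / Gamma (2/3)) * ennreal (fact n)"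
    by (subst nn_integral_cmult) (auto simp: m Gamma_fact[symmetric] add.commute)
  also have "\<dots> = ennreal (?c ^ n * fact n * Gamma (real n + 2/3) / Gamma (2/3))"
    by (subst ennreal_mult'[symmetric]) (auto simp: mult_ac add.commute)
  finally show "(\<integral>\<^sup>+x. ennreal (x ^ n) \<partial>product_law) = ennreal (?c ^ n * fact n * Gamma (real n + 2/3) / Gamma (2/3))" .
  show "AE x in product_law. 0 \<le> x ^ n" using product_law_nonneg by (auto elim: eventually_mono)
  show "0 \<le> ?c ^ n * fact n * Gamma (real n + 2/3) / Gamma (2/3)"
    by (intro divide_nonneg_nonneg mult_nonneg_nonneg less_imp_le[OF Gamma_real_pos]) auto
qed (simp add: product_law_def)

text \<open>Integrating out the exponential factor first gives 1 / (1 + \<beta> r), which against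
  the Gamma(2/3) density is exactly the kernel of \<open>laplace_g\<close>.\<close>

lemma product_law_laplace:
  assumes \<theta>: "0 < \<theta>"
  shows "(\<integral>x. exp (- \<theta> * x) \<partial>product_law) = laplace_g (3 * \<theta> / (2 * sqrt 2)) 0 1"
proof -
  interpret W: prob_space "gamma_measure 1" by (rule prob_space_gamma_measure) simp
  interpret R: prob_space "gamma_measure (2/3)" by (rule prob_space_gamma_measure) simp
  interpret P: pair_prob_space "gamma_measure 1" "gamma_measure (2/3)" ..
  define \<beta> where "\<beta> = 3 * \<theta> / (2 * sqrt 2)"
  have \<beta>: "0 < \<beta>" using \<theta> by (simp add: \<beta>_def)
  have "(\<integral>x. exp (- \<theta> * x) \<partial>product_law) = (\<integral>(w, r). exp (- \<beta> * \<bar>w\<bar> * \<bar>r\<bar>) \<partial>(gamma_measure 1 \<Otimes>\<^sub>M gamma_measure (2/3)))"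
    unfolding product_law_def \<beta>_def by (subst integral_distr) (auto simp: case_prod_unfold mult_ac)
  also have "\<dots> = (\<integral>r. (\<integral>w. exp (- \<beta> * \<bar>w\<bar> * \<bar>r\<bar>) \<partial>gamma_measure 1) \<partial>gamma_measure (2/3))"
  proof (rule P.integral_snd[symmetric])
    show "integrable (gamma_measure 1 \<Otimes>\<^sub>M gamma_measure (2/3)) (\<lambda>(w, r). exp (- \<beta> * \<bar>w\<bar> * \<bar>r\<bar>))"
      using \<beta> by (intro P.integrable_const_bound[where B = 1]) auto
  qed
  also have "\<dots> = (\<integral>r. 1 / (1 + \<beta> * \<bar>r\<bar>) \<partial>gamma_measure (2/3))"
  proof (rule Bochner_Integration.integral_cong)
    fix r :: real
    have "(\<integral>\<^sup>+w. ennreal (exp (- \<beta> * \<bar>w\<bar> * \<bar>r\<bar>)) \<partial>gamma_measure 1) = (\<integral>\<^sup>+w. ennreal (w powr 0 * exp (- (\<beta> * \<bar>r\<bar>) * w)) \<partial>gamma_measure 1)"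
      using AE_gamma_measure_pos[of 1] by (intro nn_integral_cong_AE) (auto elim!: eventually_mono simp: mult_ac)
    also have "\<dots> = ennreal (1 / (1 + \<beta> * \<bar>r\<bar>))"
      using \<beta> by (subst nn_integral_gamma_measure) (auto simp: powr_minus_divide add_nonneg_nonneg)
    finally show "(\<integral>w. exp (- \<beta> * \<bar>w\<bar> * \<bar>r\<bar>) \<partial>gamma_measure 1) = 1 / (1 + \<beta> * \<bar>r\<bar>)"
      using \<beta> by (subst integral_eq_nn_integral) auto
  qed simp
  also have "\<dots> = laplace_g \<beta> 0 1"
    unfolding laplace_g_def
    by (subst integral_gamma_measure) (auto intro!: Bochner_Integration.integral_cong simp: laplace_kernel_def indicator_def mult_ac)
  finally show ?thesis by (simp add: \<beta>_def)
qed

context standard_brownian_motion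
begin

text \<open>Equality of Laplace transforms gives the moments of T^(3/2) A. By independence these are
  the moments of A times Gamma(3n/2 + 1), which is then divided out.\<close>

theorem running_max_area_moment:
  "has_bochner_integral M (\<lambda>\<omega>. running_max_area B \<omega> ^ n)
     ((3 / (2 * sqrt 2)) ^ n * fact n * Gamma (real n + 2/3) / (Gamma (2/3) * Gamma (3/2 * real n + 1)))"
proof -
  interpret T: prob_space "gamma_measure 1" by (rule prob_space_gamma_measure) simp
  interpret P: pair_prob_space M "gamma_measure 1" ..
  \<comment> \<open>Truncation at 0 makes the area nonnegative at every sample point; it changes
    nothing almost surely.\<close>
  define A where "A \<omega> = max 0 (running_max_area B \<omega>)" for \<omega>
  have A0: "0 \<le> A \<omega>" for \<omega> by (simp add: A_def)
  have [measurable]: "A \<in> borel_measurable M" unfolding A_def[abs_def] by measurable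
  have AE_A: "AE \<omega> in M. A \<omega> = running_max_area B \<omega>"
    using AE_running_max_area_nonneg by eventually_elim (simp add: A_def)
  define \<mu> where "\<mu> = distr (M \<Otimes>\<^sub>M gamma_measure 1) borel (\<lambda>(\<omega>, t). t powr (3/2) * A \<omega>)"
  have \<mu>: "real_distribution \<mu>" unfolding \<mu>_def by (rule P.real_distribution_distr) measurable
  have \<mu>0: "AE x in \<mu>. 0 \<le> x" unfolding \<mu>_def using A0 by (subst AE_distr_iff) (auto simp: case_prod_beta)
  have laplace: "(\<integral>x. exp (- \<theta> * x) \<partial>\<mu>) = (\<integral>x. exp (- \<theta> * x) \<partial>product_law)" if \<theta>: "0 < \<theta>" for \<theta>
  proof -
    have "(\<integral>x. exp (- \<theta> * x) \<partial>\<mu>) = (\<integral>(\<omega>, t). exp (- (\<theta> * (t powr (3/2) * A \<omega>))) \<partial>(M \<Otimes>\<^sub>M gamma_measure 1))"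
      unfolding \<mu>_def by (subst integral_distr) (auto simp: case_prod_unfold)
    also have "\<dots> = (\<integral>t. expectation (\<lambda>\<omega>. exp (- (\<theta> * (t powr (3/2) * A \<omega>)))) \<partial>gamma_measure 1)"
    proof (rule P.integral_snd[symmetric])
      show "integrable (M \<Otimes>\<^sub>M gamma_measure 1) (\<lambda>(\<omega>, t). exp (- (\<theta> * (t powr (3/2) * A \<omega>))))"
        using \<theta> A0 by (intro P.integrable_const_bound[where B = 1]) auto
    qed
    also have "\<dots> = (\<integral>t. indicator {0<..} t * (exp (- t) * expectation (\<lambda>\<omega>. exp (- (\<theta> * (t powr (3/2) * A \<omega>))))) \<partial>lborel)"
      by (subst integral_gamma_measure) (auto intro!: Bochner_Integration.integral_cong simp: indicator_def)
    also have "\<dots> = (\<integral>t. indicator {0<..} t * (exp (- t) * expectation (\<lambda>\<omega>. exp (- (\<theta> * (t powr (3/2) * running_max_area B \<omega>))))) \<partial>lborel)"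
    proof (rule Bochner_Integration.integral_cong)
      fix t :: real
      have "expectation (\<lambda>\<omega>. exp (- (\<theta> * (t powr (3/2) * A \<omega>)))) = expectation (\<lambda>\<omega>. exp (- (\<theta> * (t powr (3/2) * running_max_area B \<omega>))))"
        using AE_A by (intro integral_cong_AE) (auto elim!: eventually_mono)
      thus "indicator {0<..} t * (exp (- t) * expectation (\<lambda>\<omega>. exp (- (\<theta> * (t powr (3/2) * A \<omega>))))) = indicator {0<..} t * (exp (- t) * expectation (\<lambda>\<omega>. exp (- (\<theta> * (t powr (3/2) * running_max_area B \<omega>)))))"
        by simp
    qed simp
    finally show ?thesis unfolding running_max_area_laplace[OF \<theta>] product_law_laplace[OF \<theta>] .
  qed
  define m where "m = (3 / (2 * sqrt 2)) ^ n * fact n * Gamma (real n + 2/3) / Gamma (2/3)"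
  define G where "G = Gamma (3/2 * real n + 1)"
  have G: "0 < G" unfolding G_def by (rule Gamma_real_pos) (simp add: add_nonneg_pos)
  have m0: "0 \<le> m" unfolding m_def by (intro divide_nonneg_nonneg mult_nonneg_nonneg less_imp_le[OF Gamma_real_pos]) auto
  have "integrable product_law (\<lambda>x. x ^ k)" for k using product_law_moment[of k] by (simp add: has_bochner_integral_iff)
  from moments_eq_of_laplace_eq[OF \<mu> real_distribution_product_law \<mu>0 product_law_nonneg laplace this, of n]
  have \<mu>n: "integrable \<mu> (\<lambda>x. x ^ n)" "(\<integral>x. x ^ n \<partial>\<mu>) = m"
    using product_law_moment[of n] by (auto simp: has_bochner_integral_iff m_def)
  have "ennreal m = (\<integral>\<^sup>+x. ennreal (x ^ n) \<partial>\<mu>)"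
    using \<mu>n \<mu>0 by (subst nn_integral_eq_integral) (auto elim: eventually_mono)
  also have "\<dots> = (\<integral>\<^sup>+wt. ennreal ((snd wt powr (3/2) * A (fst wt)) ^ n) \<partial>(M \<Otimes>\<^sub>M gamma_measure 1))"
    unfolding \<mu>_def by (subst nn_integral_distr) (auto simp: case_prod_beta)
  also have "\<dots> = (\<integral>\<^sup>+\<omega>. \<integral>\<^sup>+t. ennreal ((t powr (3/2) * A \<omega>) ^ n) \<partial>gamma_measure 1 \<partial>M)"
    by (subst T.nn_integral_fst[symmetric]) auto
  also have "\<dots> = (\<integral>\<^sup>+\<omega>. ennreal G * ennreal (A \<omega> ^ n) \<partial>M)"
  proof (rule nn_integral_cong)
    fix \<omega>
    have "(\<integral>\<^sup>+t. ennreal ((t powr (3/2) * A \<omega>) ^ n) \<partial>gamma_measure 1) = (\<integral>\<^sup>+t. ennreal (A \<omega> ^ n) * ennreal (t powr (3/2 * real n) * exp (- 0 * t)) \<partial>gamma_measure 1)"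
      using AE_gamma_measure_pos[of 1]
    proof (intro nn_integral_cong_AE, eventually_elim)
      case (elim t)
      have "(t powr (3/2)) ^ n = t powr (3/2 * real n)" using elim by (simp add: powr_power mult.commute)
      thus ?case using A0[of \<omega>] by (simp add: ennreal_mult[symmetric] power_mult_distrib mult.commute)
    qed
    also have "\<dots> = ennreal (A \<omega> ^ n) * ennreal G"
      by (subst nn_integral_cmult, simp, subst nn_integral_gamma_measure) (auto simp: G_def add.commute)
    finally show "(\<integral>\<^sup>+t. ennreal ((t powr (3/2) * A \<omega>) ^ n) \<partial>gamma_measure 1) = ennreal G * ennreal (A \<omega> ^ n)"
      by (simp add: mult.commute)
  qed
  also have "\<dots> = ennreal G * (\<integral>\<^sup>+\<omega>. ennreal (A \<omega> ^ n) \<partial>M)" by (rule nn_integral_cmult) measurable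
  also have "(\<integral>\<^sup>+\<omega>. ennreal (A \<omega> ^ n) \<partial>M) = (\<integral>\<^sup>+\<omega>. ennreal (running_max_area B \<omega> ^ n) \<partial>M)"
    using AE_A by (intro nn_integral_cong_AE) (auto elim: eventually_mono)
  finally have "ennreal (1 / G) * ennreal m = (ennreal (1 / G) * ennreal G) * (\<integral>\<^sup>+\<omega>. ennreal (running_max_area B \<omega> ^ n) \<partial>M)"
    by (simp add: mult.assoc)
  also have "ennreal (1 / G) * ennreal G = 1" using G by (simp add: ennreal_mult[symmetric])
  finally have "(\<integral>\<^sup>+\<omega>. ennreal (running_max_area B \<omega> ^ n) \<partial>M) = ennreal (m / G)"
    using G m0 by (simp add: ennreal_mult[symmetric])
  moreover have "AE \<omega> in M. 0 \<le> running_max_area B \<omega> ^ n"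
    using AE_running_max_area_nonneg by eventually_elim simp
  ultimately have "has_bochner_integral M (\<lambda>\<omega>. running_max_area B \<omega> ^ n) (m / G)"
    using m0 G by (intro has_bochner_integral_nn_integral) auto
  thus ?thesis by (simp add: m_def G_def)
qed

end

section \<open>The density\<close>

lemma Gamma_duplication_real:
  fixes x :: real
  assumes "0 < x"
  shows "Gamma x * Gamma (x + 1/2) = 2 powr (1 - 2 * x) * sqrt pi * Gamma (2 * x)"
proof -
  have np: "complex_of_real y \<notin> \<int>\<^sub>\<le>\<^sub>0" if "0 < y" for y
    using that by (auto elim!: nonpos_Ints_cases' simp: complex_eq_iff)
  have "Gamma (complex_of_real x) * Gamma (complex_of_real x + 1/2) =
     exp ((1 - 2 * complex_of_real x) * of_real (ln 2)) * of_real (sqrt pi) * Gamma (2 * complex_of_real x)"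
    using np[of x] np[of "x + 1/2"] assms by (intro Gamma_legendre_duplication) auto
  also have "complex_of_real x + 1/2 = complex_of_real (x + 1/2)" by simp
  also have "exp ((1 - 2 * complex_of_real x) * of_real (ln 2)) = complex_of_real (2 powr (1 - 2 * x))"
    by (simp add: powr_def exp_of_real[symmetric])
  also have "2 * complex_of_real x = complex_of_real (2 * x)" by simp
  finally have "complex_of_real (Gamma x * Gamma (x + 1/2)) = complex_of_real (2 powr (1 - 2 * x) * sqrt pi * Gamma (2 * x))"
    by (simp only: Gamma_complex_of_real of_real_mult[symmetric])
  thus ?thesis by (simp only: of_real_eq_iff)
qed

lemma Gamma_reflection_real: "Gamma x * Gamma (1 - x) = pi / sin (pi * x)" for x :: real
proof -
  have "complex_of_real (Gamma x * Gamma (1 - x)) = complex_of_real (pi / sin (pi * x))"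
    using Gamma_reflection_complex[of "complex_of_real x"]
    by (simp add: Gamma_complex_of_real[symmetric] sin_of_real[symmetric])
  thus ?thesis by (simp only: of_real_eq_iff)
qed

lemma Gamma_sixths:
  "Gamma (1/6) * Gamma (2/3) = 2 powr (2/3) * sqrt pi * Gamma (1/3 :: real)"
  "Gamma (1/3) * Gamma (5/6) = 2 powr (1/3) * sqrt pi * Gamma (2/3 :: real)"
  "Gamma (1/3) * Gamma (2/3) = 2 * pi / sqrt (3 :: real)"
  "Gamma (1/6) * Gamma (5/6) = 2 * (pi :: real)"
proof -
  show "Gamma (1/6) * Gamma (2/3) = 2 powr (2/3) * sqrt pi * Gamma (1/3 :: real)"
    using Gamma_duplication_real[of "1/6"] by simp
  show "Gamma (1/3) * Gamma (5/6) = 2 powr (1/3) * sqrt pi * Gamma (2/3 :: real)"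
    using Gamma_duplication_real[of "1/3"] by simp
  show "Gamma (1/3) * Gamma (2/3) = 2 * pi / sqrt (3 :: real)"
    using Gamma_reflection_real[of "1/3"] by (simp add: sin_60)
  show "Gamma (1/6) * Gamma (5/6) = 2 * (pi :: real)"
    using Gamma_reflection_real[of "1/6"] by (simp add: sin_30)
qed

lemma Gamma_shift:
  "Gamma (7/6 :: real) = Gamma (1/6) / 6" "Gamma (4/3 :: real) = Gamma (1/3) / 3" "Gamma (5/3 :: real) = 2 * Gamma (2/3) / 3"
  "Gamma (5/2 :: real) = 3 / 4 * sqrt pi" "Gamma (- 1/3 :: real) = - 3 * Gamma (2/3)" "Gamma (- 1/6 :: real) = - 6 * Gamma (5/6)"
proof -
  have P: "Gamma (z + 1) = z * Gamma z" if "\<And>n. z \<noteq> - real n" for z :: real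
    using that by (intro Gamma_plus1) (auto elim!: nonpos_Ints_cases')
  show "Gamma (7/6 :: real) = Gamma (1/6) / 6" using P[of "1/6"] by simp
  show "Gamma (4/3 :: real) = Gamma (1/3) / 3" using P[of "1/3"] by simp
  show "Gamma (5/3 :: real) = 2 * Gamma (2/3) / 3" using P[of "2/3"] by simp
  show "Gamma (5/2 :: real) = 3 / 4 * sqrt pi" using P[of "3/2"] P[of "1/2"] by (simp add: Gamma_one_half_real)
  have "- (1/3) \<noteq> - real n" for n
  proof
    assume "- (1/3) = - real n"
    hence "real (3 * n) = real 1" by simp
    hence "3 * n = 1" by (simp only: of_nat_eq_iff)
    thus False by presburger
  qed
  from P[OF this] show "Gamma (- 1/3 :: real) = - 3 * Gamma (2/3)" by simp
  have "- (1/6) \<noteq> - real n" for n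
  proof
    assume "- (1/6) = - real n"
    hence "real (6 * n) = real 1" by simp
    hence "6 * n = 1" by (simp only: of_nat_eq_iff)
    thus False by presburger
  qed
  from P[OF this] show "Gamma (- 1/6 :: real) = - 6 * Gamma (5/6)" by simp
qed

lemma Gamma_thirds_pos: "0 < Gamma (1/6 :: real)" "0 < Gamma (1/3 :: real)" "0 < Gamma (2/3 :: real)" "0 < Gamma (5/6 :: real)"
  by (rule Gamma_real_pos; simp)+

lemma Gamma_thirds_nonzero: "Gamma (1/6 :: real) \<noteq> 0" "Gamma (1/3 :: real) \<noteq> 0" "Gamma (2/3 :: real) \<noteq> 0" "Gamma (5/6 :: real) \<noteq> 0"
  using Gamma_thirds_pos by linarith+

lemma powr_third_identities:
  "2 powr (2/3) * 2 powr (1/3) = (2::real)" "2 powr (1/2) * 2 powr (1/2) = (2::real)" "3 powr (1/2) * 3 powr (1/2) = (3::real)"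
  "2 powr (7/6) = 2 powr (2/3) * (2::real) powr (1/2)" "2 powr (5/6) = 2 powr (1/2) * (2::real) powr (1/3)"
  "2 powr (- 1/6) = 2 powr (1/3) / (2::real) powr (1/2)" "3 powr (5/6) = 3 powr (1/2) * (3::real) powr (1/3)"
  "2 powr (4/3) = 2 * (2::real) powr (1/3)" "3 powr (4/3) = 3 * (3::real) powr (1/3)"
  by (simp_all add: powr_add[symmetric] powr_diff[symmetric] powr_mult_base)

text \<open>Here and in \<open>density_constant_2\<close> the common prefactor of the two series,
  times the leading coefficient of one of them, becomes the coefficient of the corresponding
  1F1.\<close>

lemma density_constant_1:
  "2 powr (2/3) * Gamma (1/3) / (3 powr (1/2) * pi) * (Gamma (5/6) / Gamma (2/3) * (3/2) powr (1/2)) = 2 powr (1/2) / (pi powr (1/2) :: real)"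
proof -
  have "2 powr (2/3) * Gamma (1/3) / (3 powr (1/2) * pi) * (Gamma (5/6) / Gamma (2/3) * (3/2) powr (1/2))
     = 2 powr (2/3) * (Gamma (1/3) * Gamma (5/6)) / (pi * Gamma (2/3) * 2 powr (1/2))"
    by (simp add: powr_divide)
  also have "\<dots> = (2 powr (2/3) * 2 powr (1/3)) * sqrt pi / (pi * 2 powr (1/2))"
    unfolding Gamma_sixths using Gamma_thirds_nonzero by simp
  also have "\<dots> = (2 powr (1/2) * 2 powr (1/2)) * sqrt pi / ((sqrt pi * sqrt pi) * 2 powr (1/2))"
    unfolding powr_third_identities by simp
  also have "\<dots> = 2 powr (1/2) / sqrt pi"
  proof -
    have *: "(h * h) * t / ((t * t) * h) = h / t" if "h \<noteq> 0" "t \<noteq> 0" for h t :: real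
      using that by simp
    show ?thesis by (rule *) simp_all
  qed
  finally show ?thesis by (simp add: powr_half_sqrt)
qed

lemma density_constant_2:
  "2 powr (2/3) * Gamma (1/3) / (3 powr (1/2) * pi) * (Gamma (7/6) / Gamma (4/3) * (3/2) powr (5/6)) = 2 powr (- 1/6) * 3 powr (1/3) / Gamma (5/6 :: real)"
proof -
  have "2 powr (2/3) * Gamma (1/3) / (3 powr (1/2) * pi) * (Gamma (7/6) / Gamma (4/3) * (3/2) powr (5/6))
     = 2 powr (2/3) * Gamma (1/6) * 3 powr (1/3) / (2 * pi * 2 powr (5/6))"
    unfolding Gamma_shift powr_divide[of 3 2, simplified] powr_third_identities(7) using Gamma_thirds_nonzero by simp
  also have "\<dots> = 2 powr (2/3) * Gamma (1/6) * 3 powr (1/3) / (Gamma (1/6) * Gamma (5/6) * 2 powr (5/6))"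
    unfolding Gamma_sixths ..
  also have "\<dots> = 2 powr (2/3) / 2 powr (5/6) * 3 powr (1/3) / Gamma (5/6)"
    using Gamma_thirds_nonzero by simp
  also have "2 powr (2/3) / 2 powr (5/6) = (2 powr (- 1/6) :: real)"
    by (simp add: powr_diff[symmetric])
  finally show ?thesis .
qed

text \<open>This and \<open>density_constant_4\<close> convert the two Gamma quotients in the
  definition of U(-1/6; 2/3; .) into the coefficients of the 1F1 form; the power (3/2)^(1/3) stems
  from the argument (3/2) x^2.\<close>

lemma density_constant_3:
  "2 powr (7/6) / Gamma (2/3) * (Gamma (1/3) / Gamma (1/6)) = 2 powr (1/2) / (pi powr (1/2) :: real)"
proof -
  have "2 powr (7/6) / Gamma (2/3) * (Gamma (1/3) / Gamma (1/6)) = 2 powr (2/3) * 2 powr (1/2) * Gamma (1/3) / (Gamma (1/6) * Gamma (2/3) :: real)"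
    unfolding powr_third_identities by simp
  also have "\<dots> = 2 powr (1/2) / sqrt pi"
    unfolding Gamma_sixths using Gamma_thirds_nonzero by simp
  finally show ?thesis by (simp add: powr_half_sqrt)
qed

lemma density_constant_4:
  "2 powr (7/6) / Gamma (2/3) * (Gamma (- 1/3) / Gamma (- 1/6) * (3/2) powr (1/3)) = 2 powr (- 1/6) * 3 powr (1/3) / Gamma (5/6 :: real)"
proof -
  have "2 powr (7/6) / Gamma (2/3) * (Gamma (- 1/3) / Gamma (- 1/6) * (3/2) powr (1/3))
      = 2 powr (7/6) / (2 * 2 powr (1/3)) * 3 powr (1/3) / (Gamma (5/6) :: real)"
    unfolding Gamma_shift using Gamma_thirds_nonzero by (simp add: powr_divide)
  also have "2 powr (7/6) / (2 * 2 powr (1/3)) = (2 powr (- 1/6) :: real)"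
    by (simp add: powr_mult_base powr_diff[symmetric])
  finally show ?thesis .
qed

text \<open>The parameter change swaps the two summands in the definition, up to the common power of
  \<open>z\<close>.\<close>

lemma tricomi_U_kummer:
  assumes "0 < z"
  shows "tricomi_U a b z = z powr (1 - b) * tricomi_U (a - b + 1) (2 - b) z"
proof -
  have "z powr (1 - b) * z powr (b - 1) = 1" using assms by (simp add: powr_add[symmetric])
  thus ?thesis by (simp add: tricomi_U_def algebra_simps)
qed

text \<open>Pochhammer symbols are quotients of Gamma values. The exponent \<open>s\<close> is left
  free because the two series use 1/2 and 5/6.\<close>

lemma series_hyp1F1:
  fixes a b x :: real
  assumes a: "0 < a" and b: "0 < b"
  shows "(\<lambda>n. (-1) ^ n * (Gamma (real n + a) / (fact n * Gamma (real n + b))) * (3/2) powr (real n + s) * x ^ (2 * n))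
     sums (Gamma a / Gamma b * (3/2) powr s * hyp1F1 a b (- (3/2) * x\<^sup>2))"
proof -
  have "(\<lambda>n. Gamma a / Gamma b * (3/2) powr s * (pochhammer a n / pochhammer b n * ((- (3/2) * x\<^sup>2) ^ n / fact n)))
     sums (Gamma a / Gamma b * (3/2) powr s * hyp1F1 a b (- (3/2) * x\<^sup>2))"
    unfolding hyp1F1_def by (intro sums_mult summable_sums summable_hyp1F1 b)
  moreover have "Gamma a / Gamma b * (3/2) powr s * (pochhammer a n / pochhammer b n * ((- (3/2) * x\<^sup>2) ^ n / fact n))
     = (-1) ^ n * (Gamma (real n + a) / (fact n * Gamma (real n + b))) * (3/2) powr (real n + s) * x ^ (2 * n)" for n
  proof -
    have G: "Gamma a \<noteq> 0" "Gamma b \<noteq> 0" using a b Gamma_real_pos by (metis less_irrefl)+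
    have "a \<notin> \<int>\<^sub>\<le>\<^sub>0" "b \<notin> \<int>\<^sub>\<le>\<^sub>0" using a b by (auto dest: nonpos_Ints_nonpos)
    hence p: "pochhammer a n = Gamma (real n + a) / Gamma a" "pochhammer b n = Gamma (real n + b) / Gamma b"
      by (simp_all add: pochhammer_Gamma add.commute)
    have e: "(- (3/2) * x\<^sup>2) ^ n = (-1) ^ n * (3/2) ^ n * x ^ (2 * n)"
      unfolding power_mult by (simp only: power_mult_distrib[symmetric]) simp
    have r: "(3/2) powr (real n + s) = (3/2) ^ n * (3/2 :: real) powr s"
      by (simp add: powr_add powr_realpow)
    show ?thesis unfolding p e r using G by (simp add: mult_ac)
  qed
  ultimately show ?thesis by simp
qed

section \<open>The candidate density and its moments\<close>

lemma nn_integral_gaussian_moment: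
  fixes s p :: real
  assumes s: "0 < s" and p: "0 < p"
  shows "(\<integral>\<^sup>+x. ennreal (indicator {0<..} x * (x powr (2 * s - 1) * exp (- p * x\<^sup>2))) \<partial>lborel) = ennreal (Gamma s * p powr (- s) / 2)"
proof -
  let ?f = "\<lambda>y. indicator {0<..} y * (y powr (s - 1) * exp (- p * y))"
  let ?h = "\<lambda>x. 2 * (indicator {0<..} x * (x powr (2 * s - 1) * exp (- p * x\<^sup>2)))"
  \<comment> \<open>The substitution y = x^2 is made on compact intervals; monotone convergence then
    reaches the half-line on both sides.\<close>
  have fin: "(\<integral>\<^sup>+y. ennreal (?f y * indicator {0..(real n)\<^sup>2} y) \<partial>lborel) = (\<integral>\<^sup>+x. ennreal (?h x * indicator {0..real n} x) \<partial>lborel)" for n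
  proof -
    have "(\<integral>\<^sup>+y. ennreal (?f y * indicator {0\<^sup>2..(real n)\<^sup>2} y) \<partial>lborel) = (\<integral>\<^sup>+x. ennreal (?f (x\<^sup>2) * (2 * x) * indicator {0..real n} x) \<partial>lborel)"
      by (rule nn_integral_substitution) (auto intro!: derivative_eq_intros continuous_intros simp: set_borel_measurable_def)
    also have "\<dots> = (\<integral>\<^sup>+x. ennreal (?h x * indicator {0..real n} x) \<partial>lborel)"
    proof (rule nn_integral_cong)
      fix x :: real
      have "?f (x\<^sup>2) * (2 * x) = ?h x" if "0 < x"
      proof -
        have "(x\<^sup>2) powr (s - 1) * x = x powr (2 * s - 1)"
        proof -
          have "(x\<^sup>2) powr (s - 1) = x powr (2 * (s - 1))"
            unfolding powr_powr[symmetric] using that by simp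
          thus ?thesis using that powr_mult_base[of x "2 * (s - 1)"] by (simp add: mult.commute)
        qed
        thus ?thesis using that by (simp add: mult_ac)
      qed
      thus "ennreal (?f (x\<^sup>2) * (2 * x) * indicator {0..real n} x) = ennreal (?h x * indicator {0..real n} x)"
        by (cases "0 < x") (auto simp: indicator_def)
    qed
    finally show ?thesis by simp
  qed
  have sup: "(SUP n. \<integral>\<^sup>+x. ennreal (g x * indicator {0..w n} x) \<partial>lborel) = (\<integral>\<^sup>+x. ennreal (g x) \<partial>lborel)"
    if g: "g \<in> borel_measurable borel" "\<And>x. x \<le> 0 \<Longrightarrow> g x = 0" "\<And>x. 0 \<le> g x"
      and w: "incseq w" "filterlim w at_top sequentially" for g :: "real \<Rightarrow> real" and w :: "nat \<Rightarrow> real"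
  proof -
    have "(SUP n. \<integral>\<^sup>+x. ennreal (g x * indicator {0..w n} x) \<partial>lborel) = (\<integral>\<^sup>+x. (SUP n. ennreal (g x * indicator {0..w n} x)) \<partial>lborel)"
    proof (rule nn_integral_monotone_convergence_SUP[symmetric])
      show "incseq (\<lambda>n x. ennreal (g x * indicator {0..w n} x))"
        using w(1) g(3) by (auto simp: incseq_def le_fun_def indicator_def intro!: ennreal_leI intro: order_trans)
    qed (use g(1) in auto)
    moreover have "(SUP n. ennreal (g x * indicator {0..w n} x)) = ennreal (g x)" for x
    proof (rule antisym)
      show "(SUP n. ennreal (g x * indicator {0..w n} x)) \<le> ennreal (g x)"
        using g(3) by (intro SUP_least ennreal_leI) (auto simp: indicator_def)
      have "\<forall>\<^sub>F n in sequentially. x \<le> w n" using w(2) by (simp add: filterlim_at_top)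
      then obtain n where "x \<le> w n" by (auto simp: eventually_sequentially)
      hence "g x * indicator {0..w n} x = g x" using g(2)[of x] by (cases "0 \<le> x") (auto simp: indicator_def)
      thus "ennreal (g x) \<le> (SUP n. ennreal (g x * indicator {0..w n} x))" by (intro SUP_upper2[of n]) auto
    qed
    ultimately show ?thesis by simp
  qed
  have "(\<integral>\<^sup>+y. ennreal (?f y) \<partial>lborel) = (SUP n. \<integral>\<^sup>+y. ennreal (?f y * indicator {0..(real n)\<^sup>2} y) \<partial>lborel)"
  proof (rule sup[symmetric])
    show "incseq (\<lambda>n. (real n)\<^sup>2)" by (auto simp: incseq_def intro!: power_mono)
    show "filterlim (\<lambda>n. (real n)\<^sup>2) at_top sequentially" by real_asymp
  qed auto
  also have "\<dots> = (SUP n. \<integral>\<^sup>+x. ennreal (?h x * indicator {0..real n} x) \<partial>lborel)" by (simp only: fin)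
  also have "\<dots> = (\<integral>\<^sup>+x. ennreal (?h x) \<partial>lborel)"
  proof (rule sup)
    show "incseq real" by (auto simp: incseq_def)
    show "filterlim real at_top sequentially" by (rule filterlim_real_sequentially)
  qed auto
  also have "\<dots> = ennreal 2 * (\<integral>\<^sup>+x. ennreal (indicator {0<..} x * (x powr (2 * s - 1) * exp (- p * x\<^sup>2))) \<partial>lborel)"
    by (subst ennreal_mult, simp, simp) (rule nn_integral_cmult, simp)
  finally have "ennreal (1/2) * ennreal (Gamma s * p powr (- s)) = (ennreal (1/2) * ennreal 2) * (\<integral>\<^sup>+x. ennreal (indicator {0<..} x * (x powr (2 * s - 1) * exp (- p * x\<^sup>2))) \<partial>lborel)"
    unfolding nn_integral_Gamma[OF s p] by (simp only: mult.assoc)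
  also have "ennreal (1/2) * ennreal 2 = 1" by (subst ennreal_mult[symmetric]) auto
  also have "ennreal (1/2) * ennreal (Gamma s * p powr (- s)) = ennreal (Gamma s * p powr (- s) / 2)"
    using Gamma_real_pos[OF s] by (subst ennreal_mult[symmetric]) auto
  finally show ?thesis by simp
qed

text \<open>Among the equivalent forms, the one with U(1/6; 4/3; .) satisfies 0 < a and a + 1 < b <
  2, the range of the integral representation.\<close>

definition area_density :: "real \<Rightarrow> real" where
  "area_density x = (if x \<le> 0 then 0 else
     2 powr (5/6) * 3 powr (1/3) / Gamma (2/3) * x powr (2/3) * exp (- (3/2) * x\<^sup>2) * tricomi_U (1/6) (4/3) (3/2 * x\<^sup>2))"

definition area_density_constant :: real where
  "area_density_constant = 2 powr (5/6) * 3 powr (1/3) / (Gamma (2/3) * Gamma (1/6))"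

lemma area_density_constant_pos: "0 < area_density_constant"
  using Gamma_thirds_pos by (simp add: area_density_constant_def)

text \<open>The integrand is nonnegative and jointly measurable, and the density inherits
  nonnegativity and measurability, neither of which is visible from the difference of hypergeometric
  terms in U.\<close>

lemma area_density_integral:
  "area_density x = (\<integral>u. area_density_constant * (indicator {0<..} x * (x powr (2/3) * exp (- (3/2) * x\<^sup>2 * (1 + u)) * tricomi_kernel (1/6) (1/6) u)) \<partial>lborel)"
proof (cases "x \<le> 0")
  case False
  hence y: "0 < 3/2 * x\<^sup>2" by simp
  have "(\<integral>u. exp (- (3/2 * x\<^sup>2) * u) * tricomi_kernel (1/6) (1/6) u \<partial>lborel) = Gamma (1/6) * tricomi_U (1/6) (4/3) (3/2 * x\<^sup>2)"
    using tricomi_U_integral[of "1/6" "4/3", OF _ _ _ y] by simp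
  hence "tricomi_U (1/6) (4/3) (3/2 * x\<^sup>2) = (\<integral>u. exp (- (3/2 * x\<^sup>2) * u) * tricomi_kernel (1/6) (1/6) u \<partial>lborel) / Gamma (1/6)"
    using Gamma_thirds_nonzero by simp
  hence "area_density x = area_density_constant * x powr (2/3) * exp (- (3/2) * x\<^sup>2) * (\<integral>u. exp (- (3/2 * x\<^sup>2) * u) * tricomi_kernel (1/6) (1/6) u \<partial>lborel)"
    using False by (simp add: area_density_def area_density_constant_def)
  also have "\<dots> = (\<integral>u. area_density_constant * x powr (2/3) * exp (- (3/2) * x\<^sup>2) * (exp (- (3/2 * x\<^sup>2) * u) * tricomi_kernel (1/6) (1/6) u) \<partial>lborel)"
    by simp
  also have "\<dots> = (\<integral>u. area_density_constant * (indicator {0<..} x * (x powr (2/3) * exp (- (3/2) * x\<^sup>2 * (1 + u)) * tricomi_kernel (1/6) (1/6) u)) \<partial>lborel)"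
  proof (rule Bochner_Integration.integral_cong)
    fix u :: real
    have "exp (- (3/2) * x\<^sup>2 * (1 + u)) = exp (- (3/2) * x\<^sup>2) * exp (- (3/2 * x\<^sup>2) * u)"
      by (simp add: exp_add[symmetric] algebra_simps)
    thus "area_density_constant * x powr (2/3) * exp (- (3/2) * x\<^sup>2) * (exp (- (3/2 * x\<^sup>2) * u) * tricomi_kernel (1/6) (1/6) u)
      = area_density_constant * (indicator {0<..} x * (x powr (2/3) * exp (- (3/2) * x\<^sup>2 * (1 + u)) * tricomi_kernel (1/6) (1/6) u))"
      using False by simp
  qed simp
  finally show ?thesis .
qed (simp add: area_density_def)

lemma area_density_eq_0: "x \<le> 0 \<Longrightarrow> area_density x = 0"
  by (simp add: area_density_def)

lemma tricomi_kernel_nonneg: "0 \<le> tricomi_kernel a c u"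
  by (simp add: tricomi_kernel_def)

lemma area_density_nonneg: "0 \<le> area_density x"
  unfolding area_density_integral using area_density_constant_pos tricomi_kernel_nonneg
  by (intro integral_nonneg_AE AE_I2 mult_nonneg_nonneg) auto

lemma area_density_measurable [measurable]: "area_density \<in> borel_measurable borel"
  unfolding area_density_integral[abs_def] by measurable

lemma area_density_eq_nn_integral:
  "ennreal (area_density x) = (\<integral>\<^sup>+u. ennreal (area_density_constant * (indicator {0<..} x * (x powr (2/3) * exp (- (3/2) * x\<^sup>2 * (1 + u)) * tricomi_kernel (1/6) (1/6) u))) \<partial>lborel)"
  unfolding area_density_integral
proof (rule nn_integral_eq_integral[symmetric])
  show "AE u in lborel. 0 \<le> area_density_constant * (indicator {0<..} x * (x powr (2/3) * exp (- (3/2) * x\<^sup>2 * (1 + u)) * tricomi_kernel (1/6) (1/6) u))"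
    using area_density_constant_pos tricomi_kernel_nonneg by (intro AE_I2 mult_nonneg_nonneg) auto
  show "integrable lborel (\<lambda>u. area_density_constant * (indicator {0<..} x * (x powr (2/3) * exp (- (3/2) * x\<^sup>2 * (1 + u)) * tricomi_kernel (1/6) (1/6) u)))"
  proof (cases "x \<le> 0")
    case False
    have "integrable lborel (\<lambda>u. (area_density_constant * x powr (2/3) * exp (- (3/2) * x\<^sup>2)) * (exp (- (3/2 * x\<^sup>2) * u) * tricomi_kernel (1/6) (1/6) u))"
      using False by (intro integrable_mult_right integrable_tricomi_kernel) auto
    moreover have "(area_density_constant * x powr (2/3) * exp (- (3/2) * x\<^sup>2)) * (exp (- (3/2 * x\<^sup>2) * u) * tricomi_kernel (1/6) (1/6) u)
      = area_density_constant * (indicator {0<..} x * (x powr (2/3) * exp (- (3/2) * x\<^sup>2 * (1 + u)) * tricomi_kernel (1/6) (1/6) u))" for u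
    proof -
      have "exp (- (3/2) * x\<^sup>2 * (1 + u)) = exp (- (3/2) * x\<^sup>2) * exp (- (3/2 * x\<^sup>2) * u)"
        by (simp add: exp_add[symmetric] algebra_simps)
      thus ?thesis using False by simp
    qed
    ultimately show ?thesis by (simp only:)
  qed simp
qed

text \<open>After exchanging the integrals, the one in x is a Gaussian moment with rate (3/2)(1 +
  u), and its power of 1 + u combines with the kernel to a Beta integrand.\<close>

lemma area_density_moment_beta:
  "(\<integral>\<^sup>+x. ennreal (x ^ n) * ennreal (area_density x) \<partial>lborel) =
    ennreal (area_density_constant * (Gamma (real n / 2 + 5/6) * (3/2) powr (- (real n / 2 + 5/6)) / 2) * (Gamma (1/6) * Gamma (real n / 2 + 1/2) / Gamma (real n / 2 + 2/3)))"
proof -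
  let ?c = area_density_constant
  \<comment> \<open>Chosen so that 2 s - 1 = n + 2/3, the total power of x.\<close>
  define s where "s = real n / 2 + 5/6"
  let ?E = "\<lambda>x u. (?c * (indicator {0<..} x * (x powr (2 * s - 1) * exp (- (3/2 * (1 + u)) * x\<^sup>2)) * tricomi_kernel (1/6) (1/6) u))"
  let ?D = "\<lambda>x u. (?c * (indicator {0<..} x * (x powr (2/3) * exp (- (3/2) * x\<^sup>2 * (1 + u)) * tricomi_kernel (1/6) (1/6) u)))"
  let ?V = "\<lambda>u. (indicator {0<..} u * (u powr (1/6 - 1) * (1 + u) powr (- (real n / 2 + 2/3))))"
  have s: "0 < s" by (simp add: s_def)
  have c: "0 < ?c" by (rule area_density_constant_pos)
  define K where "K = Gamma s * (3/2) powr (- s) / 2"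
  have K: "0 < K" using s by (simp add: K_def)
  have "(\<integral>\<^sup>+x. ennreal (x ^ n) * ennreal (area_density x) \<partial>lborel) = (\<integral>\<^sup>+x. (\<integral>\<^sup>+u. ennreal (?E x u) \<partial>lborel) \<partial>lborel)"
  proof (rule nn_integral_cong)
    fix x :: real
    have "ennreal (x ^ n) * ennreal (area_density x) = (\<integral>\<^sup>+u. ennreal (x ^ n) * ennreal (?D x u) \<partial>lborel)"
      unfolding area_density_eq_nn_integral by (rule nn_integral_cmult[symmetric]) measurable
    also have "\<dots> = (\<integral>\<^sup>+u. ennreal (?E x u) \<partial>lborel)"
    proof (rule nn_integral_cong)
      fix u :: real
      show "ennreal (x ^ n) * ennreal (?D x u) = ennreal (?E x u)"
      proof (cases "0 < x")
        case True
        have e1: "x powr (2 * s - 1) = x ^ n * x powr (2/3)"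
          using True by (simp add: powr_realpow[symmetric] powr_add[symmetric] s_def add.commute)
        have e2: "- (3/2 * (1 + u)) * x\<^sup>2 = - (3/2) * x\<^sup>2 * (1 + u)" by simp
        have *: "x ^ n * (?D x u) = ?c * (indicator {0<..} x * (x powr (2 * s - 1) * exp (- (3/2 * (1 + u)) * x\<^sup>2)) * tricomi_kernel (1/6) (1/6) u)"
          unfolding e1 e2 by (simp only: mult_ac)
        show ?thesis unfolding *[symmetric] by (rule ennreal_mult'[symmetric]) (use True in simp)
      qed simp
    qed
    finally show "ennreal (x ^ n) * ennreal (area_density x) = (\<integral>\<^sup>+u. ennreal (?E x u) \<partial>lborel)" .
  qed
  also have "\<dots> = (\<integral>\<^sup>+u. (\<integral>\<^sup>+x. ennreal (?E x u) \<partial>lborel) \<partial>lborel)"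
    by (rule lborel_pair.Fubini') measurable
  also have "\<dots> = (\<integral>\<^sup>+u. ennreal (?c * K) * ennreal (?V u) \<partial>lborel)"
  proof (rule nn_integral_cong)
    fix u :: real
    show "(\<integral>\<^sup>+x. ennreal (?E x u) \<partial>lborel)
      = ennreal (?c * K) * ennreal (?V u)"
    proof (cases "0 < u")
      case True
      have "(\<integral>\<^sup>+x. ennreal (?E x u) \<partial>lborel)
        = (\<integral>\<^sup>+x. ennreal (?c * tricomi_kernel (1/6) (1/6) u) * ennreal (indicator {0<..} x * (x powr (2 * s - 1) * exp (- (3/2 * (1 + u)) * x\<^sup>2))) \<partial>lborel)"
        using c tricomi_kernel_nonneg by (intro nn_integral_cong, subst ennreal_mult[symmetric]) (auto simp: mult_ac)
      also have "\<dots> = ennreal (?c * tricomi_kernel (1/6) (1/6) u) * ennreal (Gamma s * (3/2 * (1 + u)) powr (- s) / 2)"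
        using True by (subst nn_integral_cmult, simp, subst nn_integral_gaussian_moment[OF s]) auto
      also have "Gamma s * (3/2 * (1 + u)) powr (- s) / 2 = K * (1 + u) powr (- s)"
        unfolding K_def powr_mult[of "3/2" "1 + u"] by simp
      also have "ennreal (?c * tricomi_kernel (1/6) (1/6) u) * ennreal (K * (1 + u) powr (- s)) = ennreal (?c * K) * ennreal (?V u)"
      proof -
        have e: "(1 + u) powr (- (real n / 2 + 2/3)) = (1 + u) powr (1/6) * (1 + u) powr (- s)"
          by (simp add: powr_add[symmetric] s_def algebra_simps)
        have "?c * tricomi_kernel (1/6) (1/6) u * (K * (1 + u) powr (- s)) = ?c * K * (?V u)"
          unfolding tricomi_kernel_def e by (simp only: mult_ac)
        thus ?thesis using c K tricomi_kernel_nonneg by (subst (1 2) ennreal_mult[symmetric]) auto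
      qed
      finally show ?thesis .
    qed (simp add: tricomi_kernel_def)
  qed
  also have "\<dots> = ennreal (?c * K) * ennreal (Gamma (1/6) * Gamma (real n / 2 + 2/3 - 1/6) / Gamma (real n / 2 + 2/3))"
    by (subst nn_integral_cmult, simp, subst nn_integral_Beta) auto
  also have "real n / 2 + 2/3 - 1/6 = real n / 2 + 1/2" by simp
  also have "ennreal (?c * K) * ennreal (Gamma (1/6) * Gamma (real n / 2 + 1/2) / Gamma (real n / 2 + 2/3))
     = ennreal (?c * K * (Gamma (1/6) * Gamma (real n / 2 + 1/2) / Gamma (real n / 2 + 2/3)))"
    using c K by (subst ennreal_mult'[symmetric]) auto
  finally show ?thesis by (simp add: K_def s_def)
qed

definition area_moment :: "nat \<Rightarrow> real" where
  "area_moment n = (3 / (2 * sqrt 2)) ^ n * fact n * Gamma (real n + 2/3) / (Gamma (2/3) * Gamma (3/2 * real n + 1))"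

text \<open>Both sides satisfy the same recursion from \<open>n\<close> to \<open>n + 2\<close>, which avoids the multiplication
  formula for \<open>Gamma (3 z)\<close>.\<close>

lemma area_moment_beta:
  "area_density_constant * (Gamma (real n / 2 + 5/6) * (3/2) powr (- (real n / 2 + 5/6)) / 2) * (Gamma (1/6) * Gamma (real n / 2 + 1/2) / Gamma (real n / 2 + 2/3)) = area_moment n"
proof -
  define M where "M n = area_density_constant * (Gamma (real n / 2 + 5/6) * (3/2) powr (- (real n / 2 + 5/6)) / 2) * (Gamma (1/6) * Gamma (real n / 2 + 1/2) / Gamma (real n / 2 + 2/3))" for n :: nat
  have P: "Gamma (z + 1) = z * Gamma z" if "0 < z" for z :: real
    using that by (intro Gamma_plus1) (auto dest: nonpos_Ints_nonpos)
  \<comment> \<open>At n = 0 both sides are 1; this fixes the normalisation of the density.\<close>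
  have M0: "M 0 = area_moment 0"
  proof -
    have "M 0 = 2 powr (5/6) * 3 powr (1/3) * (Gamma (5/6) * (2 powr (5/6) / 3 powr (5/6)) / 2) * sqrt pi / (Gamma (2/3) * Gamma (2/3))"
      unfolding M_def area_density_constant_def
      using Gamma_thirds_nonzero by (simp add: Gamma_one_half_real powr_minus_divide powr_divide mult_ac)
    also have "\<dots> = 2 powr (5/6) * 2 powr (5/6) * Gamma (5/6) * sqrt pi / (2 * 3 powr (1/2) * Gamma (2/3) * Gamma (2/3))"
      unfolding powr_third_identities(7) by (simp add: mult_ac)
    also have "2 powr (5/6) * 2 powr (5/6) = (2 * 2 powr (2/3) :: real)"
      by (simp add: powr_add[symmetric] powr_mult_base)
    also have "Gamma (5/6) = 2 powr (1/3) * sqrt pi * Gamma (2/3) / Gamma (1/3 :: real)"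
      using Gamma_sixths(2) Gamma_thirds_nonzero by (simp add: field_simps)
    also have "2 * 2 powr (2/3) * (2 powr (1/3) * sqrt pi * Gamma (2/3) / Gamma (1/3)) * sqrt pi / (2 * 3 powr (1/2) * Gamma (2/3) * Gamma (2/3))
       = (2 powr (2/3) * 2 powr (1/3)) * (sqrt pi * sqrt pi) / (3 powr (1/2) * (Gamma (1/3) * Gamma (2/3 :: real)))"
      using Gamma_thirds_nonzero by (simp add: mult_ac del: real_sqrt_mult_self)
    also have "\<dots> = 1"
      unfolding powr_third_identities Gamma_sixths by (simp add: powr_half_sqrt)
    finally show ?thesis using Gamma_thirds_nonzero by (simp add: area_moment_def)
  qed
  \<comment> \<open>The recursion advances by two, so a second base value is required; both sides
    are 2 sqrt(2) / (3 sqrt(pi)).\<close>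
  have M1: "M 1 = area_moment 1"
  proof -
    have "M 1 = 2 powr (5/6) * 3 powr (1/3) * (Gamma (4/3) * (2 powr (4/3) / 3 powr (4/3)) / 2) / (Gamma (2/3) * Gamma (7/6))"
      unfolding M_def area_density_constant_def
      using Gamma_thirds_nonzero by (simp add: powr_minus_divide powr_divide mult_ac)
    also have "\<dots> = 2 * 2 powr (5/6) * 2 powr (1/3) * Gamma (1/3) / (3 * (Gamma (1/6) * Gamma (2/3)))"
      unfolding powr_third_identities(8,9) Gamma_shift by (simp add: mult_ac)
    also have "\<dots> = 2 * 2 powr (5/6) * 2 powr (1/3) / 2 powr (2/3) / (3 * sqrt pi)"
      unfolding Gamma_sixths using Gamma_thirds_nonzero by simp
    also have "2 * 2 powr (5/6) * 2 powr (1/3) / 2 powr (2/3) = (2 * sqrt 2 :: real)"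
    proof -
      have "2 * 2 powr (5/6) * 2 powr (1/3) / 2 powr (2/3) = 2 * (2 :: real) powr (5/6 + 1/3 - 2/3)"
        by (simp only: powr_add powr_diff)
      thus ?thesis by (simp add: powr_half_sqrt)
    qed
    finally have L: "M 1 = 2 * sqrt 2 / (3 * sqrt pi)" .
    have "area_moment 1 = 3 / (2 * sqrt 2) * Gamma (5/3) / (Gamma (2/3) * Gamma (5/2))"
      by (simp add: area_moment_def)
    also have "\<dots> = 3 / (2 * sqrt 2) * (8 / (9 * sqrt pi))"
      unfolding Gamma_shift using Gamma_thirds_nonzero by simp
    also have "\<dots> = 2 * sqrt 2 / (3 * sqrt pi)" by (simp add: field_simps)
    finally show ?thesis using L by simp
  qed
  have step: "M (Suc (Suc n)) = ((real n + 1) * (real n + 5/3) / (3 * (real n + 4/3))) * M n" for n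
  proof -
    have g: "Gamma (real (Suc (Suc n)) / 2 + c) = (real n / 2 + c) * Gamma (real n / 2 + c)" if "0 < c" for c
      using P[of "real n / 2 + c"] that by (simp add: add_nonneg_pos add_ac add_divide_distrib)
    have p: "(3/2 :: real) powr (- (real (Suc (Suc n)) / 2 + 5/6)) = 2/3 * (3/2) powr (- (real n / 2 + 5/6))"
    proof -
      have "- (real (Suc (Suc n)) / 2 + 5/6) = -1 + (- (real n / 2 + 5/6))" by (simp add: add_divide_distrib)
      thus ?thesis by (simp only: powr_add) (simp add: powr_minus_divide)
    qed
    have "M (Suc (Suc n)) = ((real n / 2 + 5/6) * (2/3) * (real n / 2 + 1/2) / (real n / 2 + 2/3)) * M n"
    proof -
      have pos: "0 < (5/6 :: real)" "0 < (1/2 :: real)" "0 < (2/3 :: real)" by simp_all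
      have *: "A * ((r1 * G1) * (2/3 * q) / 2) * (G * (r2 * G2) / (r3 * G3)) = (r1 * (2/3) * r2 / r3) * (A * (G1 * q / 2) * (G * G2 / G3))"
        for A G G1 G2 G3 r1 r2 r3 q :: real by (simp add: mult_ac)
      show ?thesis unfolding M_def p g[OF pos(1)] g[OF pos(2)] g[OF pos(3)] by (rule *)
    qed
    also have "(real n / 2 + 5/6) * (2/3) * (real n / 2 + 1/2) / (real n / 2 + 2/3) = (real n + 1) * (real n + 5/3) / (3 * (real n + 4/3))"
      by (simp add: divide_simps add_nonneg_pos) (simp add: algebra_simps)
    finally show ?thesis .
  qed
  have step': "area_moment (Suc (Suc n)) = ((real n + 1) * (real n + 5/3) / (3 * (real n + 4/3))) * area_moment n" for n
  proof -
    have g1: "Gamma (real (Suc (Suc n)) + 2/3) = (real n + 5/3) * (real n + 2/3) * Gamma (real n + 2/3)"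
      using P[of "real n + 2/3"] P[of "real n + 5/3"] by (simp add: add_ac add_nonneg_pos)
    have g2: "Gamma (3/2 * real (Suc (Suc n)) + 1) = (3/2 * real n + 3) * (3/2 * real n + 2) * (3/2 * real n + 1) * Gamma (3/2 * real n + 1)"
    proof -
      have "3/2 * real (Suc (Suc n)) + 1 = 3/2 * real n + 3 + 1" by simp
      thus ?thesis
        using P[of "3/2 * real n + 1"] P[of "3/2 * real n + 2"] P[of "3/2 * real n + 3"]
        by (simp only:) (simp add: add_ac add_nonneg_pos)
    qed
    have c: "(3 / (2 * sqrt 2)) ^ Suc (Suc n) = 9/8 * (3 / (2 * sqrt 2)) ^ n" by simp
    have f: "fact (Suc (Suc n)) = (real n + 2) * (real n + 1) * fact n" by (simp add: algebra_simps)
    have "area_moment (Suc (Suc n)) = (9/8 * ((real n + 2) * (real n + 1)) * ((real n + 5/3) * (real n + 2/3)) / ((3/2 * real n + 3) * (3/2 * real n + 2) * (3/2 * real n + 1))) * area_moment n"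
    proof -
      have *: "(9/8 * v) * (R1 * w) * (R2 * G) / (G0 * (R3 * H)) = (9/8 * R1 * R2 / R3) * (v * w * G / (G0 * H))"
        for v w G G0 H R1 R2 R3 :: real by (simp add: mult_ac)
      show ?thesis unfolding area_moment_def g1 g2 c f by (rule *)
    qed
    also have "9/8 * ((real n + 2) * (real n + 1)) * ((real n + 5/3) * (real n + 2/3)) / ((3/2 * real n + 3) * (3/2 * real n + 2) * (3/2 * real n + 1)) = (real n + 1) * (real n + 5/3) / (3 * (real n + 4/3))"
    proof -
      have e: "3/2 * real n + 3 = 3/2 * (real n + 2)" "3/2 * real n + 2 = 3/2 * (real n + 4/3)" "3/2 * real n + 1 = 3/2 * (real n + 2/3)" by simp_all
      have *: "9/8 * (a * b) * (c * d) / ((3/2 * a) * (3/2 * k) * (3/2 * d)) = b * c / (3 * k)"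
        if "a \<noteq> 0" "k \<noteq> 0" "d \<noteq> 0" for a b c d k :: real using that by simp
      show ?thesis unfolding e by (rule *) (simp_all add: add_nonneg_eq_0_iff)
    qed
    finally show ?thesis .
  qed
  have "M n = area_moment n \<and> M (Suc n) = area_moment (Suc n)"
    by (induction n) (use M0 M1 step step' in auto)
  thus ?thesis by (simp add: M_def)
qed

text \<open>At even order 2n the Gamma value in the denominator is (3n)!, a multiple of (2n)! n!. It
  outweighs the factor Gamma(2n + 2/3) / Gamma(2/3), which is at most (2n)!, and leaves 1 /
  n!.\<close>

lemma area_moment_growth:
  "(\<lambda>n. \<bar>t\<bar> ^ (2 * n) / fact (2 * n) * area_moment (2 * n)) \<longlonglongrightarrow> 0"
proof (rule Lim_null_comparison)
  define c where "c = (\<bar>t\<bar> * (3 / (2 * sqrt 2)))\<^sup>2"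
  show "\<forall>\<^sub>F n in sequentially. norm (\<bar>t\<bar> ^ (2 * n) / fact (2 * n) * area_moment (2 * n)) \<le> c ^ n / fact n"
  proof (rule always_eventually, rule allI)
    fix n
    have G: "Gamma (real (2 * n) + 2/3) / Gamma (2/3) = pochhammer (2/3) (2 * n)"
      by (subst pochhammer_Gamma) (auto dest: nonpos_Ints_nonpos simp: add.commute)
    have p: "0 \<le> pochhammer (2/3 :: real) (2 * n)" "pochhammer (2/3 :: real) (2 * n) \<le> fact (2 * n)"
    proof -
      show "0 \<le> pochhammer (2/3 :: real) (2 * n)" by (intro less_imp_le pochhammer_pos) simp
      have "pochhammer (2/3 :: real) m \<le> fact m" for m
      proof (induction m)
        case (Suc m)
        have "pochhammer (2/3 :: real) (Suc m) = pochhammer (2/3) m * (2/3 + real m)" by (simp add: pochhammer_Suc)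
        also have "\<dots> \<le> fact m * (1 + real m)" by (intro mult_mono Suc) auto
        finally show ?case by (simp add: mult.commute)
      qed simp
      thus "pochhammer (2/3 :: real) (2 * n) \<le> fact (2 * n)" .
    qed
    have "Gamma (3/2 * real (2 * n) + 1) = fact (3 * n)" using Gamma_fact[of "3 * n", where 'a = real] by (simp add: add.commute)
    hence eq: "\<bar>t\<bar> ^ (2 * n) / fact (2 * n) * area_moment (2 * n) = c ^ n * (pochhammer (2/3) (2 * n) / fact (3 * n))"
      unfolding area_moment_def G[symmetric] c_def power_mult[symmetric] power_mult_distrib by simp
    have "fact (2 * n) * fact n dvd (fact (2 * n + n) :: nat)" by (rule fact_fact_dvd_fact)
    hence "fact (2 * n) * fact n \<le> (fact (3 * n) :: nat)" by (intro dvd_imp_le) auto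
    hence f: "fact (2 * n) * fact n \<le> (fact (3 * n) :: real)"
    proof -
      have "real (fact (2 * n) * fact n) \<le> real (fact (3 * n))"
        using \<open>fact (2 * n) * fact n \<le> (fact (3 * n) :: nat)\<close> by (simp only: of_nat_le_iff)
      thus ?thesis by simp
    qed
    have "pochhammer (2/3) (2 * n) / fact (3 * n) \<le> fact (2 * n) / (fact (2 * n) * fact n :: real)"
      using p f by (intro frac_le) auto
    hence "pochhammer (2/3) (2 * n) / fact (3 * n) \<le> (1 / fact n :: real)" by simp
    hence "c ^ n * (pochhammer (2/3) (2 * n) / fact (3 * n)) \<le> c ^ n * (1 / fact n)"
      by (intro mult_left_mono) (auto simp: c_def)
    moreover have "0 \<le> c ^ n * (pochhammer (2/3) (2 * n) / fact (3 * n))" using p by (simp add: c_def)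
    ultimately show "norm (\<bar>t\<bar> ^ (2 * n) / fact (2 * n) * area_moment (2 * n)) \<le> c ^ n / fact n" unfolding eq by simp
  qed
  show "(\<lambda>n. c ^ n / fact n) \<longlonglongrightarrow> 0"
    using summable_LIMSEQ_zero[OF summable_exp_generic[of c]] by (simp add: divide_inverse mult.commute)
qed

section \<open>The law with the candidate density and the equivalent forms of the density\<close>

definition area_law :: "real measure" where
  "area_law = density lborel (\<lambda>x. ennreal (area_density x))"

lemma area_law_moment: "has_bochner_integral area_law (\<lambda>x. x ^ n) (area_moment n)"
proof (rule has_bochner_integral_nn_integral)
  have "(\<integral>\<^sup>+x. ennreal (x ^ n) \<partial>area_law) = (\<integral>\<^sup>+x. ennreal (x ^ n) * ennreal (area_density x) \<partial>lborel)"
    unfolding area_law_def by (subst nn_integral_density) (auto simp: mult.commute)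
  thus "(\<integral>\<^sup>+x. ennreal (x ^ n) \<partial>area_law) = ennreal (area_moment n)"
    unfolding area_density_moment_beta area_moment_beta .
  show "AE x in area_law. 0 \<le> x ^ n"
    unfolding area_law_def
  proof (subst AE_density)
    show "AE x in lborel. 0 < ennreal (area_density x) \<longrightarrow> 0 \<le> x ^ n"
    proof (intro AE_I2 impI)
      fix x :: real
      assume "0 < ennreal (area_density x)"
      hence "0 < x" using area_density_eq_0[of x] by (cases "x \<le> 0") simp_all
      thus "0 \<le> x ^ n" by simp
    qed
  qed simp
  show "0 \<le> area_moment n"
    unfolding area_moment_def by (intro divide_nonneg_nonneg mult_nonneg_nonneg less_imp_le[OF Gamma_real_pos]) (auto simp: add_nonneg_pos)
qed (simp add: area_law_def)

text \<open>Total mass 1 is the moment of order 0.\<close>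

lemma real_distribution_area_law: "real_distribution area_law"
proof -
  have "prob_space area_law"
  proof
    have "(\<integral>\<^sup>+x. 1 \<partial>area_law) = 1"
      using area_density_moment_beta[of 0, unfolded area_moment_beta]
      unfolding area_law_def by (subst nn_integral_density) (auto simp: area_moment_def Gamma_thirds_nonzero)
    thus "emeasure area_law (space area_law) = 1" by simp
  qed
  thus ?thesis by (intro real_distribution.intro real_distribution_axioms.intro) (auto simp: area_law_def)
qed

text \<open>The symmetry of U yields the first form, unfolding its definition the second, and
  Kummer's transformation applied to each 1F1 absorbs the exponential into the third.\<close>

lemma area_density_forms:
  assumes x: "0 < x"
  shows "area_density x = 2 powr (7/6) / Gamma (2/3) * exp (- (3/2) * x\<^sup>2) * tricomi_U (- 1/6) (2/3) (3/2 * x\<^sup>2)" (is ?U1)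
    and "area_density x = exp (- (3/2) * x\<^sup>2)
          * (2 powr (1/2) / pi powr (1/2) * hyp1F1 (- 1/6) (2/3) (3/2 * x\<^sup>2)
             + 2 powr (- 1/6) * 3 powr (1/3) / Gamma (5/6) * x powr (2/3) * hyp1F1 (1/6) (4/3) (3/2 * x\<^sup>2))" (is ?F1)
    and "area_density x = 2 powr (1/2) / pi powr (1/2) * hyp1F1 (5/6) (2/3) (- (3/2) * x\<^sup>2)
        + 2 powr (- 1/6) * 3 powr (1/3) / Gamma (5/6) * x powr (2/3) * hyp1F1 (7/6) (4/3) (- (3/2) * x\<^sup>2)" (is ?F2)
proof -
  define y where "y = 3/2 * x\<^sup>2"
  have y: "0 < y" using x by (simp add: y_def)
  have yp: "y powr (1/3) = (3/2) powr (1/3) * x powr (2/3)"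
  proof -
    have "(x\<^sup>2) powr (1/3) = x powr (2 * (1/3))" unfolding powr_powr[symmetric] using x by simp
    moreover have "y powr (1/3) = (3/2) powr (1/3) * (x\<^sup>2) powr (1/3)"
      unfolding y_def by (rule powr_mult)
    ultimately show ?thesis by simp
  qed
  have U: "tricomi_U (- 1/6) (2/3) y = y powr (1/3) * tricomi_U (1/6) (4/3) y"
    using tricomi_U_kummer[OF y, of "- 1/6" "2/3"] by simp
  have c: "2 powr (5/6) * 3 powr (1/3) = (2 powr (7/6) * (3/2) powr (1/3) :: real)"
  proof -
    have "2 powr (5/6) = 2 powr (7/6) / (2 :: real) powr (1/3)" by (simp add: powr_diff[symmetric])
    thus ?thesis by (simp add: powr_divide)
  qed
  have "area_density x = 2 powr (5/6) * 3 powr (1/3) / Gamma (2/3) * x powr (2/3) * exp (- y) * tricomi_U (1/6) (4/3) y"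
    using x by (simp add: area_density_def y_def)
  hence U1: "area_density x = 2 powr (7/6) / Gamma (2/3) * exp (- y) * tricomi_U (- 1/6) (2/3) y"
    unfolding c U yp by (simp add: mult_ac)
  thus ?U1 by (simp add: y_def)
  have "area_density x = exp (- y) * (2 powr (7/6) / Gamma (2/3) * (Gamma (1/3) / Gamma (1/6)) * hyp1F1 (- 1/6) (2/3) y
     + 2 powr (7/6) / Gamma (2/3) * (Gamma (- 1/3) / Gamma (- 1/6) * (3/2) powr (1/3)) * x powr (2/3) * hyp1F1 (1/6) (4/3) y)"
    unfolding U1 by (simp add: tricomi_U_def yp algebra_simps)
  hence F1: "area_density x = exp (- y) * (2 powr (1/2) / pi powr (1/2) * hyp1F1 (- 1/6) (2/3) y
     + 2 powr (- 1/6) * 3 powr (1/3) / Gamma (5/6) * x powr (2/3) * hyp1F1 (1/6) (4/3) y)"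
    unfolding density_constant_3 density_constant_4 .
  thus ?F1 by (simp add: y_def)
  have "hyp1F1 (5/6) (2/3) (- y) = exp (- y) * hyp1F1 (- 1/6) (2/3) y" "hyp1F1 (7/6) (4/3) (- y) = exp (- y) * hyp1F1 (1/6) (4/3) y"
    using hyp1F1_kummer_transformation[of "2/3" "5/6" y] hyp1F1_kummer_transformation[of "4/3" "7/6" y] by simp_all
  thus ?F2 using F1 by (simp add: y_def algebra_simps)
qed

lemma area_density_series:
  assumes x: "0 < x"
  defines "s1 \<equiv> \<lambda>n. (-1) ^ n * (Gamma (real n + 5/6) / (fact n * Gamma (real n + 2/3))) * (3/2) powr (real n + 1/2) * x ^ (2 * n)"
    and "s2 \<equiv> \<lambda>n. (-1) ^ n * (Gamma (real n + 7/6) / (fact n * Gamma (real n + 4/3))) * (3/2) powr (real n + 5/6) * x powr (2 * real n + 2/3)"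
    and "c \<equiv> 2 powr (2/3) * Gamma (1/3) / (3 powr (1/2) * pi)"
  shows "summable s1" "summable s2" "area_density x = c * (\<Sum>n. s1 n) + c * (\<Sum>n. s2 n)"
proof -
  have 1: "s1 sums (Gamma (5/6) / Gamma (2/3) * (3/2) powr (1/2) * hyp1F1 (5/6) (2/3) (- (3/2) * x\<^sup>2))"
    unfolding s1_def by (rule series_hyp1F1) auto
  have "x powr (2 * real n + 2/3) = x ^ (2 * n) * x powr (2/3)" for n
    using x by (simp add: powr_add powr_realpow[symmetric])
  hence "s2 = (\<lambda>n. ((-1) ^ n * (Gamma (real n + 7/6) / (fact n * Gamma (real n + 4/3))) * (3/2) powr (real n + 5/6) * x ^ (2 * n)) * x powr (2/3))"
    by (simp add: s2_def fun_eq_iff)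
  hence 2: "s2 sums (Gamma (7/6) / Gamma (4/3) * (3/2) powr (5/6) * hyp1F1 (7/6) (4/3) (- (3/2) * x\<^sup>2) * x powr (2/3))"
    using sums_mult2[OF series_hyp1F1[of "7/6" "4/3" "5/6" x], of "x powr (2/3)"] by simp
  show "summable s1" "summable s2" using 1 2 by (auto simp: sums_iff)
  have "c * (\<Sum>n. s1 n) = (c * (Gamma (5/6) / Gamma (2/3) * (3/2) powr (1/2))) * hyp1F1 (5/6) (2/3) (- (3/2) * x\<^sup>2)"
    using 1 by (simp add: sums_iff)
  also have "\<dots> = 2 powr (1/2) / pi powr (1/2) * hyp1F1 (5/6) (2/3) (- (3/2) * x\<^sup>2)"
    unfolding c_def density_constant_1 ..
  finally have e1: "c * (\<Sum>n. s1 n) = 2 powr (1/2) / pi powr (1/2) * hyp1F1 (5/6) (2/3) (- (3/2) * x\<^sup>2)" .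
  have "c * (\<Sum>n. s2 n) = (c * (Gamma (7/6) / Gamma (4/3) * (3/2) powr (5/6))) * x powr (2/3) * hyp1F1 (7/6) (4/3) (- (3/2) * x\<^sup>2)"
    using 2 by (simp add: sums_iff)
  also have "\<dots> = 2 powr (- 1/6) * 3 powr (1/3) / Gamma (5/6) * x powr (2/3) * hyp1F1 (7/6) (4/3) (- (3/2) * x\<^sup>2)"
    unfolding c_def density_constant_2 ..
  finally have e2: "c * (\<Sum>n. s2 n) = 2 powr (- 1/6) * 3 powr (1/3) / Gamma (5/6) * x powr (2/3) * hyp1F1 (7/6) (4/3) (- (3/2) * x\<^sup>2)" .
  show "area_density x = c * (\<Sum>n. s1 n) + c * (\<Sum>n. s2 n)"
    unfolding e1 e2 by (rule area_density_forms(3)[OF x])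
qed

lemma (in standard_brownian_motion) distributed_running_max_area:
  "distributed M lborel (running_max_area B) (\<lambda>x. ennreal (area_density x))"
proof -
  have "distr M borel (running_max_area B) = area_law"
  proof (rule distribution_eq_of_moments_eq)
    show "real_distribution (distr M borel (running_max_area B))" by (rule real_distribution_distr) simp
    show "real_distribution area_law" by (rule real_distribution_area_law)
    have m: "has_bochner_integral (distr M borel (running_max_area B)) (\<lambda>x. x ^ n) (area_moment n)" for n
      using running_max_area_moment[of n] by (simp add: has_bochner_integral_iff integrable_distr_eq integral_distr area_moment_def)
    show "integrable (distr M borel (running_max_area B)) (\<lambda>x. x ^ n)" "integrable area_law (\<lambda>x. x ^ n)"
      "(\<integral>x. x ^ n \<partial>distr M borel (running_max_area B)) = (\<integral>x. x ^ n \<partial>area_law)" for n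
      using m[of n] area_law_moment[of n] by (auto simp: has_bochner_integral_iff)
    show "(\<lambda>n. \<bar>t\<bar> ^ (2 * n) / fact (2 * n) * (\<integral>x. x ^ (2 * n) \<partial>area_law)) \<longlonglongrightarrow> 0" for t
      using area_moment_growth[of t] has_bochner_integral_integral_eq[OF area_law_moment] by simp
  qed
  moreover have "distr M lborel (running_max_area B) = distr M borel (running_max_area B)" by (rule distr_cong) auto
  ultimately show ?thesis by (simp add: distributed_def area_law_def)
qed

theorem theorem1p8:
  fixes M :: "'a measure" and B :: "real \<Rightarrow> 'a \<Rightarrow> real"
  assumes "standard_brownian_motion M B"
  shows "\<exists>f :: real \<Rightarrow> real.
    distributed M lborel (running_max_area B) (\<lambda>x. ennreal (f x)) \<and>
    (\<forall>x. 0 \<le> f x) \<and>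
    (\<forall>x\<le>0. f x = 0) \<and>
    (\<forall>x>0.
      summable (\<lambda>n. (-1) ^ n * (Gamma (real n + 5/6) / (fact n * Gamma (real n + 2/3)))
          * (3/2) powr (real n + 1/2) * x ^ (2 * n)) \<and>
      summable (\<lambda>n. (-1) ^ n * (Gamma (real n + 7/6) / (fact n * Gamma (real n + 4/3)))
          * (3/2) powr (real n + 5/6) * x powr (2 * real n + 2/3)) \<and>
      f x =
        2 powr (2/3) * Gamma (1/3) / (3 powr (1/2) * pi)
          * (\<Sum>n. (-1) ^ n * (Gamma (real n + 5/6) / (fact n * Gamma (real n + 2/3)))
              * (3/2) powr (real n + 1/2) * x ^ (2 * n))
        + 2 powr (2/3) * Gamma (1/3) / (3 powr (1/2) * pi)
          * (\<Sum>n. (-1) ^ n * (Gamma (real n + 7/6) / (fact n * Gamma (real n + 4/3)))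
              * (3/2) powr (real n + 5/6) * x powr (2 * real n + 2/3)) \<and>
      f x =
        2 powr (1/2) / pi powr (1/2) * hyp1F1 (5/6) (2/3) (- (3/2) * x\<^sup>2)
        + 2 powr (-1/6) * 3 powr (1/3) / Gamma (5/6)
          * x powr (2/3) * hyp1F1 (7/6) (4/3) (- (3/2) * x\<^sup>2) \<and>
      f x =
        exp (- (3/2) * x\<^sup>2)
          * (2 powr (1/2) / pi powr (1/2) * hyp1F1 (-1/6) (2/3) (3/2 * x\<^sup>2)
             + 2 powr (-1/6) * 3 powr (1/3) / Gamma (5/6)
               * x powr (2/3) * hyp1F1 (1/6) (4/3) (3/2 * x\<^sup>2)) \<and>
      f x =
        2 powr (7/6) / Gamma (2/3) * exp (- (3/2) * x\<^sup>2)
          * tricomi_U (-1/6) (2/3) (3/2 * x\<^sup>2) \<and>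
      f x =
        2 powr (5/6) * 3 powr (1/3) / Gamma (2/3) * x powr (2/3) * exp (- (3/2) * x\<^sup>2)
          * tricomi_U (1/6) (4/3) (3/2 * x\<^sup>2))"
proof (intro exI[of _ area_density] conjI)
  show "distributed M lborel (running_max_area B) (\<lambda>x. ennreal (area_density x))"
    by (rule standard_brownian_motion.distributed_running_max_area[OF assms])
  show "\<forall>x. 0 \<le> area_density x" by (simp add: area_density_nonneg)
  show "\<forall>x\<le>0. area_density x = 0" by (simp add: area_density_eq_0)
  show "\<forall>x>0.
      summable (\<lambda>n. (-1) ^ n * (Gamma (real n + 5/6) / (fact n * Gamma (real n + 2/3)))
          * (3/2) powr (real n + 1/2) * x ^ (2 * n)) \<and>
      summable (\<lambda>n. (-1) ^ n * (Gamma (real n + 7/6) / (fact n * Gamma (real n + 4/3)))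
          * (3/2) powr (real n + 5/6) * x powr (2 * real n + 2/3)) \<and>
      area_density x =
        2 powr (2/3) * Gamma (1/3) / (3 powr (1/2) * pi)
          * (\<Sum>n. (-1) ^ n * (Gamma (real n + 5/6) / (fact n * Gamma (real n + 2/3)))
              * (3/2) powr (real n + 1/2) * x ^ (2 * n))
        + 2 powr (2/3) * Gamma (1/3) / (3 powr (1/2) * pi)
          * (\<Sum>n. (-1) ^ n * (Gamma (real n + 7/6) / (fact n * Gamma (real n + 4/3)))
              * (3/2) powr (real n + 5/6) * x powr (2 * real n + 2/3)) \<and>
      area_density x =
        2 powr (1/2) / pi powr (1/2) * hyp1F1 (5/6) (2/3) (- (3/2) * x\<^sup>2)
        + 2 powr (-1/6) * 3 powr (1/3) / Gamma (5/6)
          * x powr (2/3) * hyp1F1 (7/6) (4/3) (- (3/2) * x\<^sup>2) \<and>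
      area_density x =
        exp (- (3/2) * x\<^sup>2)
          * (2 powr (1/2) / pi powr (1/2) * hyp1F1 (-1/6) (2/3) (3/2 * x\<^sup>2)
             + 2 powr (-1/6) * 3 powr (1/3) / Gamma (5/6)
               * x powr (2/3) * hyp1F1 (1/6) (4/3) (3/2 * x\<^sup>2)) \<and>
      area_density x =
        2 powr (7/6) / Gamma (2/3) * exp (- (3/2) * x\<^sup>2)
          * tricomi_U (-1/6) (2/3) (3/2 * x\<^sup>2) \<and>
      area_density x =
        2 powr (5/6) * 3 powr (1/3) / Gamma (2/3) * x powr (2/3) * exp (- (3/2) * x\<^sup>2)
          * tricomi_U (1/6) (4/3) (3/2 * x\<^sup>2)"
    using area_density_series area_density_forms by (auto simp: area_density_def)
qed

end
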